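(* Let $n\ge1$, let $\mathcal{H},\mathcal{K}$ be Hilbert spaces, and let $T\in\mathbb{S}_n^B(\mathcal{H})$ and $S\in\mathbb{S}_n^B(\mathcal{K})$ be Beurling tuples. Then $T\cong S$ if and only if $\Theta_T\cong\Theta_S$.
   Context: Hilbert spaces are complex and separable; $I_n=\{1,\dots,n\}$. For a contraction $X$, $D_X=(I-X^*X)^{1/2}$; $X\in C_{\cdot0}$ means $X^{*m}\to0$ strongly. For a commuting $n$-tuple of contractions $T$ on $\mathcal{H}$ let $\mathbb{S}_n^{-1}(T,T^* )=\sum_{k\in\{0,1\}^n}(-1)^{|k|}T^kT^{*k}$, $T^k=T_1^{k_1}\cdots T_n^{k_n}$, $T^{*k}=T_1^{*k_1}\cdots T_n^{*k_n}$, $|k|=\sum_ik_i$. $T$ is a Szegő tuple if $\mathbb{S}_n^{-1}(T,T^* )\ge0$ and all $T_i\in C_{\cdot0}$; it is a Beurling tuple, $T\in\mathbb{S}_n^B(\mathcal{H})$, if moreover $D_{T_i}D_{T_j}=0$ for all $i\ne j$. $D_{T^*}=(\mathbb{S}_n^{-1}(T,T^* ))^{1/2}$, $\mathcal{D}_{T^*}=\overline{\mathrm{ran}}\,D_{T^*}$. With $\Delta_X(A)=XAX^*$ and $[A,B]=AB-BA$, set $D_{j,T}^2=\prod_{k\in I_n\setminus\{j\}}(I-\Delta_{T_k})(D_{T_j}^2)$ and, for $i\ne j$, $\delta_{ij}(T)=\prod_{k\in I_n\setminus\{i,j\}}(I-\Delta_{T_k})([T_j,T_i^*])$ (products are compositions,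 empty product = identity). $\boldsymbol{D}_T^2$ is the operator on $\mathcal{H}^n$ with $(j,j)$ entry $D_{j,T}^2$ and $(i,j)$ entry $\delta_{ij}(T)$, $i\neq j$; it is non-negative for Beurling tuples, $\boldsymbol{D}_T$ is its non-negative square root and $\boldsymbol{\mathcal{D}}_T=\overline{\mathrm{ran}}\,\boldsymbol{D}_T\subseteq\mathcal{H}^n$. The characteristic function of a Beurling tuple $T$ is the (well-defined, inner) operator-valued analytic function $\Theta_T:\mathbb{D}^n\to\mathcal{B}(\boldsymbol{\mathcal{D}}_T,\mathcal{D}_{T^*})$ determined by $$\Theta_T(w)\boldsymbol{D}_T\tilde h=D_{T^*}\prod_{k=1}^n(I_{\mathcal{H}}-w_kT_k^* )^{-1}\sum_{j=1}^n(w_jI_{\mathcal{H}}-T_j)\prod_{i\in I_n\setminus\{j\}}(I_{\mathcal{H}}-w_iT_i^* )h_j$$ for $w\in\mathbb{D}^n$, $\tilde h=(h_1,\dots,h_n)^t\in\mathcal{H}^n$. $T\cong S$ (joint unitary equivalence) means there is a unitary $U:\mathcal{H}\to\mathcal{K}$ with $UT_iU^*=S_i$ for all $i\in I_n$. $\Theta_T\cong\Theta_S$ (coincidence) means there are unitaries $\tau:\boldsymbol{\mathcal{D}}_S\to\boldsymbol{\mathcal{D}}_T$ and $\tau_*:\mathcal{D}_{S^*}\to\mathcal{D}_{T^*}$ with $\Theta_T(w)=\tau_*\Theta_S(w)\tau^*$ for all $w\in\mathbb{D}^n$. *)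

theory Defs
  imports "HOL-Analysis.Analysis"
begin

section \<open>Complex Hilbert spaces\<close>

text \<open>
  The complex inner product is linear in its first argument.  The norm and topology are inherited
  from \<^class>\<open>real_inner\<close>, whose real inner product is the real part of the complex one, so
  that the norm of x is the square root of \<open>cinner x x\<close>.
\<close>

class complex_inner = real_inner +
  fixes scaleC :: "complex \<Rightarrow> 'a \<Rightarrow> 'a" (infixr "*\<^sub>C" 75)
    and cinner :: "'a \<Rightarrow> 'a \<Rightarrow> complex"
  assumes scaleC_add_right: "c *\<^sub>C (x + y) = c *\<^sub>C x + c *\<^sub>C y"
    and scaleC_add_left: "(c + d) *\<^sub>C x = c *\<^sub>C x + d *\<^sub>C x"
    and scaleC_scaleC: "c *\<^sub>C d *\<^sub>C x = (c * d) *\<^sub>C x"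
    and scaleC_of_real: "complex_of_real r *\<^sub>C x = r *\<^sub>R x"
    and cinner_commute: "cinner x y = cnj (cinner y x)"
    and cinner_add_left: "cinner (x + y) z = cinner x z + cinner y z"
    and cinner_scaleC_left: "cinner (c *\<^sub>C x) y = c * cinner x y"
    and inner_eq_Re_cinner: "inner x y = Re (cinner x y)"

text \<open>Complete and separable: for metric spaces separability is second countability.\<close>

class chilbert_space = complex_inner + polish_space

instantiation complex :: chilbert_space
begin

definition scaleC_complex :: "complex \<Rightarrow> complex \<Rightarrow> complex"
  where "scaleC_complex c x = c * x"

definition cinner_complex :: "complex \<Rightarrow> complex \<Rightarrow> complex"
  where "cinner_complex x y = x * cnj y"

instance
  by standard
    (auto simp: scaleC_complex_def cinner_complex_def inner_complex_def algebra_simps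
      scaleR_conv_of_real)

end

text \<open>The Hilbert space direct sum of copies of one space, indexed by a finite type.\<close>

instantiation vec :: (complex_inner, finite) complex_inner
begin

definition scaleC_vec :: "complex \<Rightarrow> 'a ^ 'b \<Rightarrow> 'a ^ 'b"
  where "scaleC_vec c x = (\<chi> i. c *\<^sub>C (x $ i))"

definition cinner_vec :: "'a ^ 'b \<Rightarrow> 'a ^ 'b \<Rightarrow> complex"
  where "cinner_vec x y = (\<Sum>i\<in>UNIV. cinner (x $ i) (y $ i))"

instance
proof
  fix x y :: "'a ^ 'b"
  show "cinner x y = cnj (cinner y x)"
    unfolding cinner_vec_def cnj_sum by (rule sum.cong) (auto intro: cinner_commute)
qed (auto simp: scaleC_vec_def cinner_vec_def inner_vec_def vec_eq_iff scaleC_add_right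
      scaleC_add_left scaleC_scaleC scaleC_of_real cinner_add_left cinner_scaleC_left
      inner_eq_Re_cinner sum.distrib sum_distrib_left)

end


section \<open>Operators\<close>

text \<open>
  Bounded operators from a closed subspace \<open>E\<close> to a closed subspace \<open>F\<close>.  They are extensional
  functions (undefined off \<open>E\<close>), so that two of them are equal iff they agree on \<open>E\<close>; for
  \<open>E = UNIV\<close> this is no restriction.
\<close>

definition bounded_ops ::
    "'a::complex_inner set \<Rightarrow> 'b::complex_inner set \<Rightarrow> ('a \<Rightarrow> 'b) set"
  where "bounded_ops E F = {A \<in> E \<rightarrow>\<^sub>E F.
    (\<forall>x\<in>E. \<forall>y\<in>E. A (x + y) = A x + A y) \<and>
    (\<forall>c. \<forall>x\<in>E. A (c *\<^sub>C x) = c *\<^sub>C A x) \<and>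
    (\<exists>K. \<forall>x\<in>E. norm (A x) \<le> K * norm x)}"

definition adjoint_on ::
    "'a::complex_inner set \<Rightarrow> 'b::complex_inner set \<Rightarrow> ('a \<Rightarrow> 'b) \<Rightarrow> ('b \<Rightarrow> 'a)"
  where "adjoint_on E F A =
    (THE B. B \<in> bounded_ops F E \<and> (\<forall>x\<in>E. \<forall>y\<in>F. cinner (A x) y = cinner x (B y)))"

abbreviation adj :: "('a::complex_inner \<Rightarrow> 'b::complex_inner) \<Rightarrow> ('b \<Rightarrow> 'a)"
  where "adj \<equiv> adjoint_on UNIV UNIV"

definition unitary_on ::
    "'a::complex_inner set \<Rightarrow> 'b::complex_inner set \<Rightarrow> ('a \<Rightarrow> 'b) \<Rightarrow> bool"
  where "unitary_on E F U \<longleftrightarrow> U \<in> bounded_ops E F \<and> U ` E = F \<and>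
    (\<forall>x\<in>E. \<forall>y\<in>E. cinner (U x) (U y) = cinner x y)"

definition positive_op :: "('a::complex_inner \<Rightarrow> 'a) \<Rightarrow> bool"
  where "positive_op A \<longleftrightarrow> A \<in> bounded_ops UNIV UNIV \<and> (\<forall>h. cinner (A h) h \<in> \<real>\<^sub>\<ge>\<^sub>0)"

definition op_sqrt :: "('a::complex_inner \<Rightarrow> 'a) \<Rightarrow> ('a \<Rightarrow> 'a)"
  where "op_sqrt A = (THE B. positive_op B \<and> B \<circ> B = A)"

definition contraction :: "('a::complex_inner \<Rightarrow> 'a) \<Rightarrow> bool"
  where "contraction X \<longleftrightarrow> X \<in> bounded_ops UNIV UNIV \<and> (\<forall>h. norm (X h) \<le> norm h)"

definition defect_op :: "('a::complex_inner \<Rightarrow> 'a) \<Rightarrow> ('a \<Rightarrow> 'a)"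
  where "defect_op X = op_sqrt (\<lambda>h. h - adj X (X h))"

definition C_dot_0 :: "('a::complex_inner \<Rightarrow> 'a) \<Rightarrow> bool"
  where "C_dot_0 X \<longleftrightarrow> (\<forall>h. (\<lambda>m. (adj X ^^ m) h) \<longlonglongrightarrow> 0)"

text \<open>
  Composition of a finite family of maps.  The order of the factors is left open by
  \<^const>\<open>Finite_Set.fold\<close>; the families below commute pairwise, and then
  \<open>comp_prod_insert\<close> determines the composition.
\<close>

definition comp_prod :: "('i \<Rightarrow> 'x \<Rightarrow> 'x) \<Rightarrow> 'i set \<Rightarrow> 'x \<Rightarrow> 'x"
  where "comp_prod f I = Finite_Set.fold (\<lambda>i g. f i \<circ> g) id I"

lemma comp_prod_empty [simp]: "comp_prod f {} = id"
  by (simp add: comp_prod_def)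

lemma comp_prod_insert:
  assumes "\<And>i j. f i \<circ> f j = f j \<circ> f i" and "finite I" and "i \<notin> I"
  shows "comp_prod f (insert i I) = f i \<circ> comp_prod f I"
proof -
  interpret comp_fun_commute "\<lambda>i g. f i \<circ> g"
    by standard (simp add: fun_eq_iff, metis assms(1) comp_apply)
  show ?thesis
    using assms(2,3) by (simp add: comp_prod_def)
qed


section \<open>Beurling tuples\<close>

text \<open>
  An n-tuple of operators is a family indexed by a finite type with n elements, which plays the
  role of the index set \<open>{1, \<dots>, n}\<close>.
\<close>

definition commuting_contractions :: "('n::finite \<Rightarrow> 'a::complex_inner \<Rightarrow> 'a) \<Rightarrow> bool"
  where "commuting_contractions T \<longleftrightarrow>
    (\<forall>i. contraction (T i)) \<and> (\<forall>i j. T i \<circ> T j = T j \<circ> T i)"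

definition szego_inv :: "('n::finite \<Rightarrow> 'a::complex_inner \<Rightarrow> 'a) \<Rightarrow> ('a \<Rightarrow> 'a)"
  where "szego_inv T h =
    (\<Sum>k\<in>{k :: 'n \<Rightarrow> nat. \<forall>i. k i \<in> {0, 1}}. (-1) ^ (\<Sum>i\<in>UNIV. k i) *\<^sub>R
      comp_prod (\<lambda>i. T i ^^ k i) UNIV (comp_prod (\<lambda>i. adj (T i) ^^ k i) UNIV h))"

definition szego_tuple :: "('n::finite \<Rightarrow> 'a::complex_inner \<Rightarrow> 'a) \<Rightarrow> bool"
  where "szego_tuple T \<longleftrightarrow>
    commuting_contractions T \<and> positive_op (szego_inv T) \<and> (\<forall>i. C_dot_0 (T i))"

definition beurling_tuple :: "('n::finite \<Rightarrow> 'a::complex_inner \<Rightarrow> 'a) \<Rightarrow> bool"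
  where "beurling_tuple T \<longleftrightarrow>
    szego_tuple T \<and> (\<forall>i j. i \<noteq> j \<longrightarrow> defect_op (T i) \<circ> defect_op (T j) = (\<lambda>h. 0))"

definition jointly_unitarily_equivalent ::
    "('n::finite \<Rightarrow> 'a::complex_inner \<Rightarrow> 'a) \<Rightarrow> ('n \<Rightarrow> 'b::complex_inner \<Rightarrow> 'b) \<Rightarrow> bool"
  where "jointly_unitarily_equivalent T S \<longleftrightarrow>
    (\<exists>U. unitary_on UNIV UNIV U \<and> (\<forall>i. U \<circ> T i \<circ> adj U = S i))"


section \<open>Characteristic functions\<close>

definition defect_star :: "('n::finite \<Rightarrow> 'a::complex_inner \<Rightarrow> 'a) \<Rightarrow> ('a \<Rightarrow> 'a)"
  where "defect_star T = op_sqrt (szego_inv T)"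

definition defect_star_space :: "('n::finite \<Rightarrow> 'a::complex_inner \<Rightarrow> 'a) \<Rightarrow> 'a set"
  where "defect_star_space T = closure (range (defect_star T))"

text \<open>The map \<open>I - \<Delta>\<^sub>X\<close> on operators, where \<open>\<Delta>\<^sub>X\<close> takes \<open>A\<close> to \<open>X A X\<^sup>*\<close>.\<close>

definition id_minus_Delta :: "('a::complex_inner \<Rightarrow> 'a) \<Rightarrow> ('a \<Rightarrow> 'a) \<Rightarrow> ('a \<Rightarrow> 'a)"
  where "id_minus_Delta X A = (\<lambda>h. A h - X (A (adj X h)))"

definition commutator :: "('a::complex_inner \<Rightarrow> 'a) \<Rightarrow> ('a \<Rightarrow> 'a) \<Rightarrow> ('a \<Rightarrow> 'a)"
  where "commutator A B = (\<lambda>h. A (B h) - B (A h))"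

definition defect_diag ::
    "'n::finite \<Rightarrow> ('n \<Rightarrow> 'a::complex_inner \<Rightarrow> 'a) \<Rightarrow> ('a \<Rightarrow> 'a)"
  where "defect_diag j T =
    comp_prod (\<lambda>k. id_minus_Delta (T k)) (UNIV - {j}) (defect_op (T j) \<circ> defect_op (T j))"

definition defect_offdiag ::
    "'n::finite \<Rightarrow> 'n \<Rightarrow> ('n \<Rightarrow> 'a::complex_inner \<Rightarrow> 'a) \<Rightarrow> ('a \<Rightarrow> 'a)"
  where "defect_offdiag i j T =
    comp_prod (\<lambda>k. id_minus_Delta (T k)) (UNIV - {i, j}) (commutator (T j) (adj (T i)))"

definition defect_matrix_sq ::
    "('n::finite \<Rightarrow> 'a::complex_inner \<Rightarrow> 'a) \<Rightarrow> ('a ^ 'n \<Rightarrow> 'a ^ 'n)"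
  where "defect_matrix_sq T h =
    (\<chi> i. \<Sum>j\<in>UNIV. (if i = j then defect_diag j T else defect_offdiag i j T) (h $ j))"

definition defect_matrix ::
    "('n::finite \<Rightarrow> 'a::complex_inner \<Rightarrow> 'a) \<Rightarrow> ('a ^ 'n \<Rightarrow> 'a ^ 'n)"
  where "defect_matrix T = op_sqrt (defect_matrix_sq T)"

definition defect_space :: "('n::finite \<Rightarrow> 'a::complex_inner \<Rightarrow> 'a) \<Rightarrow> ('a ^ 'n) set"
  where "defect_space T = closure (range (defect_matrix T))"

definition polydisc :: "(complex ^ 'n::finite) set"
  where "polydisc = {w. \<forall>i. norm (w $ i) < 1}"

text \<open>
  For a Beurling tuple and w in the polydisc, the defining equation prescribes a bounded operator on
  the range of \<open>defect_matrix T\<close>, which is dense in \<open>defect_space T\<close>; hence the description is unique.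
\<close>

definition char_fun ::
    "('n::finite \<Rightarrow> 'a::complex_inner \<Rightarrow> 'a) \<Rightarrow> complex ^ 'n \<Rightarrow> ('a ^ 'n \<Rightarrow> 'a)"
  where "char_fun T w =
    (THE \<Theta>. \<Theta> \<in> bounded_ops (defect_space T) (defect_star_space T) \<and>
      (\<forall>h. \<Theta> (defect_matrix T h) =
        defect_star T
          (comp_prod (\<lambda>k. inv (\<lambda>x. x - (w $ k) *\<^sub>C adj (T k) x)) UNIV
            (\<Sum>j\<in>UNIV. (\<lambda>x. (w $ j) *\<^sub>C x - T j x)
              (comp_prod (\<lambda>i x. x - (w $ i) *\<^sub>C adj (T i) x) (UNIV - {j}) (h $ j))))))"

definition char_funs_coincide ::
    "('n::finite \<Rightarrow> 'a::complex_inner \<Rightarrow> 'a) \<Rightarrow> ('n \<Rightarrow> 'b::complex_inner \<Rightarrow> 'b) \<Rightarrow> bool"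
  where "char_funs_coincide T S \<longleftrightarrow>
    (\<exists>\<tau> \<tau>s. unitary_on (defect_space S) (defect_space T) \<tau> \<and>
      unitary_on (defect_star_space S) (defect_star_space T) \<tau>s \<and>
      (\<forall>w\<in>polydisc. \<forall>x\<in>defect_space T.
        char_fun T w x =
          \<tau>s (char_fun S w (adjoint_on (defect_space S) (defect_space T) \<tau> x))))"

end

theory Submission
  imports Defs
begin

text \<open>
  The model behind the theorem is a dilation.  Let D be the defect operator of the adjoint tuple of
  T.  For a Szego tuple the map \<open>dil\<close>, which sends h to the function
  \<open>z \<mapsto> D \<Prod>\<^sub>i (I - z\<^sub>i T\<^sub>i\<^sup>*)\<^sup>-\<^sup>1 h\<close>, is an isometry into the Hardy space of the polydisc and turns
  \<open>T\<^sub>i\<^sup>*\<close> into the backward shift (\<open>norm_dil\<close>, \<open>dil_Ts\<close>); it is isometric because the defining series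
  telescopes in each coordinate.  Functions are represented by their Taylor coefficients, as
  square-summable families, and their values by inner products with the Szego kernel.

  The range of \<open>dil\<close> is invariant under the backward shifts, so its complement M is invariant under
  the shifts.  The condition \<open>D\<^bsub>T i\<^esub> D\<^bsub>T j\<^esub> = 0\<close> says that the shifts restricted to M are doubly
  commuting (\<open>co_shift_shift\<close>).  Let P be the projection onto the wandering subspace, the vectors of M
  that are killed by the adjoints of all restricted shifts.  The compressions \<open>corner i\<close> of the shifts
  from the range of \<open>dil\<close> to M, followed by P, have the squared defect matrix as their Gram matrix
  (\<open>cinner_defect_column\<close>), and the values of their sum \<open>defect_row\<close> are exactly the right-hand side
  of the formula for the characteristic function (\<open>cinner_defect_row_kernel\<close>).  So multiplication by
  that function is isometric on constants, and the function is well defined.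

  By a Wold argument the shifts of the range of \<open>defect_row\<close> span M within the Hardy space with
  coefficients in the closed range of D (\<open>annihilator_zero\<close>).  Hence the characteristic function
  determines M, the range of \<open>dil\<close>, and T up to unitary equivalence: if the functions of T and S
  coincide, then the unitary between the coefficient spaces, applied coefficientwise, takes one
  model onto the other (\<open>dil_intertwiner\<close>).  The converse is a transport of all constructions along a
  unitary; it needs that positive square roots are unique and that the characteristic function is
  well defined.

  The tools for this are the Riesz representation, adjoints, and the existence and uniqueness of
  positive square roots.  They are proved for complete complex inner product spaces.
\<close>

instance chilbert_space \<subseteq> banach ..

section \<open>Complex inner product spaces\<close>

lemma cinner_flip: "cinner x y = cinner (z :: 'b::complex_inner) w \<Longrightarrow>
    cinner y x = cinner w (z :: 'b::complex_inner)" for x y :: "'a::complex_inner"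
  by (metis cinner_commute)

lemma cinner_add_right: "cinner x (y + z) = cinner x y + cinner x (z :: 'a::complex_inner)"
  using cinner_commute[of x "y + z"] cinner_commute[of x y] cinner_commute[of x z]
  by (simp add: cinner_add_left)

lemma cinner_scaleC_right: "cinner x (c *\<^sub>C y) = cnj c * cinner x (y :: 'a::complex_inner)"
  using cinner_commute[of x "c *\<^sub>C y"] cinner_commute[of x y]
  by (simp add: cinner_scaleC_left)

lemma cinner_scaleR_left: "cinner (r *\<^sub>R x) y = of_real r * cinner (x :: 'a::complex_inner) y"
  by (simp flip: scaleC_of_real add: cinner_scaleC_left)

lemma cinner_scaleR_right: "cinner x (r *\<^sub>R y) = of_real r * cinner x (y :: 'a::complex_inner)"
  by (simp flip: scaleC_of_real add: cinner_scaleC_right)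

lemma scaleC_one [simp]: "1 *\<^sub>C x = (x :: 'a::complex_inner)"
  using scaleC_of_real[of 1 x] by simp

lemma scaleC_zero_left [simp]: "0 *\<^sub>C x = (0 :: 'a::complex_inner)"
  using scaleC_of_real[of 0 x] by simp

lemma scaleC_zero_right [simp]: "c *\<^sub>C 0 = (0 :: 'a::complex_inner)"
  using scaleC_add_right[of c 0 "0::'a"] by simp

lemma scaleC_minus_one: "(-1) *\<^sub>C x = - (x :: 'a::complex_inner)"
  using scaleC_of_real[of "-1" x] by simp

lemma scaleC_minus_right: "c *\<^sub>C (- x) = - (c *\<^sub>C (x :: 'a::complex_inner))"
  using scaleC_add_right[of c x "- x"] by (simp add: eq_neg_iff_add_eq_0 add.commute)

lemma scaleC_diff_right: "c *\<^sub>C (x - y) = c *\<^sub>C x - c *\<^sub>C (y :: 'a::complex_inner)"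
  using scaleC_add_right[of c x "- y"] by (simp add: scaleC_minus_right)

lemma cinner_zero_left [simp]: "cinner 0 (y :: 'a::complex_inner) = 0"
  using cinner_add_left[of 0 0 y] by simp

lemma cinner_zero_right [simp]: "cinner (y :: 'a::complex_inner) 0 = 0"
  using cinner_add_right[of y 0 0] by simp

lemma cinner_minus_left: "cinner (- x) y = - cinner (x :: 'a::complex_inner) y"
  using cinner_scaleR_left[of "-1" x y] by simp

lemma cinner_minus_right: "cinner x (- y) = - cinner (x :: 'a::complex_inner) y"
  using cinner_scaleR_right[of x "-1" y] by simp

lemma cinner_diff_left: "cinner (x - y) z = cinner x z - cinner y (z :: 'a::complex_inner)"
  using cinner_add_left[of x "- y" z] by (simp add: cinner_minus_left)

lemma cinner_diff_right: "cinner x (y - z) = cinner x y - cinner x (z :: 'a::complex_inner)"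
  using cinner_add_right[of x y "- z"] by (simp add: cinner_minus_right)

lemma cinner_sum_left: "cinner (\<Sum>i\<in>I. f i) y = (\<Sum>i\<in>I. cinner (f i) (y :: 'a::complex_inner))"
  by (induction I rule: infinite_finite_induct) (auto simp: cinner_add_left)

lemma cinner_sum_right: "cinner y (\<Sum>i\<in>I. f i) = (\<Sum>i\<in>I. cinner (y :: 'a::complex_inner) (f i))"
  by (induction I rule: infinite_finite_induct) (auto simp: cinner_add_right)

lemma cinner_self: "cinner x x = complex_of_real ((norm (x :: 'a::complex_inner))\<^sup>2)"
proof -
  have "Im (cinner x x) = 0"
    using cinner_commute[of x x] by (metis cnj.simps(2) neg_equal_zero)
  moreover have "Re (cinner x x) = (norm x)\<^sup>2"
    by (simp flip: inner_eq_Re_cinner add: power2_norm_eq_inner)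
  ultimately show ?thesis
    by (simp add: complex_eq_iff)
qed

lemma norm_cinner_self: "norm (cinner x x) = (norm (x :: 'a::complex_inner))\<^sup>2"
  by (simp only: cinner_self norm_of_real) simp

lemma cinner_self_zero [simp]: "cinner x x = 0 \<longleftrightarrow> (x :: 'a::complex_inner) = 0"
  by (simp add: cinner_self)

lemma cinner_eqI: "x = (y :: 'a::complex_inner)" if "\<And>z. cinner x z = cinner y z"
proof -
  have "cinner (x - y) (x - y) = 0"
    by (simp add: cinner_diff_left that)
  then show ?thesis
    by simp
qed

lemma norm_scaleC: "norm (c *\<^sub>C x) = norm c * norm (x :: 'a::complex_inner)"
proof -
  have "complex_of_real ((norm (c *\<^sub>C x))\<^sup>2) = of_real ((norm c * norm x)\<^sup>2)"
    using complex_norm_square[of c]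
    by (simp only: cinner_self[symmetric] cinner_scaleC_left cinner_scaleC_right power_mult_distrib
          of_real_mult) (simp add: ac_simps cinner_self)
  then have "(norm (c *\<^sub>C x))\<^sup>2 = (norm c * norm x)\<^sup>2"
    using of_real_eq_iff by blast
  then show ?thesis
    by (simp add: power2_eq_iff_nonneg)
qed

lemma norm_cinner_le: "norm (cinner x y) \<le> norm x * norm (y :: 'a::complex_inner)"
proof (cases "cinner x y = 0")
  case False
  define c where "c = cnj (cinner x y) / norm (cinner x y)"
  have c: "norm c = 1"
    using False by (simp add: c_def norm_divide)
  have "c * cinner x y = of_real (norm (cinner x y))"
    using complex_norm_square[of "cinner x y"] False
    by (simp add: c_def field_simps power2_eq_square)
  then have "norm (cinner x y) = inner (c *\<^sub>C x) y"
    by (simp add: inner_eq_Re_cinner cinner_scaleC_left)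
  also have "\<dots> \<le> norm (c *\<^sub>C x) * norm y"
    by (rule norm_cauchy_schwarz)
  finally show ?thesis
    by (simp add: norm_scaleC c)
qed simp

lemma bounded_bilinear_cinner: "bounded_bilinear (cinner :: 'a::complex_inner \<Rightarrow> 'a \<Rightarrow> complex)"
  by unfold_locales
    (auto simp: cinner_add_left cinner_add_right cinner_scaleR_left cinner_scaleR_right
        scaleR_conv_of_real intro!: exI[of _ 1] norm_cinner_le)

lemmas tendsto_cinner [tendsto_intros] = bounded_bilinear.tendsto[OF bounded_bilinear_cinner]

lemma norm_diff_sq:
  "(norm (x - y))\<^sup>2 = (norm x)\<^sup>2 - 2 * Re (cinner x y) + (norm (y :: 'a::complex_inner))\<^sup>2"
  unfolding power2_norm_eq_inner
  by (simp add: inner_diff_left inner_diff_right inner_eq_Re_cinner[symmetric] inner_commute)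

lemma cinner_eq_0_closure:
  assumes "x \<in> closure S" "\<And>s. s \<in> S \<Longrightarrow> cinner s y = 0"
  shows "cinner x (y :: 'a::complex_inner) = 0"
proof -
  obtain f where f: "\<And>n. f n \<in> S" "f \<longlonglongrightarrow> x"
    using assms(1) closure_sequential by blast
  have "(\<lambda>n. cinner (f n) y) \<longlonglongrightarrow> cinner x y"
    by (intro tendsto_intros f)
  moreover have "(\<lambda>n. cinner (f n) y) = (\<lambda>n. 0)"
    using f(1) assms(2) by auto
  ultimately show ?thesis
    using LIMSEQ_unique tendsto_const by metis
qed


section \<open>Bounded operators\<close>

text \<open>Bounded complex-linear maps between whole spaces, the members of \<open>bounded_ops UNIV UNIV\<close>.\<close>

definition bop :: "('a::complex_inner \<Rightarrow> 'b::complex_inner) \<Rightarrow> bool"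
  where "bop A \<longleftrightarrow> (\<forall>x y. A (x + y) = A x + A y) \<and> (\<forall>c x. A (c *\<^sub>C x) = c *\<^sub>C A x) \<and>
    (\<exists>K. \<forall>x. norm (A x) \<le> K * norm x)"

lemma bounded_ops_UNIV: "A \<in> bounded_ops UNIV UNIV \<longleftrightarrow> bop A"
  by (auto simp: bounded_ops_def bop_def)

lemma bopI:
  assumes "\<And>x y. A (x + y) = A x + A y" "\<And>c x. A (c *\<^sub>C x) = c *\<^sub>C A x"
    "\<And>x. norm (A x) \<le> K * norm x"
  shows "bop A"
  using assms unfolding bop_def by blast

lemma
  assumes "bop A"
  shows bop_add: "A (x + y) = A x + A y"
    and bop_scaleC: "A (c *\<^sub>C x) = c *\<^sub>C A x"
    and bop_scaleR: "A (r *\<^sub>R x) = r *\<^sub>R A x"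
    and bop_zero: "A 0 = 0"
    and bop_diff: "A (x - y) = A x - A y"
    and bop_bounded_linear: "bounded_linear A"
proof -
  show *: "A (x + y) = A x + A y" "A (c *\<^sub>C x) = c *\<^sub>C A x" for x y c
    using assms by (auto simp: bop_def)
  show **: "A (r *\<^sub>R x) = r *\<^sub>R A x" for r x
    using *(2)[of "of_real r" x] by (simp add: scaleC_of_real)
  show bl: "bounded_linear A"
    using assms by unfold_locales (auto simp: * ** bop_def mult.commute)
  interpret bounded_linear A by (rule bl)
  show "A 0 = 0" "A (x - y) = A x - A y"
    by (simp_all add: zero diff)
qed

lemma bop_sum: "bop A \<Longrightarrow> A (\<Sum>i\<in>I. f i) = (\<Sum>i\<in>I. A (f i))"
  by (induction I rule: infinite_finite_induct) (auto simp: bop_zero bop_add)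

lemma bop_bound:
  assumes "bop A"
  obtains K where "K > 0" "\<And>x. norm (A x) \<le> K * norm x"
  using bounded_linear.pos_bounded[OF bop_bounded_linear[OF assms]] by (metis mult.commute)

lemma bop_tendsto: "bop A \<Longrightarrow> (f \<longlongrightarrow> l) F \<Longrightarrow> ((\<lambda>x. A (f x)) \<longlongrightarrow> A l) F"
  using bounded_linear.tendsto[OF bop_bounded_linear] by blast

lemma bop_id: "bop (\<lambda>x. x)"
  by (auto simp: bop_def intro: exI[of _ 1])

lemma bop_id': "bop id"
  by (simp add: id_def bop_id)

lemma bop_const_zero: "bop (\<lambda>x. 0)"
  by (auto simp: bop_def intro: exI[of _ 0])

lemma bop_compose:
  assumes "bop A" "bop B" shows "bop (\<lambda>x. A (B x))"
proof -
  obtain K L where K: "K > 0" "\<And>x. norm (A x) \<le> K * norm x" and L: "\<And>x. norm (B x) \<le> L * norm x"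
    using bop_bound[OF assms(1)] bop_bound[OF assms(2)] by metis
  have "norm (A (B x)) \<le> (K * L) * norm x" for x
    using order_trans[OF K(2)[of "B x"] mult_left_mono[OF L[of x], of K]] K(1)
    by (simp add: ac_simps)
  then show ?thesis
    using assms by (intro bopI) (auto simp: bop_add bop_scaleC)
qed

lemma bop_comp: "bop A \<Longrightarrow> bop B \<Longrightarrow> bop (A \<circ> B)"
  by (simp add: comp_def bop_compose)

lemma bop_plus_fun:
  assumes "bop A" "bop B" shows "bop (\<lambda>x. A x + B x)"
proof -
  obtain K L where K: "\<And>x. norm (A x) \<le> K * norm x" and L: "\<And>x. norm (B x) \<le> L * norm x"
    using bop_bound[OF assms(1)] bop_bound[OF assms(2)] by metis
  have "norm (A x + B x) \<le> (K + L) * norm x" for x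
    using K[of x] L[of x] norm_triangle_ineq[of "A x" "B x"] by (simp add: algebra_simps)
  then show ?thesis
    using assms by (intro bopI) (auto simp: bop_add bop_scaleC scaleC_add_right)
qed

lemma bop_scaleC_fun: "bop A \<Longrightarrow> bop (\<lambda>x. c *\<^sub>C A x)"
proof -
  assume A: "bop A"
  obtain K where K: "\<And>x. norm (A x) \<le> K * norm x"
    using bop_bound[OF A] by metis
  have "norm (c *\<^sub>C A x) \<le> (norm c * K) * norm x" for x
    using mult_left_mono[OF K[of x], of "norm c"] by (simp add: norm_scaleC ac_simps)
  then show ?thesis
    using A by (intro bopI[of _ "norm c * K"])
      (auto simp: bop_add bop_scaleC scaleC_add_right scaleC_scaleC mult.commute)
qed

lemma bop_minus_fun: "bop A \<Longrightarrow> bop B \<Longrightarrow> bop (\<lambda>x. A x - B x)"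
  using bop_plus_fun[of A "\<lambda>x. (-1) *\<^sub>C B x"] bop_scaleC_fun[of B "-1"]
  by (simp add: scaleC_minus_one)

lemma bop_sum_fun: "(\<And>i. i \<in> I \<Longrightarrow> bop (A i)) \<Longrightarrow> bop (\<lambda>x. \<Sum>i\<in>I. A i x)"
  by (induction I rule: infinite_finite_induct) (auto intro: bop_const_zero bop_plus_fun)

lemma bop_funpow: "bop (A :: 'a::complex_inner \<Rightarrow> 'a) \<Longrightarrow> bop (A ^^ m)"
  by (induction m) (simp_all add: bop_id' bop_comp)

lemma bop_scaleC_id: "bop (\<lambda>x. c *\<^sub>C x)"
  by (intro bop_scaleC_fun bop_id)

lemma bop_vec_nth: "bop (\<lambda>x. x $ i)"
  by (rule bopI[of _ 1]) (auto simp: scaleC_vec_def Finite_Cartesian_Product.norm_nth_le)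

lemma bop_vec_lambda:
  assumes "\<And>i. bop (A i)"
  shows "bop (\<lambda>x. \<chi> i. A i x)"
proof -
  have "\<exists>K. \<forall>x. norm (A i x) \<le> K * norm x" for i
    using assms[of i] by (auto simp: bop_def)
  then obtain K where K: "\<And>i x. norm (A i x) \<le> K i * norm x"
    by metis
  have "norm (\<chi> i. A i x) \<le> (\<Sum>i\<in>UNIV. K i) * norm x" for x
    unfolding norm_vec_def
    by (rule order_trans[OF L2_set_le_sum]) (auto simp: sum_distrib_right intro!: sum_mono K)
  then show ?thesis
    using assms by (intro bopI) (auto simp: bop_add bop_scaleC vec_eq_iff scaleC_vec_def)
qed

lemma bop_scaleR_fun: "bop A \<Longrightarrow> bop (\<lambda>x. r *\<^sub>R A x)"
  unfolding scaleC_of_real[symmetric] by (rule bop_scaleC_fun)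

lemmas bop_intros = bop_id bop_id' bop_const_zero bop_scaleR_fun bop_comp bop_plus_fun bop_minus_fun
  bop_scaleC_fun bop_sum_fun bop_funpow


section \<open>The Riesz representation and adjoints\<close>

text \<open>The real case: the representing vector minimises the functional
  \<open>x \<mapsto> \<parallel>x\<parallel>\<^sup>2 - 2 \<psi> x\<close>.\<close>

lemma real_riesz:
  fixes \<psi> :: "'a::{real_inner,banach} \<Rightarrow> real"
  assumes "bounded_linear \<psi>"
  obtains z where "\<And>x. \<psi> x = inner x z"
proof -
  interpret bounded_linear \<psi> by fact
  obtain K where K: "K > 0" "\<And>x. \<bar>\<psi> x\<bar> \<le> norm x * K"
    using pos_bounded by auto
  define J where "J x = (norm x)\<^sup>2 - 2 * \<psi> x" for x
  have J_lower: "J x \<ge> - K\<^sup>2" for x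
    using K(2)[of x] zero_le_power2[of "norm x - K"] unfolding J_def
    by (simp add: power2_diff)
  define d where "d = Inf (range J)"
  have bdd: "bdd_below (range J)"
    using J_lower by (auto intro!: bdd_belowI)
  have d_le: "d \<le> J x" for x
    unfolding d_def using bdd by (auto intro: cInf_lower)
  have "\<exists>x. J x < d + 1 / Suc n" for n
    using cInf_less_iff[OF _ bdd, of "d + 1 / Suc n"] by (auto simp: d_def)
  then obtain s where s: "\<And>n. J (s n) < d + 1 / Suc n"
    by metis
  have par: "(norm (x - y))\<^sup>2 \<le> 2 * (J x - d) + 2 * (J y - d)" for x y
  proof -
    have "(norm (x - y))\<^sup>2 = 2 * J x + 2 * J y - 4 * J ((1/2) *\<^sub>R (x + y))"
      unfolding J_def power2_norm_eq_inner
      by (simp add: scaleR add inner_add_left inner_add_right inner_diff_left inner_diff_right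
          inner_commute algebra_simps)
    then show ?thesis
      using d_le[of "(1/2) *\<^sub>R (x + y)"] by argo
  qed
  have "Cauchy s"
  proof (rule metric_CauchyI)
    fix e :: real assume "e > 0"
    obtain N where N: "4 / Suc N < e\<^sup>2"
      using \<open>e > 0\<close> reals_Archimedean[of "e\<^sup>2 / 4"] by (auto simp: field_simps)
    have "dist (s m) (s n) < e" if "m \<ge> N" "n \<ge> N" for m n
    proof -
      have "1 / Suc m \<le> 1 / Suc N" "1 / Suc n \<le> 1 / Suc N"
        using that by (auto simp: field_simps)
      then have "(norm (s m - s n))\<^sup>2 < 4 / Suc N"
        using par[of "s m" "s n"] s[of m] s[of n] by argo
      then have "(norm (s m - s n))\<^sup>2 < e\<^sup>2"
        using N by linarith
      then show ?thesis
        using \<open>e > 0\<close> by (simp add: dist_norm power_less_imp_less_base)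
    qed
    then show "\<exists>M. \<forall>m\<ge>M. \<forall>n\<ge>M. dist (s m) (s n) < e"
      by blast
  qed
  then obtain z where z: "s \<longlonglongrightarrow> z"
    using Cauchy_convergent convergent_def by blast
  have "(\<lambda>n. J (s n)) \<longlonglongrightarrow> J z"
    unfolding J_def by (intro tendsto_intros tendsto z)
  moreover have "(\<lambda>n. d + 1 / Suc n) \<longlonglongrightarrow> d + 0"
    by (intro tendsto_intros LIMSEQ_Suc[OF lim_1_over_n])
  ultimately have "J z \<le> d"
    using LIMSEQ_le[of "\<lambda>n. J (s n)" "J z" "\<lambda>n. d + 1 / Suc n" "d + 0"] s by (auto intro: less_imp_le)
  then have Jmin: "J z \<le> J x" for x
    using d_le[of x] by linarith
  have "\<psi> x = inner x z" for x
  proof (cases "x = 0")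
    case False
    \<comment> \<open>the minimum of the quadratic polynomial along the line through z in direction x\<close>
    define t where "t = (\<psi> x - inner x z) / (norm x)\<^sup>2"
    have "J (z + t *\<^sub>R x) = J z + t\<^sup>2 * (norm x)\<^sup>2 - 2 * t * (\<psi> x - inner x z)"
      unfolding J_def power2_norm_eq_inner
      by (simp add: scaleR add inner_add_left inner_add_right inner_commute algebra_simps
          power2_eq_square)
    also have "\<dots> = J z - (\<psi> x - inner x z)\<^sup>2 / (norm x)\<^sup>2"
      using False by (simp add: t_def field_simps power2_eq_square)
    finally have "(\<psi> x - inner x z)\<^sup>2 / (norm x)\<^sup>2 \<le> 0"
      using Jmin[of "z + t *\<^sub>R x"] by simp
    then show ?thesis
      using False by (simp add: divide_le_0_iff not_le)
  qed (simp add: zero)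
  then show ?thesis
    by (rule that)
qed

lemma riesz:
  fixes \<phi> :: "'a::{complex_inner,banach} \<Rightarrow> complex"
  assumes "bop \<phi>"
  obtains z where "\<And>x. \<phi> x = cinner x z"
proof -
  have *: "bounded_linear (\<lambda>x. Re (\<phi> x))"
    using bounded_linear_compose[OF bounded_linear_Re bop_bounded_linear[OF assms]] .
  obtain z where z: "\<And>x. Re (\<phi> x) = inner x z"
    by (rule real_riesz[OF *]) blast
  have "\<phi> x = cinner x z" for x
  proof (rule complex_eqI)
    show "Re (\<phi> x) = Re (cinner x z)"
      by (simp add: z inner_eq_Re_cinner)
    have "Re (\<phi> (\<i> *\<^sub>C x)) = Re (cinner (\<i> *\<^sub>C x) z)"
      by (simp add: z inner_eq_Re_cinner)
    then show "Im (\<phi> x) = Im (cinner x z)"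
      by (simp add: bop_scaleC[OF assms] cinner_scaleC_left scaleC_complex_def)
  qed
  then show ?thesis
    by (rule that)
qed

text \<open>A formal adjoint of a bounded operator is itself bounded and linear.\<close>

lemma bop_of_adjoint:
  assumes "bop A" "\<And>x y. cinner (A x) y = cinner x (B y)"
  shows "bop B"
proof -
  obtain K where K: "K > 0" "\<And>x. norm (A x) \<le> K * norm x"
    using bop_bound[OF assms(1)] by metis
  have adj: "cinner (B y) x = cinner y (A x)" for x y
    by (rule cinner_flip) (rule assms(2)[symmetric])
  have "norm (B y) \<le> K * norm y" for y
  proof (cases "B y = 0")
    case False
    have "(norm (B y))\<^sup>2 = norm (cinner (A (B y)) y)"
      by (simp add: assms(2) norm_cinner_self)
    also have "\<dots> \<le> norm (A (B y)) * norm y"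
      by (rule norm_cinner_le)
    also have "\<dots> \<le> (K * norm (B y)) * norm y"
      by (intro mult_right_mono K) auto
    finally show ?thesis
      using False by (simp add: power2_eq_square)
  qed (use K in auto)
  moreover have "B (x + y) = B x + B y" for x y
    by (rule cinner_eqI) (simp add: adj cinner_add_left)
  moreover have "B (c *\<^sub>C x) = c *\<^sub>C B x" for c x
    by (rule cinner_eqI) (simp add: adj cinner_scaleC_left)
  ultimately show ?thesis
    by (intro bopI)
qed

lemma adjoint_exists:
  fixes A :: "'a::{complex_inner,banach} \<Rightarrow> 'b::complex_inner"
  assumes "bop A"
  obtains B where "bop B" "\<And>x y. cinner (A x) y = cinner x (B y)"
proof -
  have "\<exists>z. \<forall>x. cinner (A x) y = cinner x z" for y
  proof -
    have "bop (\<lambda>x. cinner x y)"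
      by (rule bopI[of _ "norm y"])
        (auto simp: cinner_add_left cinner_scaleC_left scaleC_complex_def mult.commute
          intro: order_trans[OF norm_cinner_le])
    then have "bop (\<lambda>x. cinner (A x) y)"
      using assms by (rule bop_compose)
    then show ?thesis
      by (rule riesz) blast
  qed
  then obtain B where "\<And>x y. cinner (A x) y = cinner x (B y)"
    by metis
  then show ?thesis
    using that bop_of_adjoint[OF assms] by blast
qed

lemma adj_unique:
  assumes "bop B" "\<And>x y. cinner (A x) y = cinner x (B y)"
  shows "adj A = B"
  unfolding adjoint_on_def bounded_ops_UNIV
proof (rule the_equality)
  fix C assume C: "bop C \<and> (\<forall>x\<in>UNIV. \<forall>y\<in>UNIV. cinner (A x) y = cinner x (C y))"
  have "cinner (C y) x = cinner (B y) x" for x y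
    by (rule cinner_flip) (metis C UNIV_I assms(2))
  then show "C = B"
    by (metis cinner_eqI ext)
qed (use assms in auto)

lemma
  fixes A :: "'a::{complex_inner,banach} \<Rightarrow> 'b::complex_inner"
  assumes "bop A"
  shows bop_adj: "bop (adj A)"
    and cinner_adj_right: "cinner x (adj A y) = cinner (A x) y"
    and cinner_adj_left: "cinner (adj A y) x = cinner y (A x)"
proof -
  obtain B where B: "bop B" "\<And>x y. cinner (A x) y = cinner x (B y)"
    using adjoint_exists[OF assms] by metis
  have "adj A = B"
    using B by (rule adj_unique)
  then show "bop (adj A)" "cinner x (adj A y) = cinner (A x) y" for x y
    using B by auto
  then show "cinner (adj A y) x = cinner y (A x)"
    by (metis cinner_flip)
qed

lemma adj_commute:
  fixes A B :: "'a::{complex_inner,banach} \<Rightarrow> 'a"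
  assumes "bop A" "bop B" "A \<circ> B = B \<circ> A"
  shows "adj A \<circ> adj B = adj B \<circ> adj A"
proof
  fix x
  have "A (B z) = B (A z)" for z
    using assms(3) by (metis comp_apply)
  then show "(adj A \<circ> adj B) x = (adj B \<circ> adj A) x"
    by (simp only: comp_apply, intro cinner_eqI[of "adj A (adj B x)"])
      (simp add: cinner_adj_left assms)
qed

lemma norm_adj_le:
  fixes A :: "'a::{complex_inner,banach} \<Rightarrow> 'b::complex_inner"
  assumes "bop A" "\<And>x. norm (A x) \<le> norm x"
  shows "norm (adj A y) \<le> norm y"
proof (cases "adj A y = 0")
  case False
  have "(norm (adj A y))\<^sup>2 = norm (cinner (A (adj A y)) y)"
    by (simp add: cinner_adj_right[OF assms(1), symmetric] norm_cinner_self)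
  also have "\<dots> \<le> norm (adj A y) * norm y"
    using norm_cinner_le[of "A (adj A y)" y] assms(2)[of "adj A y"]
    by (meson mult_right_mono norm_ge_zero order_trans)
  finally show ?thesis
    using False by (simp add: power2_eq_square)
qed auto

section \<open>Positive operators and their square roots\<close>

lemma positive_op_iff:
  "positive_op A \<longleftrightarrow> bop A \<and> (\<forall>h. Im (cinner (A h) h) = 0 \<and> Re (cinner (A h) h) \<ge> 0)"
  by (auto simp: positive_op_def bounded_ops_UNIV complex_nonneg_Reals_iff)

lemma positive_op_bop: "positive_op A \<Longrightarrow> bop A"
  by (simp add: positive_op_iff)

text \<open>By polarization, an operator with a real quadratic form is self-adjoint.\<close>

lemma positive_op_selfadjoint:
  assumes "positive_op A"
  shows "cinner (A x) y = cinner x (A y)"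
proof -
  have A: "bop A" and r: "Im (cinner (A h) h) = 0" for h
    using assms by (auto simp: positive_op_iff)
  have "Im (cinner (A x) y + cinner (A y) x) = 0"
    using r[of "x + y"] r[of x] r[of y] by (simp add: bop_add[OF A] cinner_add_left cinner_add_right)
  moreover have "Re (cinner (A x) y) = Re (cinner (A y) x)"
    using r[of "x + \<i> *\<^sub>C y"] r[of x] r[of y]
    by (simp add: bop_add[OF A] bop_scaleC[OF A] cinner_add_left cinner_add_right
        cinner_scaleC_left cinner_scaleC_right)
  ultimately have "cinner (A x) y = cnj (cinner (A y) x)"
    by (simp add: complex_eq_iff)
  then show ?thesis
    using cinner_commute[of x "A y"] by simp
qed

text \<open>The Cauchy-Schwarz inequality for the form of a positive operator, in the special case
  of the vectors h and A h.\<close>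

lemma positive_op_norm_sq:
  assumes "positive_op A" "\<And>x. norm (A x) \<le> K * norm x" "K > 0"
  shows "(norm (A h))\<^sup>2 \<le> K * Re (cinner (A h) h)"
proof -
  have A: "bop A" and p: "Re (cinner (A x) x) \<ge> 0" for x
    using assms by (auto simp: positive_op_iff)
  define t where "t = 1 / K"
  have self: "cinner (A (A h)) h = cinner (A h) (A h)"
    by (rule positive_op_selfadjoint[OF assms(1)])
  have "0 \<le> Re (cinner (A (h - t *\<^sub>R A h)) (h - t *\<^sub>R A h))"
    by (rule p)
  also have "\<dots> = Re (cinner (A h) h) - 2 * t * (norm (A h))\<^sup>2
      + t\<^sup>2 * Re (cinner (A (A h)) (A h))"
    by (simp add: bop_diff[OF A] bop_scaleR[OF A] cinner_diff_left cinner_diff_right self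
        cinner_scaleR_left cinner_scaleR_right cinner_self algebra_simps power2_eq_square)
  also have "\<dots> \<le> Re (cinner (A h) h) - 2 * t * (norm (A h))\<^sup>2 + t\<^sup>2 * (K * (norm (A h))\<^sup>2)"
  proof -
    have "Re (cinner (A (A h)) (A h)) \<le> norm (A (A h)) * norm (A h)"
      using norm_cinner_le[of "A (A h)" "A h"] complex_Re_le_cmod order_trans by blast
    also have "\<dots> \<le> K * (norm (A h))\<^sup>2"
      using mult_right_mono[OF assms(2)[of "A h"], of "norm (A h)"] by (simp add: power2_eq_square)
    finally show ?thesis
      by (simp add: mult_left_mono)
  qed
  also have "\<dots> = Re (cinner (A h) h) - (norm (A h))\<^sup>2 / K"
    using \<open>K > 0\<close> by (simp add: t_def field_simps power2_eq_square)
  finally show ?thesis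
    using \<open>K > 0\<close> by (simp add: field_simps)
qed

lemma positive_op_form_zero:
  assumes "positive_op A" "Re (cinner (A h) h) = 0"
  shows "A h = 0"
proof -
  obtain K where "K > 0" "\<And>x. norm (A x) \<le> K * norm x"
    using bop_bound[OF positive_op_bop[OF assms(1)]] by metis
  then show ?thesis
    using positive_op_norm_sq[OF assms(1), of K h] assms(2) by simp
qed

text \<open>
  For an operator with \<open>\<parallel>B\<parallel> \<le> 1\<close> the iteration below converges in norm to a solution Y of
  \<open>2 Y = B + Y\<^sup>2\<close>, that is, of \<open>(I - Y)\<^sup>2 = I - B\<close>.  It is dominated by the scalar iteration
  for \<open>B = 1\<close>, which increases and is bounded by 1.
\<close>

fun sqrt_iter :: "('a::real_normed_vector \<Rightarrow>\<^sub>L 'a) \<Rightarrow> nat \<Rightarrow> ('a \<Rightarrow>\<^sub>L 'a)" where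
  "sqrt_iter B 0 = 0"
| "sqrt_iter B (Suc n) = (1/2) *\<^sub>R (B + (sqrt_iter B n o\<^sub>L sqrt_iter B n))"

fun sqrt_bound :: "nat \<Rightarrow> real" where
  "sqrt_bound 0 = 0"
| "sqrt_bound (Suc n) = (1 + (sqrt_bound n)\<^sup>2) / 2"

lemma sqrt_bound_range: "0 \<le> sqrt_bound n \<and> sqrt_bound n \<le> 1"
proof (induction n)
  case (Suc n)
  then have "(sqrt_bound n)\<^sup>2 \<le> 1"
    by (simp add: power_le_one)
  then show ?case
    by simp
qed simp

lemma sqrt_bound_mono: "sqrt_bound n \<le> sqrt_bound (Suc n)"
  using zero_le_power2[of "sqrt_bound n - 1"] by (simp add: power2_diff)

lemma sqrt_iter_commute:
  assumes "C o\<^sub>L B = B o\<^sub>L C"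
  shows "C o\<^sub>L sqrt_iter B n = sqrt_iter B n o\<^sub>L C"
proof (induction n)
  case (Suc n)
  have "blinfun_apply C (blinfun_apply (sqrt_iter B n) x)
      = blinfun_apply (sqrt_iter B n) (blinfun_apply C x)" for x
    using arg_cong[OF Suc, of "\<lambda>D. blinfun_apply D x"] by simp
  then have "C o\<^sub>L (sqrt_iter B n o\<^sub>L sqrt_iter B n) = (sqrt_iter B n o\<^sub>L sqrt_iter B n) o\<^sub>L C"
    by (intro blinfun_eqI) simp
  then show ?case
    using assms by (simp add: bounded_bilinear.add_left[OF bounded_bilinear_blinfun_compose]
        bounded_bilinear.add_right[OF bounded_bilinear_blinfun_compose]
        bounded_bilinear.scaleR_left[OF bounded_bilinear_blinfun_compose]
        bounded_bilinear.scaleR_right[OF bounded_bilinear_blinfun_compose])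
qed (simp add: bounded_bilinear.zero_left[OF bounded_bilinear_blinfun_compose]
        bounded_bilinear.zero_right[OF bounded_bilinear_blinfun_compose])

lemma sqrt_iter_commute_self: "sqrt_iter B m o\<^sub>L sqrt_iter B n = sqrt_iter B n o\<^sub>L sqrt_iter B m"
  by (intro sqrt_iter_commute sqrt_iter_commute[symmetric] refl)

lemma norm_sqrt_iter:
  assumes "norm B \<le> 1"
  shows "norm (sqrt_iter B n) \<le> sqrt_bound n"
proof (induction n)
  case (Suc n)
  have "norm (sqrt_iter B n o\<^sub>L sqrt_iter B n) \<le> norm (sqrt_iter B n) * norm (sqrt_iter B n)"
    by (rule norm_blinfun_compose)
  also have "\<dots> \<le> (sqrt_bound n)\<^sup>2"
    unfolding power2_eq_square using Suc sqrt_bound_range[of n] by (intro mult_mono) auto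
  finally have "norm (B + (sqrt_iter B n o\<^sub>L sqrt_iter B n)) \<le> 1 + (sqrt_bound n)\<^sup>2"
    using assms norm_triangle_ineq[of B "sqrt_iter B n o\<^sub>L sqrt_iter B n"] by linarith
  then show ?case
    by simp
qed simp

lemma norm_sqrt_iter_diff:
  assumes "norm B \<le> 1"
  shows "norm (sqrt_iter B (Suc n) - sqrt_iter B n) \<le> sqrt_bound (Suc n) - sqrt_bound n"
proof (induction n)
  case 0
  then show ?case
    using assms by simp
next
  case (Suc n)
  define X where "X = sqrt_iter B (Suc n)"
  define Y where "Y = sqrt_iter B n"
  have "sqrt_iter B (Suc (Suc n)) - X = (1/2) *\<^sub>R ((X o\<^sub>L X) - (Y o\<^sub>L Y))"
    unfolding X_def Y_def sqrt_iter.simps(2)[of B "Suc n"]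
    by (subst (3) sqrt_iter.simps(2)) (simp add: algebra_simps)
  also have "(X o\<^sub>L X) - (Y o\<^sub>L Y) = (X - Y) o\<^sub>L (X + Y)"
    using sqrt_iter_commute_self[of B "Suc n" n, folded X_def Y_def]
    by (simp add: bounded_bilinear.diff_left[OF bounded_bilinear_blinfun_compose]
        bounded_bilinear.add_right[OF bounded_bilinear_blinfun_compose])
  finally have "norm (sqrt_iter B (Suc (Suc n)) - X) = norm ((X - Y) o\<^sub>L (X + Y)) / 2"
    by simp
  also have "\<dots> \<le> (norm (X - Y) * norm (X + Y)) / 2"
    by (simp add: norm_blinfun_compose)
  also have "\<dots> \<le> ((sqrt_bound (Suc n) - sqrt_bound n) * (sqrt_bound (Suc n) + sqrt_bound n)) / 2"
  proof -
    have "norm (X - Y) \<le> sqrt_bound (Suc n) - sqrt_bound n"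
      using Suc by (simp add: X_def Y_def)
    moreover have "norm (X + Y) \<le> sqrt_bound (Suc n) + sqrt_bound n"
      unfolding X_def Y_def
      by (intro order_trans[OF norm_triangle_ineq] add_mono norm_sqrt_iter assms)
    ultimately show ?thesis
      using sqrt_bound_mono[of n] by (intro divide_right_mono mult_mono) auto
  qed
  also have "\<dots> = sqrt_bound (Suc (Suc n)) - sqrt_bound (Suc n)"
    by (simp add: power2_eq_square field_simps)
  finally show ?case
    by (simp add: X_def)
qed

lemma sqrt_iter_convergent:
  fixes B :: "'a::banach \<Rightarrow>\<^sub>L 'a"
  assumes "norm B \<le> 1"
  obtains Y where "sqrt_iter B \<longlonglongrightarrow> Y"
proof -
  have "incseq sqrt_bound"
    by (rule incseq_SucI) (rule sqrt_bound_mono)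
  then obtain L where L: "sqrt_bound \<longlonglongrightarrow> L"
    using sqrt_bound_range incseq_convergent[of sqrt_bound 1] by metis
  have "summable (\<lambda>n. sqrt_bound (Suc n) - sqrt_bound n)"
    using telescope_sums[OF L] sums_summable by blast
  then have "summable (\<lambda>n. sqrt_iter B (Suc n) - sqrt_iter B n)"
    by (rule summable_comparison_test'[of _ 0]) (use norm_sqrt_iter_diff[OF assms] in auto)
  then obtain Y where "(\<lambda>n. \<Sum>i<n. sqrt_iter B (Suc i) - sqrt_iter B i) \<longlonglongrightarrow> Y"
    by (auto simp: summable_def sums_def)
  then have "sqrt_iter B \<longlonglongrightarrow> Y"
    unfolding sum_lessThan_telescope by simp
  then show ?thesis
    by (rule that)
qed

text \<open>Besides existence the statement records that the root commutes with whatever commutes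
  with the operator; uniqueness rests on that.\<close>

lemma sqrt_exists:
  fixes A :: "'a::{complex_inner,banach} \<Rightarrow> 'a"
  assumes A: "positive_op A"
  obtains R where "positive_op R" "R \<circ> R = A"
    "\<And>C. bop C \<Longrightarrow> C \<circ> A = A \<circ> C \<Longrightarrow> C \<circ> R = R \<circ> C"
proof -
  have bA: "bop A"
    using A by (rule positive_op_bop)
  obtain c where c: "c > 0" "\<And>x. norm (A x) \<le> c * norm x"
    using bop_bound[OF bA] by metis
  have bB: "bop (\<lambda>x. x - (1/c) *\<^sub>R A x)"
    by (intro bop_intros bA)
  \<comment> \<open>the rescaled operator \<open>A/c\<close> lies between 0 and I, so \<open>B = I - A/c\<close> is a contraction\<close>
  define B where "B = Blinfun (\<lambda>x. x - (1/c) *\<^sub>R A x)"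
  have B: "blinfun_apply B x = x - (1/c) *\<^sub>R A x" for x
    unfolding B_def by (simp add: bounded_linear_Blinfun_apply bop_bounded_linear[OF bB])
  have "norm (blinfun_apply B x) \<le> norm x" for x
  proof -
    have "(norm (A x))\<^sup>2 \<le> c * Re (cinner (A x) x)"
      using A c by (intro positive_op_norm_sq) auto
    then have "(1/c)\<^sup>2 * (norm (A x))\<^sup>2 \<le> (1/c) * Re (cinner (A x) x)"
      using c(1) by (simp add: field_simps power2_eq_square)
    moreover have "Re (cinner (A x) x) \<ge> 0"
      using A by (simp add: positive_op_iff)
    moreover have "(norm (blinfun_apply B x))\<^sup>2
        = (norm x)\<^sup>2 - 2 * ((1/c) * Re (cinner (A x) x)) + (1/c)\<^sup>2 * (norm (A x))\<^sup>2"
      using c(1) positive_op_selfadjoint[OF A, of x x]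
      by (simp add: B norm_diff_sq cinner_scaleR_right power_mult_distrib power_divide)
    ultimately have "(norm (blinfun_apply B x))\<^sup>2 \<le> (norm x)\<^sup>2"
      using c(1) by (smt (verit) mult_nonneg_nonneg divide_nonneg_pos)
    then show ?thesis
      by (rule power2_le_imp_le) simp
  qed
  then have "norm B \<le> 1"
    by (intro norm_blinfun_bound) auto
  then obtain Y where Y: "sqrt_iter B \<longlonglongrightarrow> Y"
    by (rule sqrt_iter_convergent)
  have Yx: "(\<lambda>n. blinfun_apply (sqrt_iter B n) x) \<longlonglongrightarrow> blinfun_apply Y x" for x
    by (intro tendsto_intros Y)
  have "(\<lambda>n. sqrt_iter B (Suc n)) \<longlonglongrightarrow> (1/2) *\<^sub>R (B + (Y o\<^sub>L Y))"
    unfolding sqrt_iter.simps by (intro tendsto_intros Y)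
  then have Y_eq: "Y = (1/2) *\<^sub>R (B + (Y o\<^sub>L Y))"
    using LIMSEQ_unique[OF LIMSEQ_Suc[OF Y]] by blast
  have Y2: "2 *\<^sub>R blinfun_apply Y x = blinfun_apply B x + blinfun_apply Y (blinfun_apply Y x)" for x
    by (subst (1) Y_eq) (simp add: blinfun.add_left blinfun.scaleR_left)
  have "norm Y \<le> 1"
    using norm_sqrt_iter[OF \<open>norm B \<le> 1\<close>] sqrt_bound_range
    by (intro Lim_norm_ubound[OF _ Y] always_eventually allI) (auto intro: order_trans)
  then have norm_Y: "norm (blinfun_apply Y x) \<le> norm x" for x
    using norm_blinfun[of Y x] mult_right_mono[of "norm Y" 1 "norm x"] by simp
  have iter_c: "blinfun_apply (sqrt_iter B n) (d *\<^sub>C x) = d *\<^sub>C blinfun_apply (sqrt_iter B n) x" for n d x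
    by (induction n arbitrary: x)
      (simp_all add: blinfun.add_left blinfun.scaleR_left B bop_scaleC[OF bA] scaleC_add_right
        scaleC_diff_right bop_scaleR[OF bop_scaleC_id])
  have Y_c: "blinfun_apply Y (d *\<^sub>C x) = d *\<^sub>C blinfun_apply Y x" for d x
    using LIMSEQ_unique[OF Yx[of "d *\<^sub>C x"]] bop_tendsto[OF bop_scaleC_id, OF Yx[of x], of d]
    by (simp add: iter_c)
  have bY: "bop (blinfun_apply Y)"
    by (rule bopI[of _ 1]) (simp_all add: blinfun.add_right Y_c norm_Y)
  have iter_sa: "cinner (blinfun_apply (sqrt_iter B n) x) y
      = cinner x (blinfun_apply (sqrt_iter B n) y)" for n x y
    by (induction n arbitrary: x y)
      (simp_all add: blinfun.add_left blinfun.scaleR_left B cinner_add_left cinner_add_right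
        cinner_diff_left cinner_diff_right cinner_scaleR_left cinner_scaleR_right
        positive_op_selfadjoint[OF A])
  have Y_sa: "cinner (blinfun_apply Y x) y = cinner x (blinfun_apply Y y)" for x y
  proof -
    have "(\<lambda>n. cinner (blinfun_apply (sqrt_iter B n) x) y) \<longlonglongrightarrow> cinner (blinfun_apply Y x) y"
      by (intro tendsto_intros Yx)
    moreover have "(\<lambda>n. cinner x (blinfun_apply (sqrt_iter B n) y)) \<longlonglongrightarrow> cinner x (blinfun_apply Y y)"
      by (intro tendsto_intros Yx)
    ultimately show ?thesis
      by (simp add: iter_sa LIMSEQ_unique)
  qed
  define s where "s = sqrt c"
  have s: "s > 0" "s * s = c"
    using c(1) by (auto simp: s_def)
  \<comment> \<open>\<open>I - Y\<close> is the root of \<open>I - B = A/c\<close>; it is positive because Y is a self-adjoint contraction\<close>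
  define R where "R x = s *\<^sub>R (x - blinfun_apply Y x)" for x
  have bR: "bop R"
    unfolding R_def by (intro bop_intros bY)
  have "positive_op R"
    unfolding positive_op_iff
  proof (intro conjI allI bR)
    fix h
    have "Im (cinner (blinfun_apply Y h) h) = 0"
      using Y_sa[of h h] cinner_commute[of h "blinfun_apply Y h"]
      by (metis cnj.simps(2) neg_equal_zero)
    then show "Im (cinner (R h) h) = 0"
      by (simp add: R_def cinner_scaleR_left cinner_diff_left cinner_self)
    have "Re (cinner (blinfun_apply Y h) h) \<le> norm (blinfun_apply Y h) * norm h"
      using norm_cinner_le complex_Re_le_cmod order_trans by blast
    also have "\<dots> \<le> (norm h)\<^sup>2"
      using mult_right_mono[OF norm_Y[of h], of "norm h"] by (simp add: power2_eq_square)
    finally show "Re (cinner (R h) h) \<ge> 0"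
      using s(1) by (simp add: R_def cinner_scaleR_left cinner_diff_left cinner_self)
  qed
  moreover have "R \<circ> R = A"
  proof
    fix x
    have "(R \<circ> R) x = c *\<^sub>R ((x - blinfun_apply Y x) - blinfun_apply Y (x - blinfun_apply Y x))"
      by (simp add: R_def s(2)[symmetric] blinfun.scaleR_right blinfun.diff_right algebra_simps)
    also have "\<dots> = c *\<^sub>R (x - 2 *\<^sub>R blinfun_apply Y x + blinfun_apply Y (blinfun_apply Y x))"
      by (simp add: blinfun.diff_right algebra_simps scaleR_2)
    also have "\<dots> = A x"
      using c(1) by (simp only: Y2) (simp add: B)
    finally show "(R \<circ> R) x = A x" .
  qed
  moreover have "C \<circ> R = R \<circ> C" if C: "bop C" "C \<circ> A = A \<circ> C" for C
  proof -
    have CA: "C (A x) = A (C x)" for x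
      using C(2) by (metis comp_apply)
    have "C (blinfun_apply (sqrt_iter B n) x) = blinfun_apply (sqrt_iter B n) (C x)" for n x
      by (induction n arbitrary: x)
        (simp_all add: blinfun.add_left blinfun.scaleR_left B bop_add[OF C(1)] bop_diff[OF C(1)]
          bop_scaleR[OF C(1)] bop_zero[OF C(1)] CA)
    then have "C (blinfun_apply Y x) = blinfun_apply Y (C x)" for x
      using LIMSEQ_unique[OF Yx[of "C x"]] bop_tendsto[OF C(1) Yx[of x]] by simp
    then show ?thesis
      by (simp add: fun_eq_iff R_def bop_scaleR[OF C(1)] bop_diff[OF C(1)])
  qed
  ultimately show ?thesis
    by (rule that)
qed

lemma sqrt_unique:
  fixes A :: "'a::{complex_inner,banach} \<Rightarrow> 'a"
  assumes "positive_op A"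
  shows "\<exists>!R. positive_op R \<and> R \<circ> R = A"
proof -
  obtain R where R: "positive_op R" "R \<circ> R = A"
    and comm: "\<And>C. bop C \<Longrightarrow> C \<circ> A = A \<circ> C \<Longrightarrow> C \<circ> R = R \<circ> C"
    using sqrt_exists[OF assms] by metis
  have "B = R" if B: "positive_op B" "B \<circ> B = A" for B
  proof
    fix h
    have bB: "bop B" and bR: "bop R"
      using B(1) R(1) by (auto intro: positive_op_bop)
    have "B \<circ> R = R \<circ> B"
      using comm[OF bB] B(2) by (metis comp_assoc)
    then have BR: "B (R x) = R (B x)" for x
      by (metis comp_apply)
    have BB: "B (B x) = R (R x)" for x
      using B(2) R(2) by (metis comp_apply)
    \<comment> \<open>\<open>(B + R) (B - R) = B\<^sup>2 - R\<^sup>2 = 0\<close>, and both B and R are positive\<close>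
    define x where "x = B h - R h"
    have "B x + R x = 0"
      unfolding x_def by (simp add: bop_diff[OF bB] bop_diff[OF bR] BR BB)
    then have "Re (cinner (B x) x) + Re (cinner (R x) x) = 0"
      by (metis Re_complex_of_real cinner_add_left cinner_zero_left plus_complex.simps(1) of_real_0)
    moreover have "Re (cinner (B x) x) \<ge> 0" "Re (cinner (R x) x) \<ge> 0"
      using B(1) R(1) by (auto simp: positive_op_iff)
    ultimately have "B x = 0" "R x = 0"
      using positive_op_form_zero[OF B(1), of x] positive_op_form_zero[OF R(1), of x] by linarith+
    then have "cinner x x = 0"
      by (subst (1) x_def) (simp add: cinner_diff_left positive_op_selfadjoint[OF B(1)]
          positive_op_selfadjoint[OF R(1)])
    then show "B h = R h"
      by (simp add: x_def)
  qed
  then show ?thesis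
    using R by blast
qed

lemma
  fixes A :: "'a::{complex_inner,banach} \<Rightarrow> 'a"
  assumes "positive_op A"
  shows positive_op_sqrt: "positive_op (op_sqrt A)"
    and op_sqrt_square: "op_sqrt A (op_sqrt A x) = A x"
proof -
  have *: "positive_op (op_sqrt A) \<and> op_sqrt A \<circ> op_sqrt A = A"
    unfolding op_sqrt_def by (rule theI'[OF sqrt_unique[OF assms]])
  then show "positive_op (op_sqrt A)" "op_sqrt A (op_sqrt A x) = A x"
    by (auto simp: fun_eq_iff)
qed

lemma op_sqrt_eqI:
  fixes A :: "'a::{complex_inner,banach} \<Rightarrow> 'a"
  assumes "positive_op R" "\<And>x. R (R x) = A x" "positive_op A"
  shows "op_sqrt A = R"
  unfolding op_sqrt_def
  by (rule the1_equality[OF sqrt_unique[OF assms(3)]]) (use assms in auto)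

lemma norm_op_sqrt:
  fixes A :: "'a::{complex_inner,banach} \<Rightarrow> 'a"
  assumes "positive_op A"
  shows "(norm (op_sqrt A x))\<^sup>2 = Re (cinner (A x) x)"
  using cinner_self[of "op_sqrt A x"] positive_op_selfadjoint[OF positive_op_sqrt[OF assms], of "op_sqrt A x" x]
  by (simp add: op_sqrt_square[OF assms])

section \<open>Square-summable families\<close>

text \<open>
  The Hilbert space of square-summable families of vectors.  For the index type \<open>'n \<Rightarrow> nat\<close>
  of multi-indices it plays the role of the vector-valued Hardy space on the polydisc, an element
  being the family of Taylor coefficients of a function.
\<close>

typedef (overloaded) ('i, 'a) ell2 =
  "{f :: 'i \<Rightarrow> 'a::complex_inner. (\<lambda>i. (norm (f i))\<^sup>2) summable_on UNIV}"
  morphisms coeff Abs_ell2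
  by (rule exI[of _ "\<lambda>_. 0"]) simp

setup_lifting type_definition_ell2

lemma square_summable_add:
  fixes f g :: "'i \<Rightarrow> 'a::real_normed_vector"
  assumes "(\<lambda>i. (norm (f i))\<^sup>2) summable_on UNIV" "(\<lambda>i. (norm (g i))\<^sup>2) summable_on UNIV"
  shows "(\<lambda>i. (norm (f i + g i))\<^sup>2) summable_on UNIV"
proof (rule summable_on_comparison_test)
  show "(\<lambda>i. 2 * (norm (f i))\<^sup>2 + 2 * (norm (g i))\<^sup>2) summable_on UNIV"
    by (intro summable_on_add summable_on_cmult_right assms)
  show "(norm (f i + g i))\<^sup>2 \<le> 2 * (norm (f i))\<^sup>2 + 2 * (norm (g i))\<^sup>2" for i
  proof -
    have "(norm (f i + g i))\<^sup>2 \<le> (norm (f i) + norm (g i))\<^sup>2"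
      by (intro power_mono norm_triangle_ineq norm_ge_zero)
    also have "\<dots> \<le> 2 * (norm (f i))\<^sup>2 + 2 * (norm (g i))\<^sup>2"
      using zero_le_power2[of "norm (f i) - norm (g i)"] by (simp add: power2_diff power2_sum)
    finally show ?thesis .
  qed
qed auto

lemma abs_summable_cinner:
  fixes f g :: "'i \<Rightarrow> 'a::complex_inner"
  assumes "(\<lambda>i. (norm (f i))\<^sup>2) summable_on UNIV" "(\<lambda>i. (norm (g i))\<^sup>2) summable_on UNIV"
  shows "(\<lambda>i. norm (cinner (f i) (g i))) summable_on UNIV"
proof (rule summable_on_comparison_test)
  show "(\<lambda>i. (norm (f i))\<^sup>2 + (norm (g i))\<^sup>2) summable_on UNIV"
    by (intro summable_on_add assms)
  show "norm (cinner (f i) (g i)) \<le> (norm (f i))\<^sup>2 + (norm (g i))\<^sup>2" for i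
    using norm_cinner_le[of "f i" "g i"] sum_squares_bound[of "norm (f i)" "norm (g i)"]
      mult_nonneg_nonneg[OF norm_ge_zero[of "f i"] norm_ge_zero[of "g i"]] by linarith
qed auto

lemma coeff_square_summable: "(\<lambda>i. (norm (coeff f i))\<^sup>2) summable_on UNIV"
  using coeff[of f] by simp

instantiation ell2 :: (type, complex_inner) complex_inner
begin

lift_definition zero_ell2 :: "('a, 'b) ell2" is "\<lambda>_. 0"
  by simp

lift_definition plus_ell2 :: "('a, 'b) ell2 \<Rightarrow> ('a, 'b) ell2 \<Rightarrow> ('a, 'b) ell2"
  is "\<lambda>f g i. f i + g i"
  by (simp add: square_summable_add)

lift_definition uminus_ell2 :: "('a, 'b) ell2 \<Rightarrow> ('a, 'b) ell2" is "\<lambda>f i. - f i"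
  by simp

lift_definition minus_ell2 :: "('a, 'b) ell2 \<Rightarrow> ('a, 'b) ell2 \<Rightarrow> ('a, 'b) ell2"
  is "\<lambda>f g i. f i - g i"
  subgoal for f g using square_summable_add[of f "\<lambda>i. - g i"] by simp
  done

lift_definition scaleR_ell2 :: "real \<Rightarrow> ('a, 'b) ell2 \<Rightarrow> ('a, 'b) ell2" is "\<lambda>r f i. r *\<^sub>R f i"
  by (simp add: power_mult_distrib summable_on_cmult_right)

lift_definition scaleC_ell2 :: "complex \<Rightarrow> ('a, 'b) ell2 \<Rightarrow> ('a, 'b) ell2" is "\<lambda>r f i. r *\<^sub>C f i"
  by (simp add: power_mult_distrib summable_on_cmult_right norm_scaleC)

definition cinner_ell2 :: "('a, 'b) ell2 \<Rightarrow> ('a, 'b) ell2 \<Rightarrow> complex"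
  where "cinner_ell2 f g = (\<Sum>\<^sub>\<infinity>i. cinner (coeff f i) (coeff g i))"

definition inner_ell2 :: "('a, 'b) ell2 \<Rightarrow> ('a, 'b) ell2 \<Rightarrow> real"
  where "inner_ell2 f g = Re (cinner f g)"

definition norm_ell2 :: "('a, 'b) ell2 \<Rightarrow> real"
  where "norm_ell2 f = sqrt (inner f f)"

definition sgn_ell2 :: "('a, 'b) ell2 \<Rightarrow> ('a, 'b) ell2"
  where "sgn_ell2 f = inverse (norm f) *\<^sub>R f"

definition dist_ell2 :: "('a, 'b) ell2 \<Rightarrow> ('a, 'b) ell2 \<Rightarrow> real"
  where "dist_ell2 f g = norm (f - g)"

definition uniformity_ell2 :: "(('a, 'b) ell2 \<times> ('a, 'b) ell2) filter"
  where "uniformity_ell2 = (INF e\<in>{0 <..}. principal {(x, y). dist x y < e})"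

definition open_ell2 :: "('a, 'b) ell2 set \<Rightarrow> bool"
  where "open_ell2 U = (\<forall>x\<in>U. eventually (\<lambda>(x', y). x' = x \<longrightarrow> y \<in> U) uniformity)"

lemma coeff_simps [simp]:
  "coeff 0 i = 0" "coeff (f + g) i = coeff f i + coeff g i" "coeff (- f) i = - coeff f i"
  "coeff (f - g) i = coeff f i - coeff g i" "coeff (r *\<^sub>R f) i = r *\<^sub>R coeff f i"
  "coeff (c *\<^sub>C f) i = c *\<^sub>C coeff f i"
  by (transfer, simp)+

lemma ell2_eqI: "(\<And>i. coeff f i = coeff g i) \<Longrightarrow> f = g"
  by (meson coeff_inject ext)

lemma has_sum_cinner:
  "((\<lambda>i. cinner (coeff f i) (coeff g i)) has_sum cinner f g) UNIV"
  unfolding cinner_ell2_def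
  by (rule has_sum_infsum, rule abs_summable_summable)
    (intro abs_summable_cinner coeff_square_summable)

lemma has_sum_norm_square:
  "((\<lambda>i. (norm (coeff f i))\<^sup>2) has_sum Re (cinner f f)) UNIV"
  using has_sum_Re[OF has_sum_cinner[of f f]] by (simp add: cinner_self)

instance
proof
  fix f g h :: "('a, 'b) ell2" and r s :: real and c d :: complex and U :: "('a, 'b) ell2 set"
  show "f + g + h = f + (g + h)" "f + g = g + f" "0 + f = f" "- f + f = 0" "f - g = f + - g"
    by (auto intro!: ell2_eqI)
  show "r *\<^sub>R (f + g) = r *\<^sub>R f + r *\<^sub>R g" "(r + s) *\<^sub>R f = r *\<^sub>R f + s *\<^sub>R f"
    "r *\<^sub>R s *\<^sub>R f = (r * s) *\<^sub>R f" "1 *\<^sub>R f = f"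
    by (auto intro!: ell2_eqI simp: algebra_simps)
  show "dist f g = norm (f - g)" "sgn f = inverse (norm f) *\<^sub>R f"
    by (simp_all add: dist_ell2_def sgn_ell2_def)
  show "uniformity = (INF e\<in>{0 <..}. principal {(x, y :: ('a, 'b) ell2). dist x y < e})"
    by (rule uniformity_ell2_def)
  show "open U = (\<forall>x\<in>U. \<forall>\<^sub>F (x', y) in uniformity. x' = x \<longrightarrow> y \<in> U)"
    by (rule open_ell2_def)
  have commute: "cinner f g = cnj (cinner g f)" for f g :: "('a, 'b) ell2"
  proof -
    have "((\<lambda>i. cnj (cinner (coeff g i) (coeff f i))) has_sum cnj (cinner g f)) UNIV"
      using has_sum_cinner[of g f] by (simp add: has_sum_cnj_iff)
    moreover have "(\<lambda>i. cnj (cinner (coeff g i) (coeff f i))) = (\<lambda>i. cinner (coeff f i) (coeff g i))"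
      by (rule ext) (rule cinner_commute[symmetric])
    ultimately show ?thesis
      using has_sum_cinner[of f g] has_sum_unique by metis
  qed
  then show "cinner f g = cnj (cinner g f)" .
  have add: "cinner (f + g) h = cinner f h + cinner g h" for f g h :: "('a, 'b) ell2"
    using has_sum_add[OF has_sum_cinner[of f h] has_sum_cinner[of g h]] has_sum_cinner[of "f + g" h]
    by (simp add: cinner_add_left has_sum_unique)
  then show "cinner (f + g) h = cinner f h + cinner g h" .
  have scale: "cinner (c *\<^sub>C f) g = c * cinner f g" for f g :: "('a, 'b) ell2" and c
    using has_sum_cmult_right[OF has_sum_cinner[of f g], of c] has_sum_cinner[of "c *\<^sub>C f" g]
    by (simp add: cinner_scaleC_left has_sum_unique)
  then show "cinner (c *\<^sub>C f) g = c * cinner f g" .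
  show "c *\<^sub>C (f + g) = c *\<^sub>C f + c *\<^sub>C g" "(c + d) *\<^sub>C f = c *\<^sub>C f + d *\<^sub>C f"
    "c *\<^sub>C d *\<^sub>C f = (c * d) *\<^sub>C f"
    by (auto intro!: ell2_eqI simp: scaleC_add_right scaleC_add_left scaleC_scaleC)
  have real: "complex_of_real r *\<^sub>C f = r *\<^sub>R f" for f :: "('a, 'b) ell2" and r
    by (auto intro!: ell2_eqI simp: scaleC_of_real)
  then show "complex_of_real r *\<^sub>C f = r *\<^sub>R f" .
  show "inner f g = Re (cinner f g)"
    by (rule inner_ell2_def)
  show "inner f g = inner g f"
    by (simp add: inner_ell2_def commute[of f g])
  show "inner (f + g) h = inner f h + inner g h"
    by (simp add: inner_ell2_def add)
  show "inner (r *\<^sub>R f) g = r * inner f g"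
    by (simp add: inner_ell2_def scale flip: real)
  show "norm f = sqrt (inner f f)"
    by (rule norm_ell2_def)
  show "0 \<le> inner f f"
    unfolding inner_ell2_def by (rule has_sum_nonneg[OF has_sum_norm_square]) simp
  show "inner f f = 0 \<longleftrightarrow> f = 0"
  proof
    assume "inner f f = 0"
    then have sum0: "((\<lambda>i. (norm (coeff f i))\<^sup>2) has_sum 0) UNIV"
      using has_sum_norm_square[of f] by (simp add: inner_ell2_def)
    then have "(norm (coeff f i))\<^sup>2 \<le> 0" for i
      using has_sum_mono2[OF has_sum_finite[of "{i}" "\<lambda>i. (norm (coeff f i))\<^sup>2"] sum0] by simp
    then show "f = 0"
      by (intro ell2_eqI) simp
  next
    assume "f = 0"
    then show "inner f f = 0"
      by (simp add: inner_ell2_def cinner_ell2_def)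
  qed
qed

end

lemma has_sum_norm: "((\<lambda>i. (norm (coeff f i))\<^sup>2) has_sum (norm f)\<^sup>2) UNIV"
  using has_sum_norm_square[of f] by (simp add: cinner_self)

lemma bop_coeff: "bop (\<lambda>f. coeff f i)"
proof (rule bopI[of _ 1])
  fix f :: "('a, 'b) ell2"
  have "(norm (coeff f i))\<^sup>2 \<le> (norm f)\<^sup>2"
    using has_sum_mono2[OF has_sum_finite[of "{i}" "\<lambda>i. (norm (coeff f i))\<^sup>2"] has_sum_norm[of f]]
    by simp
  then show "norm (coeff f i) \<le> 1 * norm f"
    using power2_le_imp_le[OF _ norm_ge_zero] by simp
qed auto

lemma norm_ell2_le:
  assumes "\<And>F. finite F \<Longrightarrow> (\<Sum>i\<in>F. (norm (coeff f i))\<^sup>2) \<le> c\<^sup>2" "c \<ge> 0"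
  shows "norm f \<le> c"
proof -
  have "(norm f)\<^sup>2 \<le> c\<^sup>2"
    using has_sum_le_finite_sums[OF has_sum_norm[of f]] assms by blast
  then show ?thesis
    using assms(2) by (rule power2_le_imp_le)
qed

text \<open>Bounded finite partial sums suffice for a family to be square-summable.\<close>

lemma coeff_Abs:
  assumes "\<And>F. finite F \<Longrightarrow> (\<Sum>i\<in>F. (norm (f i))\<^sup>2) \<le> c"
  shows "coeff (Abs_ell2 f) = f"
proof -
  have "(\<lambda>i. (norm (f i))\<^sup>2) summable_on UNIV"
    by (rule nonneg_bounded_partial_sums_imp_summable_on[of _ _ c])
      (auto intro!: eventually_finite_subsets_at_top_weakI assms)
  then show ?thesis
    by (simp add: Abs_ell2_inverse)
qed

instance ell2 :: (type, "{complex_inner, banach}") banach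
proof
  fix X :: "nat \<Rightarrow> ('a, 'b) ell2"
  assume X: "Cauchy X"
  have "\<exists>l. (\<lambda>n. coeff (X n) i) \<longlonglongrightarrow> l" for i
    using bounded_linear.Cauchy[OF bop_bounded_linear[OF bop_coeff] X]
    by (simp add: Cauchy_convergent convergentD)
  then obtain x where x: "\<And>i. (\<lambda>n. coeff (X n) i) \<longlonglongrightarrow> x i"
    by metis
  have tail: "(\<Sum>i\<in>F. (norm (coeff (X n) i - x i))\<^sup>2) \<le> e\<^sup>2"
    if "\<And>m. m \<ge> n \<Longrightarrow> norm (X n - X m) \<le> e" "finite F" for e n F
  proof (rule tendsto_upperbound)
    show "(\<lambda>m. \<Sum>i\<in>F. (norm (coeff (X n) i - coeff (X m) i))\<^sup>2)
        \<longlonglongrightarrow> (\<Sum>i\<in>F. (norm (coeff (X n) i - x i))\<^sup>2)"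
      by (intro tendsto_intros x)
    show "\<forall>\<^sub>F m in sequentially. (\<Sum>i\<in>F. (norm (coeff (X n) i - coeff (X m) i))\<^sup>2) \<le> e\<^sup>2"
      unfolding eventually_sequentially
    proof (intro exI[of _ n] allI impI)
      fix m assume "n \<le> m"
      have "(\<Sum>i\<in>F. (norm (coeff (X n) i - coeff (X m) i))\<^sup>2) \<le> (norm (X n - X m))\<^sup>2"
        using has_sum_mono2[OF has_sum_finite[OF that(2)] has_sum_norm[of "X n - X m"]] by simp
      also have "\<dots> \<le> e\<^sup>2"
        using that(1)[OF \<open>n \<le> m\<close>] by (intro power_mono) auto
      finally show "(\<Sum>i\<in>F. (norm (coeff (X n) i - coeff (X m) i))\<^sup>2) \<le> e\<^sup>2" .
    qed
  qed simp
  obtain N where N: "\<And>m. m \<ge> N \<Longrightarrow> norm (X N - X m) \<le> 1"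
    using X metric_CauchyD[OF X, of 1] by (metis dist_norm less_eq_real_def order_refl zero_less_one)
  define d where "d = Abs_ell2 (\<lambda>i. coeff (X N) i - x i)"
  have d: "coeff d = (\<lambda>i. coeff (X N) i - x i)"
    unfolding d_def by (rule coeff_Abs[of _ "1\<^sup>2"]) (intro tail N)
  have "X \<longlonglongrightarrow> X N - d"
  proof (rule LIMSEQ_I)
    fix e :: real assume e: "e > 0"
    obtain M where M: "\<And>m n. m \<ge> M \<Longrightarrow> n \<ge> M \<Longrightarrow> norm (X m - X n) < e / 2"
      using metric_CauchyD[OF X, of "e / 2"] e by (auto simp: dist_norm)
    have "norm (X n - (X N - d)) \<le> e / 2" if "n \<ge> M" for n
    proof (rule norm_ell2_le)
      fix F :: "'a set" assume "finite F"
      have "(\<Sum>i\<in>F. (norm (coeff (X n) i - x i))\<^sup>2) \<le> (e / 2)\<^sup>2"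
        using M[OF that] that \<open>finite F\<close> by (intro tail) (auto intro: less_imp_le)
      then show "(\<Sum>i\<in>F. (norm (coeff (X n - (X N - d)) i))\<^sup>2) \<le> (e / 2)\<^sup>2"
        by (simp add: d)
    qed (use e in simp)
    then show "\<exists>M. \<forall>n\<ge>M. norm (X n - (X N - d)) < e"
      using e by (intro exI[of _ M]) (smt (verit) field_sum_of_halves)
  qed
  then show "convergent X"
    by (rule convergentI)
qed

section \<open>Products of commuting maps\<close>

lemma comp_prod_insert_apply:
  assumes "\<And>i j x. f i (f j x) = f j (f i x)" "finite I" "i \<notin> I"
  shows "comp_prod f (insert i I) x = f i (comp_prod f I x)"
  using comp_prod_insert[of f I i] assms by (auto simp: fun_eq_iff)

lemma comp_prod_commute:
  assumes "\<And>i j x. f i (f j x) = f j (f i x)" "finite I" "\<And>i x. i \<in> I \<Longrightarrow> g (f i x) = f i (g x)"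
  shows "g (comp_prod f I x) = comp_prod f I (g x)"
  using assms(2,3)
proof (induction I arbitrary: x rule: finite_induct)
  case (insert i I)
  then show ?case
    by (simp add: comp_prod_insert_apply[of f, OF assms(1)])
qed simp

lemma comp_prod_insert_apply':
  assumes "\<And>i j x. f i (f j x) = f j (f i x)" "finite I" "i \<notin> I"
  shows "comp_prod f (insert i I) x = comp_prod f I (f i x)"
  using comp_prod_commute[of f I "f i" x] assms by (simp add: comp_prod_insert_apply)

lemma comp_prod_remove:
  assumes "\<And>i j x. f i (f j x) = f j (f i x)" "finite I" "i \<in> I"
  shows "comp_prod f I x = f i (comp_prod f (I - {i}) x)"
  using comp_prod_insert_apply[of f "I - {i}" i x] assms by (simp add: insert_absorb)

lemma comp_prod_cong:
  assumes "\<And>i j x. f i (f j x) = f j (f i x)" "\<And>i j x. g i (g j x) = g j (g i x)"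
    "finite I" "\<And>i. i \<in> I \<Longrightarrow> f i = g i"
  shows "comp_prod f I x = comp_prod g I x"
  using assms(3,4)
proof (induction I arbitrary: x rule: finite_induct)
  case (insert i I)
  then show ?case
    by (simp add: comp_prod_insert_apply assms(1,2))
qed simp

lemma comp_prod_conj:
  assumes "\<And>i j x. f i (f j x) = f j (f i x)" "\<And>i j x. g i (g j x) = g j (g i x)"
    "finite I" "\<And>i x. V (f i x) = g i (V x)"
  shows "V (comp_prod f I x) = comp_prod g I (V x)"
  using assms(3)
proof (induction I arbitrary: x rule: finite_induct)
  case (insert i I)
  then show ?case
    by (simp add: comp_prod_insert_apply assms)
qed simp

lemma comp_prod_inverse:
  assumes "\<And>i j x. f i (f j x) = f j (f i x)" "\<And>i j x. g i (g j x) = g j (g i x)"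
    "finite I" "\<And>i x. f i (g i x) = x"
  shows "comp_prod f I (comp_prod g I x) = x"
  using assms(3)
proof (induction I arbitrary: x rule: finite_induct)
  case (insert i I)
  have "comp_prod f (insert i I) (comp_prod g (insert i I) x)
      = comp_prod f I (f i (g i (comp_prod g I x)))"
    using insert.hyps by (simp add: comp_prod_insert_apply'[of f, OF assms(1)] comp_prod_insert_apply[of g, OF assms(2)])
  then show ?case
    using insert.IH by (simp add: assms(4))
qed simp

lemma bop_comp_prod:
  assumes "\<And>i j x. f i (f j x) = f j (f i x)" "finite I" "\<And>i. i \<in> I \<Longrightarrow> bop (f i)"
  shows "bop (comp_prod f I)"
  using assms(2,3)
proof (induction I rule: finite_induct)
  case empty
  then show ?case
    using bop_id by (simp add: id_def)
next
  case (insert i I)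
  have "comp_prod f (insert i I) = f i \<circ> comp_prod f I"
    using comp_prod_insert_apply[of f I i, OF assms(1)] insert.hyps by (auto simp: fun_eq_iff)
  then show ?case
    using insert by (simp add: bop_compose comp_def)
qed


section \<open>Extension by continuity and a resolvent\<close>

lemma in_closure_LIMSEQ: "(\<And>n. f n \<in> S) \<Longrightarrow> f \<longlonglongrightarrow> x \<Longrightarrow> x \<in> closure (S :: 'a::metric_space set)"
  unfolding closure_sequential by (rule exI[of _ f]) simp

text \<open>A map A that is dominated by D factors through D; the factor extends to the closure
  of the range of D.\<close>

lemma bounded_extension:
  fixes D :: "'v::complex_inner \<Rightarrow> 'x::complex_inner" and A :: "'v \<Rightarrow> 'y::{complex_inner,banach}"
  assumes D: "bop D" and A: "bop A" and dom: "\<And>h. norm (A h) \<le> C * norm (D h)"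
  obtains \<Theta> where "\<Theta> \<in> bounded_ops (closure (range D)) (closure (range A))"
    "\<And>h. \<Theta> (D h) = A h"
proof -
  have "\<bar>C\<bar> \<ge> C" by simp
  then have dom': "norm (A h) \<le> \<bar>C\<bar> * norm (D h)" for h
    using dom[of h] mult_right_mono[of C "\<bar>C\<bar>" "norm (D h)"] by simp
  have "\<exists>y. \<forall>k. (\<lambda>n. D (k n)) \<longlonglongrightarrow> x \<longrightarrow> (\<lambda>n. A (k n)) \<longlonglongrightarrow> y"
    if "x \<in> closure (range D)" for x
  proof -
    obtain d where d: "\<And>n. d n \<in> range D" "d \<longlonglongrightarrow> x"
      using \<open>x \<in> closure (range D)\<close> closure_sequential by blast
    then have "\<forall>n. \<exists>h. d n = D h"
      by blast
    then obtain h where h: "\<And>n. d n = D (h n)"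
      by metis
    have "Cauchy (\<lambda>n. A (h n))"
    proof (rule metric_CauchyI)
      fix e :: real assume "e > 0"
      then have "e / (\<bar>C\<bar> + 1) > 0"
        by (simp add: add_nonneg_pos)
      then obtain M where M: "\<forall>m\<ge>M. \<forall>n\<ge>M. dist (d m) (d n) < e / (\<bar>C\<bar> + 1)"
        using LIMSEQ_imp_Cauchy[OF d(2)] metric_CauchyD by blast
      have "dist (A (h m)) (A (h n)) < e" if "m \<ge> M" "n \<ge> M" for m n
      proof -
        have "norm (A (h m) - A (h n)) \<le> \<bar>C\<bar> * norm (D (h m) - D (h n))"
          using dom'[of "h m - h n"] by (simp add: bop_diff[OF A] bop_diff[OF D])
        also have "\<dots> \<le> (\<bar>C\<bar> + 1) * norm (D (h m) - D (h n))"
          by (intro mult_right_mono) auto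
        also have "\<dots> < e"
          using M that by (simp add: h dist_norm field_simps add_nonneg_pos)
        finally show ?thesis
          by (simp add: dist_norm)
      qed
      then show "\<exists>M. \<forall>m\<ge>M. \<forall>n\<ge>M. dist (A (h m)) (A (h n)) < e"
        by blast
    qed
    then obtain y where y: "(\<lambda>n. A (h n)) \<longlonglongrightarrow> y"
      using Cauchy_convergent convergentD by blast
    have "(\<lambda>n. A (k n)) \<longlonglongrightarrow> y" if k: "(\<lambda>n. D (k n)) \<longlonglongrightarrow> x" for k
    proof -
      have "(\<lambda>n. D (k n) - D (h n)) \<longlonglongrightarrow> x - x"
        using k d(2) by (intro tendsto_diff) (auto simp flip: h)
      then have "(\<lambda>n. \<bar>C\<bar> * norm (D (k n) - D (h n))) \<longlonglongrightarrow> \<bar>C\<bar> * 0"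
        by (intro tendsto_mult_left tendsto_norm_zero) simp
      then have lim: "(\<lambda>n. \<bar>C\<bar> * norm (D (k n) - D (h n))) \<longlonglongrightarrow> 0"
        by (simp only: mult_zero_right)
      have le: "norm (A (k n) - A (h n)) \<le> \<bar>C\<bar> * norm (D (k n) - D (h n))" for n
        using dom'[of "k n - h n"] by (simp add: bop_diff[OF A] bop_diff[OF D])
      have "(\<lambda>n. A (k n) - A (h n)) \<longlonglongrightarrow> 0"
        by (rule Lim_null_comparison[OF always_eventually lim]) (use le in blast)
      then have "(\<lambda>n. (A (k n) - A (h n)) + A (h n)) \<longlonglongrightarrow> 0 + y"
        by (intro tendsto_add y)
      then show ?thesis
        by simp
    qed
    then show ?thesis
      by blast
  qed
  then obtain E where E: "\<And>x k. x \<in> closure (range D) \<Longrightarrow> (\<lambda>n. D (k n)) \<longlonglongrightarrow> x \<Longrightarrow>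
      (\<lambda>n. A (k n)) \<longlonglongrightarrow> E x"
    by metis
  have seq: "\<exists>k. (\<lambda>n. D (k n)) \<longlonglongrightarrow> x" if "x \<in> closure (range D)" for x
  proof -
    obtain d where d: "\<And>n. d n \<in> range D" "d \<longlonglongrightarrow> x"
      using \<open>x \<in> closure (range D)\<close> closure_sequential by blast
    then have "\<forall>n. \<exists>h. d n = D h"
      by blast
    then obtain h where "\<And>n. d n = D (h n)"
      by metis
    then have "d = (\<lambda>n. D (h n))"
      by blast
    then show ?thesis
      using d(2) by blast
  qed
  define \<Theta> where "\<Theta> = restrict E (closure (range D))"
  have val: "(\<lambda>n. A (k n)) \<longlonglongrightarrow> \<Theta> x" "x \<in> closure (range D)" if "(\<lambda>n. D (k n)) \<longlonglongrightarrow> x" for k x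
  proof -
    show "x \<in> closure (range D)"
      by (rule in_closure_LIMSEQ[OF _ that]) simp
    then show "(\<lambda>n. A (k n)) \<longlonglongrightarrow> \<Theta> x"
      using E that by (simp add: \<Theta>_def)
  qed
  have "\<Theta> (D h) = A h" for h
    using val(1)[of "\<lambda>_. h" "D h"] by (simp add: LIMSEQ_const_iff)
  moreover have "\<Theta> \<in> bounded_ops (closure (range D)) (closure (range A))"
    unfolding bounded_ops_def
  proof (intro CollectI conjI ballI allI exI[of _ "\<bar>C\<bar>"])
    show "\<Theta> \<in> closure (range D) \<rightarrow>\<^sub>E closure (range A)"
    proof
      fix x assume x: "x \<in> closure (range D)"
      then obtain k where "(\<lambda>n. D (k n)) \<longlonglongrightarrow> x"
        using seq by blast
      from val(1)[OF this] show "\<Theta> x \<in> closure (range A)"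
        by (rule in_closure_LIMSEQ[rotated]) simp
    qed (simp add: \<Theta>_def)
    fix x assume "x \<in> closure (range D)"
    then obtain k where k: "(\<lambda>n. D (k n)) \<longlonglongrightarrow> x"
      using seq by blast
    show "\<Theta> (x + y) = \<Theta> x + \<Theta> y" if "y \<in> closure (range D)" for y
    proof -
      obtain l where l: "(\<lambda>n. D (l n)) \<longlonglongrightarrow> y"
        using seq \<open>y \<in> closure (range D)\<close> by blast
      have "(\<lambda>n. D (k n + l n)) \<longlonglongrightarrow> x + y"
        unfolding bop_add[OF D] by (intro tendsto_add k l)
      from val(1)[OF this] have "(\<lambda>n. A (k n + l n)) \<longlonglongrightarrow> \<Theta> (x + y)" .
      moreover have "(\<lambda>n. A (k n + l n)) \<longlonglongrightarrow> \<Theta> x + \<Theta> y"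
        unfolding bop_add[OF A] by (intro tendsto_add val(1) k l)
      ultimately show ?thesis
        by (rule LIMSEQ_unique)
    qed
    show "\<Theta> (c *\<^sub>C x) = c *\<^sub>C \<Theta> x" for c
    proof -
      have "(\<lambda>n. D (c *\<^sub>C k n)) \<longlonglongrightarrow> c *\<^sub>C x"
        unfolding bop_scaleC[OF D] by (intro bop_tendsto[OF bop_scaleC_id] k)
      from val(1)[OF this] have "(\<lambda>n. A (c *\<^sub>C k n)) \<longlonglongrightarrow> \<Theta> (c *\<^sub>C x)" .
      moreover have "(\<lambda>n. A (c *\<^sub>C k n)) \<longlonglongrightarrow> c *\<^sub>C \<Theta> x"
        unfolding bop_scaleC[OF A] by (intro bop_tendsto[OF bop_scaleC_id] val(1) k)
      ultimately show ?thesis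
        by (rule LIMSEQ_unique)
    qed
    show "norm (\<Theta> x) \<le> \<bar>C\<bar> * norm x"
      by (rule LIMSEQ_le[OF tendsto_norm[OF val(1)[OF k]] tendsto_mult_left[OF tendsto_norm[OF k]]])
        (use dom' in auto)
  qed
  ultimately show ?thesis
    by (metis that)
qed

lemma
  assumes "A \<in> bounded_ops E F"
  shows bounded_ops_add: "x \<in> E \<Longrightarrow> y \<in> E \<Longrightarrow> A (x + y) = A x + A y"
    and bounded_ops_scaleC: "x \<in> E \<Longrightarrow> A (c *\<^sub>C x) = c *\<^sub>C A x"
    and bounded_ops_in: "x \<in> E \<Longrightarrow> A x \<in> F"
    and bounded_ops_undef: "x \<notin> E \<Longrightarrow> A x = undefined"
  using assms by (auto simp: bounded_ops_def)

text \<open>Closed complex subspaces.\<close>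

definition csubspace :: "'a::complex_inner set \<Rightarrow> bool"
  where "csubspace E \<longleftrightarrow> closed E \<and> 0 \<in> E \<and> (\<forall>x\<in>E. \<forall>y\<in>E. x + y \<in> E) \<and> (\<forall>c. \<forall>x\<in>E. c *\<^sub>C x \<in> E)"

lemma
  assumes "csubspace E"
  shows csubspace_0: "0 \<in> E"
    and csubspace_add: "x \<in> E \<Longrightarrow> y \<in> E \<Longrightarrow> x + y \<in> E"
    and csubspace_scaleC: "x \<in> E \<Longrightarrow> c *\<^sub>C x \<in> E"
    and csubspace_diff: "x \<in> E \<Longrightarrow> y \<in> E \<Longrightarrow> x - y \<in> E"
    and csubspace_closed: "closed E"
proof -
  show *: "0 \<in> E" "closed E" "x \<in> E \<Longrightarrow> y \<in> E \<Longrightarrow> x + y \<in> E"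
    "x \<in> E \<Longrightarrow> c *\<^sub>C x \<in> E" for x y c
    using assms unfolding csubspace_def by auto
  have "x - y = x + (-1) *\<^sub>C y"
    by (simp add: scaleC_minus_one)
  then show "x \<in> E \<Longrightarrow> y \<in> E \<Longrightarrow> x - y \<in> E"
    by (simp only: *)
qed

lemma csubspace_closure_range:
  fixes D :: "'a::complex_inner \<Rightarrow> 'b::complex_inner"
  assumes D: "bop D" shows "csubspace (closure (range D))"
  unfolding csubspace_def
proof (intro conjI ballI allI)
  show "0 \<in> closure (range D)"
    using bop_zero[OF D] closure_subset[of "range D"] rangeI[of D 0] by auto
  fix x assume "x \<in> closure (range D)"
  then obtain f where f: "\<And>n. f n \<in> range D" "f \<longlonglongrightarrow> x"
    using closure_sequential by blast
  show "c *\<^sub>C x \<in> closure (range D)" for c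
  proof -
    have "c *\<^sub>C f n \<in> range D" for n
    proof -
      obtain h where "f n = D h"
        using f(1)[of n] by (elim imageE)
      then show ?thesis
        by (simp flip: bop_scaleC[OF D])
    qed
    moreover have "(\<lambda>n. c *\<^sub>C f n) \<longlonglongrightarrow> c *\<^sub>C x"
      by (intro bop_tendsto[OF bop_scaleC_id] f)
    ultimately show ?thesis
      by (rule in_closure_LIMSEQ)
  qed
  fix y assume "y \<in> closure (range D)"
  then obtain g where g: "\<And>n. g n \<in> range D" "g \<longlonglongrightarrow> y"
    using closure_sequential by blast
  have "f n + g n \<in> range D" for n
  proof -
    obtain h h' where "f n = D h" "g n = D h'"
      using f(1)[of n] g(1)[of n] by (elim imageE)
    then show ?thesis
      by (simp flip: bop_add[OF D])
  qed
  moreover have "(\<lambda>n. f n + g n) \<longlonglongrightarrow> x + y"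
    by (intro tendsto_add f g)
  ultimately show "x + y \<in> closure (range D)"
    by (rule in_closure_LIMSEQ)
qed simp

lemma bounded_ops_tendsto:
  assumes A: "A \<in> bounded_ops E F" and E: "csubspace E" and f: "\<And>n. f n \<in> E" "f \<longlonglongrightarrow> x"
  shows "(\<lambda>n. A (f n)) \<longlonglongrightarrow> A x" "x \<in> E"
proof -
  show x: "x \<in> E"
    by (rule closed_sequentially[OF csubspace_closed[OF E] f])
  obtain K where K: "\<And>y. y \<in> E \<Longrightarrow> norm (A y) \<le> K * norm y"
    using A unfolding bounded_ops_def by blast
  have "A (f n) - A x = A (f n - x)" for n
    using bounded_ops_add[OF A csubspace_diff[OF E f(1)[of n] x] x] by simp
  then have le: "norm (A (f n) - A x) \<le> K * norm (f n - x)" for n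
    using K[OF csubspace_diff[OF E f(1)[of n] x]] by simp
  have "(\<lambda>n. K * norm (f n - x)) \<longlonglongrightarrow> K * 0"
    using f(2) by (intro tendsto_mult_left tendsto_norm_zero) (simp add: LIM_zero)
  then have lim: "(\<lambda>n. K * norm (f n - x)) \<longlonglongrightarrow> 0"
    by (simp only: mult_zero_right)
  have "(\<lambda>n. A (f n) - A x) \<longlonglongrightarrow> 0"
    by (rule Lim_null_comparison[OF always_eventually lim]) (use le in blast)
  then show "(\<lambda>n. A (f n)) \<longlonglongrightarrow> A x"
    by (simp add: LIM_zero_iff)
qed

lemma bounded_ops_eqI:
  assumes "A \<in> bounded_ops (closure (range D)) F" "B \<in> bounded_ops (closure (range D)) G"
    "bop D" "\<And>h. A (D h) = B (D h)"
  shows "A = B"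
proof
  fix x
  show "A x = B x"
  proof (cases "x \<in> closure (range D)")
    case True
    then obtain f where f: "\<And>n. f n \<in> range D" "f \<longlonglongrightarrow> x"
      using closure_sequential by blast
    have f': "f n \<in> closure (range D)" for n
      using f(1) closure_subset by blast
    have "A (f n) = B (f n)" for n
      using f(1)[of n] by (elim imageE) (simp add: assms(4))
    then show ?thesis
      using bounded_ops_tendsto(1)[OF assms(1) csubspace_closure_range[OF assms(3)] f' f(2)]
        bounded_ops_tendsto(1)[OF assms(2) csubspace_closure_range[OF assms(3)] f' f(2)]
      by (simp add: LIMSEQ_unique)
  qed (use assms in \<open>simp add: bounded_ops_undef\<close>)
qed

lemma bij_one_minus_contraction:
  fixes B :: "'a::{complex_inner,banach} \<Rightarrow> 'a"
  assumes "bop B" "\<And>x. norm (B x) \<le> norm x" "norm w < 1"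
  shows "bij (\<lambda>x. x - w *\<^sub>C B x)"
proof (rule bijI')
  fix x y
  have "x = y" if "x - w *\<^sub>C B x = y - w *\<^sub>C B y"
  proof (rule ccontr)
    assume "x \<noteq> y"
    have "x - y = w *\<^sub>C B (x - y)"
      using that by (simp add: bop_diff[OF assms(1)] scaleC_diff_right algebra_simps)
    then have "norm (x - y) \<le> norm w * norm (x - y)"
      using assms(2)[of "x - y"] by (metis mult_left_mono norm_ge_zero norm_scaleC)
    then show False
      using \<open>x \<noteq> y\<close> assms(3) by simp
  qed
  then show "(x - w *\<^sub>C B x = y - w *\<^sub>C B y) = (x = y)"
    by auto
  show "\<exists>x. y = x - w *\<^sub>C B x"
  proof -
    have "dist (y + w *\<^sub>C B a) (y + w *\<^sub>C B b) \<le> norm w * dist a b" for a b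
      using assms(2)[of "a - b"]
      by (simp add: dist_norm scaleC_diff_right[symmetric] bop_diff[OF assms(1), symmetric]
          norm_scaleC mult_left_mono)
    then obtain x where "y + w *\<^sub>C B x = x"
      using banach_fix_type[of "norm w" "\<lambda>x. y + w *\<^sub>C B x"] assms(3) by auto
    then show ?thesis
      by (intro exI[of _ x]) (simp add: algebra_simps)
  qed
qed

section \<open>Shifts and kernel vectors\<close>

lemma inj_raise: "inj (\<lambda>m :: 'n \<Rightarrow> nat. m(i := m i + p))"
  by (rule injI) (metis add_right_imp_eq fun_upd_eqD fun_upd_triv fun_upd_upd)

lemma range_raise: "m \<in> range (\<lambda>m :: 'n \<Rightarrow> nat. m(i := Suc (m i))) \<longleftrightarrow> m i \<noteq> 0"
proof
  assume "m i \<noteq> 0"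
  then have "m = (m(i := m i - 1))(i := Suc ((m(i := m i - 1)) i))"
    by (auto simp: fun_eq_iff)
  then show "m \<in> range (\<lambda>m. m(i := Suc (m i)))"
    by blast
qed auto

text \<open>A sum over multi-indices whose terms vanish for \<open>m\<^sub>i = 0\<close> may be reindexed by raising \<open>m\<^sub>i\<close>.\<close>

lemma has_sum_raise:
  fixes g :: "('n \<Rightarrow> nat) \<Rightarrow> 'b::{comm_monoid_add, topological_space}"
  assumes "\<And>m. m i = 0 \<Longrightarrow> g m = 0"
  shows "(g has_sum s) UNIV \<longleftrightarrow> ((\<lambda>m. g (m(i := Suc (m i)))) has_sum s) UNIV"
proof -
  have "(g has_sum s) UNIV \<longleftrightarrow> (g has_sum s) (range (\<lambda>m. m(i := Suc (m i))))"
    by (rule has_sum_cong_neutral) (use assms range_raise[of _ i] in auto)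
  also have "\<dots> \<longleftrightarrow> ((\<lambda>m. g (m(i := Suc (m i)))) has_sum s) UNIV"
    using has_sum_reindex[OF inj_raise[of i 1], of g s] by (simp add: comp_def)
  finally show ?thesis .
qed

text \<open>Multiplication by the i-th coordinate function, and its adjoint.\<close>

lift_definition shift :: "'n \<Rightarrow> ('n \<Rightarrow> nat, 'a) ell2 \<Rightarrow> ('n \<Rightarrow> nat, 'a::complex_inner) ell2"
  is "\<lambda>i f m. if m i = 0 then 0 else f (m(i := m i - 1))"
proof -
  fix i and f :: "('n \<Rightarrow> nat) \<Rightarrow> 'a"
  assume "(\<lambda>m. (norm (f m))\<^sup>2) summable_on UNIV"
  then obtain s where "((\<lambda>m. (norm (f m))\<^sup>2) has_sum s) UNIV"
    by (auto simp: summable_on_def)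
  then have "((\<lambda>m. (norm (if m i = 0 then 0 else f (m(i := m i - 1))))\<^sup>2) has_sum s) UNIV"
    by (subst has_sum_raise[of i]) auto
  then show "(\<lambda>m. (norm (if m i = 0 then 0 else f (m(i := m i - 1))))\<^sup>2) summable_on UNIV"
    by (auto simp: summable_on_def)
qed

lift_definition back_shift :: "'n \<Rightarrow> ('n \<Rightarrow> nat, 'a) ell2 \<Rightarrow> ('n \<Rightarrow> nat, 'a::complex_inner) ell2"
  is "\<lambda>i f m. f (m(i := Suc (m i)))"
proof -
  fix i and f :: "('n \<Rightarrow> nat) \<Rightarrow> 'a"
  assume "(\<lambda>m. (norm (f m))\<^sup>2) summable_on UNIV"
  then have "(\<lambda>m. (norm (f m))\<^sup>2) summable_on range (\<lambda>m. m(i := Suc (m i)))"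
    by (rule summable_on_subset_banach) simp
  then show "(\<lambda>m. (norm (f (m(i := Suc (m i)))))\<^sup>2) summable_on UNIV"
    using summable_on_reindex[OF inj_raise[of i 1], of "\<lambda>m. (norm (f m))\<^sup>2"] by (simp add: comp_def)
qed

lemma coeff_shift [simp]:
  "coeff (shift i f) m = (if m i = 0 then 0 else coeff f (m(i := m i - 1)))"
  by transfer simp

lemma coeff_back_shift [simp]: "coeff (back_shift i f) m = coeff f (m(i := Suc (m i)))"
  by transfer simp

lemma cinner_shift_left: "cinner (shift i f) g = cinner f (back_shift i g)"
proof -
  have "((\<lambda>m. cinner (coeff (shift i f) m) (coeff g m)) has_sum cinner f (back_shift i g)) UNIV"
    by (subst has_sum_raise[of i]) (use has_sum_cinner[of f "back_shift i g"] in simp_all)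
  then show ?thesis
    using has_sum_cinner[of "shift i f" g] has_sum_unique by blast
qed

lemma back_shift_shift [simp]: "back_shift i (shift i f) = f"
  by (rule ell2_eqI) simp

lemma cinner_shift_shift: "cinner (shift i f) (shift i g) = cinner f g"
  by (simp add: cinner_shift_left)

lemma norm_shift [simp]: "norm (shift i f) = norm f"
  by (simp add: norm_eq_sqrt_inner inner_eq_Re_cinner cinner_shift_shift)

lemma bop_shift: "bop (shift i)"
  by (rule bopI[of _ 1]) (auto intro!: ell2_eqI)

lemma bop_back_shift: "bop (back_shift i)"
  by (rule bop_of_adjoint[OF bop_shift cinner_shift_left])

lemma cinner_back_shift_left: "cinner (back_shift i f) g = cinner f (shift i g)"
  by (rule cinner_flip) (simp add: cinner_shift_left)

lemma shift_commute: "shift i (shift j f) = shift j (shift i f)"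
  by (cases "i = j") (auto intro!: ell2_eqI simp: fun_upd_twist)

lemma back_shift_commute: "back_shift i (back_shift j f) = back_shift j (back_shift i f)"
  by (cases "i = j") (auto intro!: ell2_eqI simp: fun_upd_twist)

lemma back_shift_shift_commute: "i \<noteq> j \<Longrightarrow> back_shift i (shift j f) = shift j (back_shift i f)"
  by (auto intro!: ell2_eqI simp: fun_upd_twist)

lemma norm_back_shift_le: "norm (back_shift i f) \<le> norm f"
proof (cases "back_shift i f = 0")
  case False
  have "(norm (back_shift i f))\<^sup>2 = norm (cinner f (shift i (back_shift i f)))"
    by (simp flip: cinner_back_shift_left add: norm_cinner_self)
  also have "\<dots> \<le> norm f * norm (back_shift i f)"
    using norm_cinner_le[of f "shift i (back_shift i f)"] by simp
  finally show ?thesis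
    using False by (simp add: power2_eq_square)
qed simp

lemma coeff_back_shift_funpow: "coeff ((back_shift i ^^ p) f) m = coeff f (m(i := m i + p))"
  by (induction p arbitrary: m) auto

lemma back_shift_funpow_tendsto_0: "(\<lambda>p. (back_shift i ^^ p) f) \<longlonglongrightarrow> 0"
proof (rule LIMSEQ_I)
  fix e :: real assume e: "e > 0"
  have "eventually (\<lambda>F. dist (\<Sum>m\<in>F. (norm (coeff f m))\<^sup>2) ((norm f)\<^sup>2) < (e / 2)\<^sup>2)
      (finite_subsets_at_top UNIV)"
    using has_sum_norm[of f] e unfolding has_sum_def by (intro tendstoD) auto
  then obtain F where F: "finite F" "\<bar>(\<Sum>m\<in>F. (norm (coeff f m))\<^sup>2) - (norm f)\<^sup>2\<bar> < (e / 2)\<^sup>2"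
    unfolding eventually_finite_subsets_at_top dist_real_def by blast
  \<comment> \<open>beyond this exponent the shifted multi-indices avoid F, which carries almost all of the norm\<close>
  define N where "N = Suc (\<Sum>m\<in>F. m i)"
  have "norm ((back_shift i ^^ p) f) \<le> e / 2" if "p \<ge> N" for p
  proof (rule norm_ell2_le)
    fix G :: "('a \<Rightarrow> nat) set" assume G: "finite G"
    let ?h = "\<lambda>m :: 'a \<Rightarrow> nat. m(i := m i + p)"
    have inj: "inj_on ?h G"
      using inj_raise[of i p] by (rule inj_on_subset) simp
    have "?h ` G \<inter> F = {}"
    proof -
      have "?h m \<notin> F" for m
      proof
        assume "?h m \<in> F"
        then have "(?h m) i \<le> (\<Sum>m\<in>F. m i)"
          using F(1) by (intro member_le_sum[of "?h m" F "\<lambda>m. m i"]) simp_all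
        then show False
          using that by (simp add: N_def)
      qed
      then show ?thesis
        by blast
    qed
    then have "(\<Sum>m\<in>?h ` G. (norm (coeff f m))\<^sup>2) + (\<Sum>m\<in>F. (norm (coeff f m))\<^sup>2)
        = (\<Sum>m\<in>?h ` G \<union> F. (norm (coeff f m))\<^sup>2)"
      using F(1) G by (simp add: sum.union_disjoint)
    also have "\<dots> \<le> (norm f)\<^sup>2"
      using has_sum_mono2[OF has_sum_finite[of "?h ` G \<union> F"] has_sum_norm[of f]] F(1) G by simp
    finally have "(\<Sum>m\<in>?h ` G. (norm (coeff f m))\<^sup>2) \<le> (e / 2)\<^sup>2"
      using F(2) by linarith
    then show "(\<Sum>m\<in>G. (norm (coeff ((back_shift i ^^ p) f) m))\<^sup>2) \<le> (e / 2)\<^sup>2"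
      by (simp add: sum.reindex[OF inj] coeff_back_shift_funpow)
  qed (use e in simp)
  then show "\<exists>N. \<forall>p\<ge>N. norm ((back_shift i ^^ p) f - 0) < e"
    using e by (intro exI[of _ N]) (smt (verit) diff_zero field_sum_of_halves)
qed

text \<open>
  The vector \<open>szego_kernel w \<eta>\<close> represents evaluation at w in the direction \<open>\<eta>\<close>: the inner product of f
  with it is that of \<open>\<Sum>\<^sub>m w\<^sup>m f\<^sub>m\<close> with \<open>\<eta>\<close>.  All values are accessed through these inner products.
\<close>

definition szego_kernel :: "complex ^ 'n \<Rightarrow> 'a \<Rightarrow> ('n::finite \<Rightarrow> nat, 'a::complex_inner) ell2"
  where "szego_kernel w \<eta> = Abs_ell2 (\<lambda>m. (\<Prod>i\<in>UNIV. cnj (w $ i) ^ m i) *\<^sub>C \<eta>)"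

lemma polydisc_norm_sq: "w \<in> polydisc \<Longrightarrow> (norm (w $ i))\<^sup>2 < 1"
  using power_strict_mono[of "norm (w $ i)" 1 2] by (simp add: polydisc_def)

text \<open>The finite partial sums are bounded by a product of geometric series.\<close>

lemma kernel_bound:
  fixes w :: "complex ^ 'n::finite"
  assumes w: "w \<in> polydisc" and F: "finite F"
  shows "(\<Sum>m\<in>F. (norm ((\<Prod>i\<in>UNIV. cnj (w $ i) ^ m i) *\<^sub>C (\<eta> :: 'a::complex_inner)))\<^sup>2)
    \<le> (sqrt (\<Prod>i\<in>UNIV. 1 / (1 - (norm (w $ i))\<^sup>2)) * norm \<eta>)\<^sup>2"
proof -
  define r where "r i = (norm (w $ i))\<^sup>2" for i
  have r: "0 \<le> r i" "r i < 1" for i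
    using polydisc_norm_sq[OF w] by (simp_all add: r_def)
  define N where "N = (\<Sum>m\<in>F. \<Sum>i\<in>UNIV. m i)"
  have "m i \<le> N" if "m \<in> F" for m i
  proof -
    have "m i \<le> (\<Sum>i\<in>UNIV. m i)"
      by (intro member_le_sum) auto
    also have "\<dots> \<le> N"
      unfolding N_def using that F by (intro member_le_sum[of m F "\<lambda>m. \<Sum>i\<in>UNIV. m i"]) auto
    finally show ?thesis .
  qed
  then have sub: "F \<subseteq> PiE UNIV (\<lambda>_. {..N})"
    by auto
  have "(\<Sum>m\<in>F. \<Prod>i\<in>UNIV. r i ^ m i) \<le> (\<Sum>m\<in>PiE UNIV (\<lambda>_. {..N}). \<Prod>i\<in>UNIV. r i ^ m i)"
    using sub r by (intro sum_mono2) (auto intro!: finite_PiE prod_nonneg)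
  also have "\<dots> = (\<Prod>i\<in>UNIV. \<Sum>p\<le>N. r i ^ p)"
    by (rule prod_sum_PiE[symmetric]) auto
  also have "\<dots> \<le> (\<Prod>i\<in>UNIV. 1 / (1 - r i))"
  proof (rule prod_mono, intro conjI)
    fix i
    show "0 \<le> (\<Sum>p\<le>N. r i ^ p)"
      using r by (intro sum_nonneg) auto
    have "(\<Sum>p\<le>N. r i ^ p) \<le> (\<Sum>p. r i ^ p)"
      using r by (intro sum_le_suminf summable_geometric) auto
    also have "\<dots> = 1 / (1 - r i)"
      using r by (intro suminf_geometric) auto
    finally show "(\<Sum>p\<le>N. r i ^ p) \<le> 1 / (1 - r i)" .
  qed
  finally have le: "(\<Sum>m\<in>F. \<Prod>i\<in>UNIV. r i ^ m i) \<le> (\<Prod>i\<in>UNIV. 1 / (1 - r i))" .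
  have "0 \<le> (\<Prod>i\<in>UNIV. 1 / (1 - r i))"
    using r by (intro prod_nonneg) (simp add: less_imp_le)
  have "(norm ((\<Prod>i\<in>UNIV. cnj (w $ i) ^ m i) *\<^sub>C \<eta>))\<^sup>2 = (\<Prod>i\<in>UNIV. r i ^ m i) * (norm \<eta>)\<^sup>2" for m
    by (simp add: norm_scaleC power_mult_distrib prod_norm[symmetric] norm_power prod_power_distrib
        r_def power_mult[symmetric] mult.commute)
  then show ?thesis
    using le \<open>0 \<le> (\<Prod>i\<in>UNIV. 1 / (1 - r i))\<close>
    by (simp add: sum_distrib_right[symmetric] power_mult_distrib mult_right_mono
        flip: r_def)
qed

lemma coeff_kernel:
  assumes "w \<in> polydisc"
  shows "coeff (szego_kernel w \<eta>) m = (\<Prod>i\<in>UNIV. cnj (w $ i) ^ m i) *\<^sub>C \<eta>"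
  unfolding szego_kernel_def using coeff_Abs[OF kernel_bound[OF assms, of _ \<eta>]] by simp

lemma norm_kernel_le:
  fixes w :: "complex ^ 'n::finite"
  assumes w: "w \<in> polydisc"
  shows "norm (szego_kernel w \<eta>) \<le> sqrt (\<Prod>i\<in>UNIV. 1 / (1 - (norm (w $ i))\<^sup>2)) * norm \<eta>"
proof (rule norm_ell2_le)
  have "0 \<le> (\<Prod>i\<in>UNIV. 1 / (1 - (norm (w $ i))\<^sup>2))"
    using polydisc_norm_sq[OF w] by (intro prod_nonneg) (simp add: less_imp_le)
  then show "0 \<le> sqrt (\<Prod>i\<in>UNIV. 1 / (1 - (norm (w $ i))\<^sup>2)) * norm \<eta>"
    by simp
qed (simp only: coeff_kernel[OF w] kernel_bound[OF w])

lemma bop_kernel: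
  assumes w: "w \<in> polydisc"
  shows "bop (szego_kernel w)"
  by (rule bopI[OF _ _ norm_kernel_le[OF w]])
    (rule ell2_eqI, simp add: coeff_kernel[OF w] scaleC_add_right scaleC_scaleC mult.commute)+

lemma back_shift_kernel:
  assumes w: "w \<in> polydisc"
  shows "back_shift i (szego_kernel w \<eta>) = cnj (w $ i) *\<^sub>C szego_kernel w \<eta>"
proof (rule ell2_eqI)
  fix m
  have "(\<Prod>j\<in>UNIV. cnj (w $ j) ^ (m(i := Suc (m i))) j)
      = cnj (w $ i) * (\<Prod>j\<in>UNIV. cnj (w $ j) ^ m j)"
    by (simp add: prod.remove[of UNIV i])
  then show "coeff (back_shift i (szego_kernel w \<eta>)) m = coeff (cnj (w $ i) *\<^sub>C szego_kernel w \<eta>) m"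
    by (simp add: coeff_kernel[OF w] scaleC_scaleC)
qed

lemma cinner_shift_kernel:
  assumes w: "w \<in> polydisc"
  shows "cinner (shift i f) (szego_kernel w \<eta>) = w $ i * cinner f (szego_kernel w \<eta>)"
  by (simp add: cinner_shift_left back_shift_kernel[OF w] cinner_scaleC_right)

text \<open>The point w with the coordinates in A replaced by 0.\<close>

definition zero_on :: "'n set \<Rightarrow> complex ^ 'n \<Rightarrow> complex ^ 'n"
  where "zero_on A w = (\<chi> k. if k \<in> A then 0 else w $ k)"

lemma zero_on_polydisc: "w \<in> polydisc \<Longrightarrow> zero_on A w \<in> polydisc"
  by (auto simp: polydisc_def zero_on_def)

lemma zero_on_insert: "zero_on (insert i A) w = zero_on {i} (zero_on A w)"
  by (auto simp: zero_on_def vec_eq_iff)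

lemma kernel_decomp:
  assumes w: "w \<in> polydisc"
  shows "szego_kernel w \<eta> = szego_kernel (zero_on {i} w) \<eta> + cnj (w $ i) *\<^sub>C shift i (szego_kernel w \<eta>)"
proof (rule ell2_eqI)
  fix m
  let ?z = "zero_on {i} w"
  show "coeff (szego_kernel w \<eta>) m
      = coeff (szego_kernel ?z \<eta> + cnj (w $ i) *\<^sub>C shift i (szego_kernel w \<eta>)) m"
  proof (cases "m i = 0")
    case True
    have "(\<Prod>j\<in>UNIV. cnj (?z $ j) ^ m j) = (\<Prod>j\<in>UNIV. cnj (w $ j) ^ m j)"
      by (intro prod.cong) (auto simp: zero_on_def True)
    then show ?thesis
      by (simp add: coeff_kernel[OF w] coeff_kernel[OF zero_on_polydisc[OF w]] True)
  next
    case False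
    have "(\<Prod>j\<in>UNIV. cnj (?z $ j) ^ m j) = 0"
      using False by (auto simp: zero_on_def intro!: bexI[of _ i])
    moreover have "(\<Prod>j\<in>UNIV. cnj (w $ j) ^ m j)
        = cnj (w $ i) * (\<Prod>j\<in>UNIV. cnj (w $ j) ^ (m(i := m i - 1)) j)"
      using False by (simp add: prod.remove[of UNIV i] mult.assoc[symmetric] power_Suc[symmetric]
        del: power_Suc)
    ultimately show ?thesis
      using False
      by (simp add: coeff_kernel[OF w] coeff_kernel[OF zero_on_polydisc[OF w]] scaleC_scaleC
          del: prod_zero_iff)
  qed
qed

lemma cinner_one_minus_back_shift_kernel:
  assumes w: "w \<in> polydisc"
  shows "cinner (f - w $ i *\<^sub>C back_shift i f) (szego_kernel w \<eta>) = cinner f (szego_kernel (zero_on {i} w) \<eta>)"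
proof -
  have "cinner f (szego_kernel w \<eta>) = cinner f (szego_kernel (zero_on {i} w) \<eta>)
      + cinner f (cnj (w $ i) *\<^sub>C shift i (szego_kernel w \<eta>))"
    by (subst kernel_decomp[OF w, of \<eta> i]) (rule cinner_add_right)
  then show ?thesis
    by (simp add: cinner_diff_left cinner_scaleC_left cinner_scaleC_right cinner_back_shift_left)
qed

lemma kernel_0:
  fixes f :: "('n::finite \<Rightarrow> nat, 'a::complex_inner) ell2"
  shows "cinner f (szego_kernel 0 \<eta>) = cinner (coeff f (\<lambda>_. 0)) \<eta>"
proof -
  have z: "(0 :: complex ^ 'n) \<in> polydisc"
    by (simp add: polydisc_def)
  have "(\<Prod>i\<in>UNIV. cnj (0 $ i) ^ m i) = (if m = (\<lambda>_. 0) then 1 else 0 :: complex)"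
    for m :: "'n \<Rightarrow> nat"
    by (auto simp: fun_eq_iff)
  then have c: "coeff (szego_kernel (0 :: complex ^ 'n) \<eta>) m = (if m = (\<lambda>_. 0) then \<eta> else 0)" for m
    by (simp add: coeff_kernel[OF z])
  have "((\<lambda>m. cinner (coeff f m) (coeff (szego_kernel 0 \<eta>) m)) has_sum
      cinner (coeff f (\<lambda>_. 0)) \<eta>) UNIV"
    by (rule has_sum_finite_neutralI[of "{\<lambda>_. 0}"]) (auto simp: c)
  then show ?thesis
    by (rule has_sum_unique[OF has_sum_cinner])
qed

text \<open>
  A function that vanishes on the polydisc has zero coefficients: its backward shifts vanish too,
  first where the i-th coordinate is not 0 and then by continuity everywhere.
\<close>

lemma vanishing_back_shift:
  fixes f :: "('n::finite \<Rightarrow> nat, 'a::complex_inner) ell2"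
  assumes f: "\<And>w. w \<in> polydisc \<Longrightarrow> cinner f (szego_kernel w \<eta>) = 0" and w: "w \<in> polydisc"
  shows "cinner (back_shift i f) (szego_kernel w \<eta>) = 0"
proof -
  let ?g = "back_shift i f"
  have nz: "cinner ?g (szego_kernel v \<eta>) = 0" if v: "v \<in> polydisc" "v $ i \<noteq> 0" for v
    using cinner_one_minus_back_shift_kernel[OF v(1), of f i \<eta>] f[OF v(1)]
      f[OF zero_on_polydisc[OF v(1)]] v(2)
    by (simp add: cinner_diff_left cinner_scaleC_left)
  show ?thesis
  proof (cases "w $ i = 0")
    case True
    have bound: "norm (cinner ?g (szego_kernel w \<eta>)) \<le> t * (norm ?g * (2 * norm (szego_kernel w \<eta>)))"
      if t: "0 < t" "t \<le> 1/2" for t :: real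
    proof -
      define v :: "complex ^ 'n" where "v = (\<chi> k. if k = i then of_real t else w $ k)"
      have v: "v \<in> polydisc" "v $ i = of_real t"
        using w t by (auto simp: polydisc_def v_def)
      have zv: "zero_on {i} v = w"
        using True by (auto simp: zero_on_def v_def vec_eq_iff)
      have dec: "szego_kernel v \<eta> = szego_kernel w \<eta> + of_real t *\<^sub>C shift i (szego_kernel v \<eta>)"
        using kernel_decomp[OF v(1), of \<eta> i] by (simp add: zv v(2))
      have "norm (szego_kernel v \<eta>) \<le> norm (szego_kernel w \<eta>) + t * norm (szego_kernel v \<eta>)"
        using norm_triangle_ineq[of "szego_kernel w \<eta>" "of_real t *\<^sub>C shift i (szego_kernel v \<eta>)"] t(1)
        by (simp add: dec[symmetric] norm_scaleC)
      moreover have "t * norm (szego_kernel v \<eta>) \<le> 1/2 * norm (szego_kernel v \<eta>)"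
        using t by (intro mult_right_mono) auto
      ultimately have nv: "norm (szego_kernel v \<eta>) \<le> 2 * norm (szego_kernel w \<eta>)"
        by linarith
      have "0 = cinner ?g (szego_kernel v \<eta>)"
        using nz[OF v(1)] v(2) t(1) by simp
      also have "\<dots> = cinner ?g (szego_kernel w \<eta>) + of_real t * cinner (back_shift i ?g) (szego_kernel v \<eta>)"
        by (subst dec) (simp add: cinner_add_right cinner_scaleC_right cinner_back_shift_left)
      finally have "cinner ?g (szego_kernel w \<eta>) = - (of_real t * cinner (back_shift i ?g) (szego_kernel v \<eta>))"
        by (simp add: eq_neg_iff_add_eq_0)
      then have "norm (cinner ?g (szego_kernel w \<eta>)) = t * norm (cinner (back_shift i ?g) (szego_kernel v \<eta>))"
        using t(1) by (simp add: norm_mult)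
      also have "\<dots> \<le> t * (norm (back_shift i ?g) * norm (szego_kernel v \<eta>))"
        using t(1) by (intro mult_left_mono norm_cinner_le) auto
      also have "\<dots> \<le> t * (norm ?g * (2 * norm (szego_kernel w \<eta>)))"
        using t(1) nv by (intro mult_left_mono mult_mono norm_back_shift_le) auto
      finally show ?thesis .
    qed
    have "norm (cinner ?g (szego_kernel w \<eta>)) \<le> 0"
    proof (rule tendsto_lowerbound)
      show "((\<lambda>t. t * (norm ?g * (2 * norm (szego_kernel w \<eta>)))) \<longlongrightarrow> 0) (at_right 0)"
        by (intro tendsto_mult_left_zero tendsto_ident_at)
      show "\<forall>\<^sub>F t in at_right 0. norm (cinner ?g (szego_kernel w \<eta>)) \<le> t * (norm ?g * (2 * norm (szego_kernel w \<eta>)))"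
        unfolding eventually_at_right_field by (intro exI[of _ "1/2"]) (auto intro!: bound)
    qed simp
    then show ?thesis
      by simp
  qed (use nz w in blast)
qed

lemma vanishing_coeff:
  fixes f :: "('n::finite \<Rightarrow> nat, 'a::complex_inner) ell2"
  assumes "\<And>w. w \<in> polydisc \<Longrightarrow> cinner f (szego_kernel w \<eta>) = 0"
  shows "cinner (coeff f m) \<eta> = 0"
  using assms
proof (induction "\<Sum>i\<in>UNIV. m i" arbitrary: f m rule: less_induct)
  case less
  show ?case
  proof (cases "m = (\<lambda>_. 0)")
    case True
    then show ?thesis
      using less.prems[of 0] kernel_0[of f \<eta>] by (simp add: polydisc_def)
  next
    case False
    then obtain i where i: "m i \<noteq> 0"
      by auto
    let ?m = "m(i := m i - 1)"
    have "(\<Sum>j\<in>UNIV. ?m j) < (\<Sum>j\<in>UNIV. m j)"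
      using i by (intro sum_strict_mono_ex1) (auto intro!: bexI[of _ i])
    then have "cinner (coeff (back_shift i f) ?m) \<eta> = 0"
      by (rule less.hyps) (rule vanishing_back_shift[OF less.prems])
    then show ?thesis
      using i by simp
  qed
qed

section \<open>The dilation of a Szego tuple\<close>

lemma comp_prod_trivial: "(\<And>i x. f i x = x) \<Longrightarrow> finite I \<Longrightarrow> comp_prod f I x = x"
  by (rotate_tac, induction I rule: finite_induct) (simp_all add: comp_prod_insert_apply)

lemma cinner_comp_prod:
  assumes "\<And>i j x. f i (f j x) = f j (f i x)" "\<And>i j x. g i (g j x) = g j (g i x)" "finite I"
    "\<And>i x y. cinner (f i x) y = cinner x (g i y)"
  shows "cinner (comp_prod f I x) y = cinner x (comp_prod g I y)"
  using assms(3)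
proof (induction I arbitrary: x rule: finite_induct)
  case (insert i I)
  have "cinner (comp_prod f (insert i I) x) y = cinner (comp_prod f I (f i x)) y"
    using insert.hyps by (subst comp_prod_insert_apply'[of f, OF assms(1)]) simp_all
  also have "\<dots> = cinner x (comp_prod g (insert i I) y)"
    using insert.hyps
    by (subst comp_prod_insert_apply[of g, OF assms(2)]) (simp_all add: insert.IH assms(4))
  finally show ?case .
qed simp

lemma funpow_commute:
  assumes "\<And>x. f (g x) = g (f x)"
  shows "(f ^^ p) ((g ^^ q) x) = (g ^^ q) ((f ^^ p) x)"
proof -
  have *: "f ((g ^^ q) x) = (g ^^ q) (f x)" for x
    by (induction q) (simp_all add: assms)
  show ?thesis
    by (induction p) (simp_all add: *)
qed

text \<open>A norm-preserving map preserves inner products.\<close>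

lemma isometry_cinner:
  assumes V: "bop V" and n: "\<And>x. norm (V x) = norm x"
  shows "cinner (V x) (V y) = cinner x y"
proof -
  have re: "Re (cinner (V x) (V y)) = Re (cinner x y)" for x y
    using n[of "x - y"] norm_diff_sq[of x y] norm_diff_sq[of "V x" "V y"]
    by (simp add: bop_diff[OF V, symmetric] n)
  show ?thesis
    using re[of x y] re[of "\<i> *\<^sub>C x" y]
    by (simp add: complex_eq_iff bop_scaleC[OF V] cinner_scaleC_left)
qed

text \<open>The theory of one Szego tuple T; \<open>Ts i\<close> is the adjoint of \<open>T i\<close>.\<close>

locale szego =
  fixes T :: "'n::finite \<Rightarrow> 'a::{complex_inner,banach} \<Rightarrow> 'a"
  assumes szego: "szego_tuple T"
begin

abbreviation Ts :: "'n \<Rightarrow> 'a \<Rightarrow> 'a" where "Ts i \<equiv> adj (T i)"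

lemma bop_T: "bop (T i)" and norm_T: "norm (T i x) \<le> norm x"
  and T_commute: "T i (T j x) = T j (T i x)"
  and positive_szego_inv: "positive_op (szego_inv T)"
  and Ts_tendsto_0: "(\<lambda>m. (Ts i ^^ m) h) \<longlonglongrightarrow> 0"
  using szego unfolding szego_tuple_def commuting_contractions_def contraction_def bounded_ops_UNIV
    C_dot_0_def by (auto simp: fun_eq_iff)

lemma bop_Ts: "bop (Ts i)"
  by (rule bop_adj[OF bop_T])

lemma Ts_commute: "Ts i (Ts j x) = Ts j (Ts i x)"
  using adj_commute[OF bop_T bop_T, of i j] T_commute by (auto simp: fun_eq_iff)

lemma norm_Ts: "norm (Ts i x) \<le> norm x"
  by (rule norm_adj_le[OF bop_T norm_T])

lemmas cinner_Ts_left = cinner_adj_left[OF bop_T]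
lemmas cinner_Ts_right = cinner_adj_right[OF bop_T]

text \<open>The power \<open>T\<^sup>*\<^sup>m\<close> for a multi-index m.\<close>

definition Ts_pow :: "('n \<Rightarrow> nat) \<Rightarrow> 'a \<Rightarrow> 'a"
  where "Ts_pow m = comp_prod (\<lambda>i. Ts i ^^ m i) UNIV"

lemma Ts_funpow_commute: "(Ts i ^^ p) ((Ts j ^^ q) x) = (Ts j ^^ q) ((Ts i ^^ p) x)"
  by (rule funpow_commute) (rule Ts_commute)

lemma Ts_pow_0: "Ts_pow (\<lambda>_. 0) x = x"
  unfolding Ts_pow_def by (rule comp_prod_trivial) auto

lemma bop_Ts_pow: "bop (Ts_pow m)"
  unfolding Ts_pow_def by (intro bop_comp_prod Ts_funpow_commute bop_funpow bop_Ts) auto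

lemma Ts_pow_add: "Ts_pow (m(i := m i + p)) h = Ts_pow m ((Ts i ^^ p) h)"
proof -
  let ?f = "\<lambda>m j. Ts j ^^ m j"
  let ?m = "m(i := m i + p)"
  have "Ts_pow ?m h = (Ts i ^^ (m i + p)) (comp_prod (?f ?m) (UNIV - {i}) h)"
    unfolding Ts_pow_def by (subst comp_prod_remove[of _ _ i]) (auto intro: Ts_funpow_commute)
  also have "comp_prod (?f ?m) (UNIV - {i}) h = comp_prod (?f m) (UNIV - {i}) h"
    by (rule comp_prod_cong) (auto intro: Ts_funpow_commute)
  also have "(Ts i ^^ (m i + p)) (comp_prod (?f m) (UNIV - {i}) h)
      = (Ts i ^^ m i) (comp_prod (?f m) (UNIV - {i}) ((Ts i ^^ p) h))"
    using comp_prod_commute[of "?f m" "UNIV - {i}" "Ts i ^^ p"]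
    by (simp add: funpow_add Ts_funpow_commute)
  also have "\<dots> = Ts_pow m ((Ts i ^^ p) h)"
    unfolding Ts_pow_def by (subst (2) comp_prod_remove[of _ _ i]) (auto intro: Ts_funpow_commute)
  finally show ?thesis .
qed

lemma Ts_pow_Suc: "Ts_pow (m(i := Suc (m i))) h = Ts_pow m (Ts i h)"
  using Ts_pow_add[of m i 1] by simp

text \<open>
  The operation \<open>I - \<Delta>\<^sub>i\<close> in terms of quadratic forms; \<open>form A\<close> is the quadratic form of the product
  of \<open>I - \<Delta>\<^sub>i\<close>, i in A, applied to the identity.
\<close>

definition form_diff :: "'n \<Rightarrow> ('a \<Rightarrow> real) \<Rightarrow> 'a \<Rightarrow> real"
  where "form_diff i \<phi> h = \<phi> h - \<phi> (Ts i h)"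

definition form :: "'n set \<Rightarrow> 'a \<Rightarrow> real"
  where "form A = comp_prod form_diff A (\<lambda>h. (norm h)\<^sup>2)"

lemma form_diff_commute: "form_diff i (form_diff j \<phi>) = form_diff j (form_diff i \<phi>)"
  by (rule ext) (simp add: form_diff_def Ts_commute[of i j])

lemma form_empty: "form {} h = (norm h)\<^sup>2"
  by (simp add: form_def)

lemma form_insert: "i \<notin> A \<Longrightarrow> form (insert i A) h = form A h - form A (Ts i h)"
  unfolding form_def
  by (subst comp_prod_insert_apply) (auto simp: form_diff_def intro: form_diff_commute)

lemma form_bound: "\<bar>form A h\<bar> \<le> 2 ^ card A * (norm h)\<^sup>2"
proof -
  have "finite A" by simp
  then show ?thesis
  proof (induction A arbitrary: h rule: finite_induct)
    case (insert i A)
    have "2 ^ card A * (norm (Ts i h))\<^sup>2 \<le> 2 ^ card A * (norm h)\<^sup>2"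
      by (intro mult_left_mono power_mono norm_Ts) auto
    then have "\<bar>form A h - form A (Ts i h)\<bar> \<le> 2 * (2 ^ card A * (norm h)\<^sup>2)"
      using insert.IH[of h] insert.IH[of "Ts i h"] by linarith
    then show ?case
      using insert.hyps by (simp add: form_insert)
  qed (simp add: form_empty)
qed

lemma form_tendsto_0: "(\<lambda>p. form A ((Ts i ^^ p) h)) \<longlonglongrightarrow> 0"
proof (rule Lim_null_comparison[OF always_eventually])
  show "\<forall>p. norm (form A ((Ts i ^^ p) h)) \<le> 2 ^ card A * (norm ((Ts i ^^ p) h))\<^sup>2"
    using form_bound by simp
  have "(\<lambda>p. 2 ^ card A * (norm ((Ts i ^^ p) h))\<^sup>2) \<longlonglongrightarrow> 2 ^ card A * (norm (0::'a))\<^sup>2"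
    by (intro tendsto_intros Ts_tendsto_0)
  then show "(\<lambda>p. 2 ^ card A * (norm ((Ts i ^^ p) h))\<^sup>2) \<longlonglongrightarrow> 0"
    by simp
qed

lemma form_expand:
  "form A h = (\<Sum>k\<in>{k. (\<forall>i. k i \<in> {0, 1}) \<and> (\<forall>i. i \<notin> A \<longrightarrow> k i = 0)}.
    (-1) ^ (\<Sum>i\<in>UNIV. k i) * (norm (Ts_pow k h))\<^sup>2)"
proof -
  have "finite A" by simp
  then show ?thesis
  proof (induction A arbitrary: h rule: finite_induct)
    case empty
    have "{k. (\<forall>i. k i \<in> {0, 1}) \<and> (\<forall>i. i \<notin> {} \<longrightarrow> k i = 0)} = {\<lambda>_ :: 'n. 0 :: nat}"
      by auto
    then show ?case
      by (simp add: form_empty Ts_pow_0)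
  next
    case (insert i A)
    define K where "K A = {k :: 'n \<Rightarrow> nat. (\<forall>i. k i \<in> {0, 1}) \<and> (\<forall>i. i \<notin> A \<longrightarrow> k i = 0)}" for A
    let ?g = "\<lambda>k :: 'n \<Rightarrow> nat. k(i := Suc (k i))"
    let ?t = "\<lambda>h k. (-1) ^ (\<Sum>i\<in>UNIV. k i) * (norm (Ts_pow k h))\<^sup>2"
    have fin: "finite (K A)" for A
      by (rule finite_subset[of _ "PiE UNIV (\<lambda>_. {0, 1})"]) (force simp: K_def intro!: finite_PiE)+
    have "K (insert i A) = K A \<union> ?g ` K A"
    proof (intro equalityI subsetI)
      fix k assume k: "k \<in> K (insert i A)"
      show "k \<in> K A \<union> ?g ` K A"
      proof (cases "k i = 0")
        case False
        have "k i \<in> {0, 1}"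
          using k by (simp only: K_def mem_Collect_eq)
        with False have "k i = 1"
          by simp
        then have "k = ?g (k(i := 0))"
          by (auto simp: fun_eq_iff)
        moreover have "k(i := 0) \<in> K A"
          using k unfolding K_def by auto
        ultimately show ?thesis
          by blast
      next
        case True
        then have "k \<in> K A"
          using k unfolding K_def by (simp, metis)
        then show ?thesis ..
      qed
    next
      fix k assume "k \<in> K A \<union> ?g ` K A"
      then show "k \<in> K (insert i A)"
        using insert.hyps unfolding K_def by auto metis
    qed
    moreover have "K A \<inter> ?g ` K A = {}"
      using insert.hyps unfolding K_def by auto
    ultimately have "(\<Sum>k\<in>K (insert i A). ?t h k) = (\<Sum>k\<in>K A. ?t h k) + (\<Sum>k\<in>?g ` K A. ?t h k)"
      by (simp add: sum.union_disjoint fin)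
    also have "(\<Sum>k\<in>?g ` K A. ?t h k) = (\<Sum>k\<in>K A. ?t h (?g k))"
      using inj_raise[of i 1] by (intro sum.reindex_cong[of ?g]) (auto simp: inj_on_def)
    also have "\<dots> = - (\<Sum>k\<in>K A. ?t (Ts i h) k)"
    proof -
      have "(\<Sum>j\<in>UNIV. ?g k j) = Suc (\<Sum>j\<in>UNIV. k j)" for k
        by (simp add: sum.remove[of UNIV i])
      then show ?thesis
        by (simp add: Ts_pow_Suc sum_negf[symmetric])
    qed
    finally show ?case
      using insert.hyps insert.IH[folded K_def] unfolding K_def[symmetric] by (simp add: form_insert)
  qed
qed

lemma norm_defect_star: "(norm (defect_star T h))\<^sup>2 = form UNIV h"
proof -
  let ?K = "{k :: 'n \<Rightarrow> nat. \<forall>i. k i \<in> {0, 1}}"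
  have "cinner (comp_prod (\<lambda>i. T i ^^ k i) UNIV (Ts_pow k h)) h = cinner (Ts_pow k h) (Ts_pow k h)" for k
    unfolding Ts_pow_def
  proof (rule cinner_comp_prod)
    show "(T i ^^ k i) ((T j ^^ k j) x) = (T j ^^ k j) ((T i ^^ k i) x)" for i j x
      by (rule funpow_commute) (rule T_commute)
    show "cinner ((T i ^^ k i) x) y = cinner x ((Ts i ^^ k i) y)" for i x y
    proof -
      have "cinner ((T i ^^ p) x) y = cinner x ((Ts i ^^ p) y)" for p
      proof (induction p arbitrary: y)
        case (Suc p)
        have "cinner ((T i ^^ Suc p) x) y = cinner ((T i ^^ p) x) (Ts i y)"
          by (simp add: cinner_Ts_right)
        then show ?case
          by (simp add: Suc.IH funpow_swap1)
      qed simp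
      then show ?thesis .
    qed
  qed (auto intro: Ts_funpow_commute)
  then have "Re (cinner (szego_inv T h) h) = (\<Sum>k\<in>?K. (-1) ^ (\<Sum>i\<in>UNIV. k i) * (norm (Ts_pow k h))\<^sup>2)"
    unfolding szego_inv_def Ts_pow_def[symmetric]
    by (simp add: cinner_sum_left cinner_scaleR_left Re_sum cinner_self)
  also have "\<dots> = form UNIV h"
    by (simp add: form_expand)
  finally show ?thesis
    unfolding defect_star_def by (simp add: norm_op_sqrt[OF positive_szego_inv])
qed

text \<open>
  Summing over the powers with exponents in A undoes the differences for the indices in A:
  the series telescopes in every coordinate because all \<open>T\<^sub>i\<close> are of class \<open>C\<^sub>\<cdot>\<^sub>0\<close>.
\<close>

lemma form_has_sum:
  "((\<lambda>m. form UNIV (Ts_pow m h)) has_sum form (UNIV - A) h) {m. \<forall>i. i \<notin> A \<longrightarrow> m i = 0}"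
proof -
  have "finite A" by simp
  then show ?thesis
  proof (induction A arbitrary: h rule: finite_induct)
    case empty
    have "{m :: 'n \<Rightarrow> nat. \<forall>i. i \<notin> {} \<longrightarrow> m i = 0} = {\<lambda>_. 0}"
      by auto
    then show ?case
      using has_sum_finite[of "{\<lambda>_. 0}" "\<lambda>m. form UNIV (Ts_pow m h)"] by (simp add: Ts_pow_0)
  next
    case (insert i A)
    define K where "K = {m :: 'n \<Rightarrow> nat. \<forall>i. i \<notin> A \<longrightarrow> m i = 0}"
    define B where "B = UNIV - insert i A"
    have B: "UNIV - A = insert i B" "i \<notin> B"
      using insert.hyps by (auto simp: B_def)
    have nonneg: "0 \<le> form UNIV x" for x
      by (simp flip: norm_defect_star)
    have nonneg_A: "0 \<le> form (UNIV - A) x" for x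
      by (rule has_sum_nonneg[OF insert.IH]) (rule nonneg)
    have "(\<lambda>p. form B ((Ts i ^^ p) h) - form B ((Ts i ^^ Suc p) h)) sums (form B ((Ts i ^^ 0) h) - 0)"
      by (rule telescope_sums') (rule form_tendsto_0)
    then have "(\<lambda>p. form (UNIV - A) ((Ts i ^^ p) h)) sums form B h"
      by (simp add: B form_insert)
    then have 1: "((\<lambda>p. form (UNIV - A) ((Ts i ^^ p) h)) has_sum form B h) UNIV"
      by (rule sums_nonneg_imp_has_sum) (rule nonneg_A)
    have 2: "((\<lambda>m. case (p, m) of (p, m) \<Rightarrow> form UNIV (Ts_pow m ((Ts i ^^ p) h)))
        has_sum form (UNIV - A) ((Ts i ^^ p) h)) K" for p
      using insert.IH unfolding K_def by simp
    have "((\<lambda>(p, m). form UNIV (Ts_pow m ((Ts i ^^ p) h))) has_sum form B h) (Sigma UNIV (\<lambda>_. K))"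
    proof (rule has_sum_SigmaI[OF 2 1])
      show "(\<lambda>(p, m). form UNIV (Ts_pow m ((Ts i ^^ p) h))) summable_on Sigma UNIV (\<lambda>_. K)"
        by (rule summable_on_SigmaI[OF 2]) (use 1 nonneg in \<open>auto simp: summable_on_def\<close>)
    qed
    moreover have "((\<lambda>(p, m). form UNIV (Ts_pow m ((Ts i ^^ p) h))) has_sum form B h) (Sigma UNIV (\<lambda>_. K))
        \<longleftrightarrow> ((\<lambda>m. form UNIV (Ts_pow m h)) has_sum form B h) {m. \<forall>j. j \<notin> insert i A \<longrightarrow> m j = 0}"
    proof (rule has_sum_reindex_bij_witness[of _ "\<lambda>m. (m i, m(i := 0))" "\<lambda>(p, m). m(i := p)"])
      fix a :: "nat \<times> ('n \<Rightarrow> nat)"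
      assume a: "a \<in> Sigma UNIV (\<lambda>_. K)"
      then have mi: "snd a i = 0"
        using insert.hyps by (auto simp: K_def)
      then show "(\<lambda>m. (m i, m(i := 0))) ((\<lambda>(p, m). m(i := p)) a) = a"
        by (auto simp: case_prod_beta fun_eq_iff prod_eq_iff)
      show "(\<lambda>(p, m). m(i := p)) a \<in> {m. \<forall>j. j \<notin> insert i A \<longrightarrow> m j = 0}"
        using a by (auto simp: K_def)
      show "form UNIV (Ts_pow ((\<lambda>(p, m). m(i := p)) a) h)
          = (\<lambda>(p, m). form UNIV (Ts_pow m ((Ts i ^^ p) h))) a"
        using Ts_pow_add[of "snd a" i "fst a" h] mi by (simp add: case_prod_beta)
    qed (auto simp: K_def)
    ultimately show ?case
      by (simp add: B_def)
  qed
qed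

lemma defect_star_has_sum: "((\<lambda>m. (norm (defect_star T (Ts_pow m h)))\<^sup>2) has_sum (norm h)\<^sup>2) UNIV"
  using form_has_sum[of h UNIV] by (simp add: norm_defect_star form_empty)

lemma bop_defect_star: "bop (defect_star T)"
  unfolding defect_star_def by (rule positive_op_bop[OF positive_op_sqrt[OF positive_szego_inv]])

text \<open>The dilation map: \<open>dil h\<close> is the function \<open>z \<mapsto> D \<Prod>\<^sub>i (I - z\<^sub>i T\<^sub>i\<^sup>*)\<^sup>-\<^sup>1 h\<close> with the defect
  operator \<open>D\<close> of the adjoint tuple, given by its Taylor coefficients.\<close>

definition dil :: "'a \<Rightarrow> ('n \<Rightarrow> nat, 'a) ell2"
  where "dil h = Abs_ell2 (\<lambda>m. defect_star T (Ts_pow m h))"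

lemma coeff_dil: "coeff (dil h) m = defect_star T (Ts_pow m h)"
  unfolding dil_def using defect_star_has_sum[of h]
  by (subst Abs_ell2_inverse) (auto simp: summable_on_def)

lemma norm_dil: "norm (dil h) = norm h"
proof -
  have "(norm (dil h))\<^sup>2 = (norm h)\<^sup>2"
    using has_sum_unique[OF has_sum_norm[of "dil h"]] defect_star_has_sum[of h]
    by (simp add: coeff_dil)
  then show ?thesis
    by (simp add: power2_eq_iff_nonneg)
qed

lemma bop_dil: "bop dil"
  by (rule bopI[of _ 1])
    (auto intro!: ell2_eqI simp: coeff_dil norm_dil bop_add[OF bop_Ts_pow] bop_scaleC[OF bop_Ts_pow]
      bop_add[OF bop_defect_star] bop_scaleC[OF bop_defect_star])

lemma cinner_dil: "cinner (dil x) (dil y) = cinner x y"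
  by (rule isometry_cinner[OF bop_dil norm_dil])

abbreviation dil_adj :: "('n \<Rightarrow> nat, 'a) ell2 \<Rightarrow> 'a" where "dil_adj \<equiv> adj dil"

lemma bop_dil_adj: "bop dil_adj"
  by (rule bop_adj[OF bop_dil])

lemmas cinner_dil_adj_left = cinner_adj_left[OF bop_dil]
lemmas cinner_dil_adj_right = cinner_adj_right[OF bop_dil]

lemma dil_adj_dil [simp]: "dil_adj (dil x) = x"
  by (rule cinner_eqI[of "dil_adj (dil x)"]) (simp add: cinner_dil_adj_left cinner_dil)

lemma dil_Ts: "dil (Ts i h) = back_shift i (dil h)"
  by (rule ell2_eqI) (simp add: coeff_dil Ts_pow_Suc)

lemma dil_adj_shift: "dil_adj (shift i f) = T i (dil_adj f)"
  by (rule cinner_eqI[of "dil_adj (shift i f)"])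
    (simp add: cinner_dil_adj_left cinner_shift_left dil_Ts[symmetric] cinner_Ts_right[symmetric])

text \<open>The maps \<open>I - w\<^sub>i T\<^sub>i\<^sup>*\<close>.\<close>

abbreviation res :: "complex ^ 'n \<Rightarrow> 'n \<Rightarrow> 'a \<Rightarrow> 'a"
  where "res w \<equiv> \<lambda>i x. x - w $ i *\<^sub>C Ts i x"

lemma bop_res: "bop (res w i)"
  by (intro bop_intros bop_Ts)

lemma res_commute: "res w i (res w j x) = res w j (res w i x)"
  by (simp add: bop_diff[OF bop_Ts] bop_scaleC[OF bop_Ts] Ts_commute[of i j] scaleC_diff_right
      scaleC_scaleC algebra_simps)

text \<open>Applying \<open>I - w\<^sub>i T\<^sub>i\<^sup>*\<close> before the dilation replaces the i-th
  coordinate of w by 0 in the value at w.\<close>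

lemma cinner_dil_comp_prod_res:
  assumes w: "w \<in> polydisc"
  shows "cinner (dil (comp_prod (res w) A x)) (szego_kernel w \<eta>) = cinner (dil x) (szego_kernel (zero_on A w) \<eta>)"
proof -
  have "finite A" by simp
  then show ?thesis
  proof (induction A arbitrary: x rule: finite_induct)
    case empty
    have "zero_on {} w = w"
      by (simp add: zero_on_def vec_eq_iff)
    then show ?case
      by simp
  next
    case (insert i A)
    have "cinner (dil (comp_prod (res w) (insert i A) x)) (szego_kernel w \<eta>)
        = cinner (dil (res w i x)) (szego_kernel (zero_on A w) \<eta>)"
      using insert.hyps insert.IH
      by (subst comp_prod_insert_apply'[of "res w", OF res_commute]) simp_all
    also have "\<dots> = cinner (dil x - zero_on A w $ i *\<^sub>C back_shift i (dil x)) (szego_kernel (zero_on A w) \<eta>)"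
      using insert.hyps
      by (simp add: bop_diff[OF bop_dil] bop_scaleC[OF bop_dil] dil_Ts zero_on_def)
    also have "\<dots> = cinner (dil x) (szego_kernel (zero_on (insert i A) w) \<eta>)"
      by (simp add: cinner_one_minus_back_shift_kernel zero_on_polydisc[OF w] zero_on_insert[of i A])
    finally show ?case .
  qed
qed

lemma bij_res: "w \<in> polydisc \<Longrightarrow> bij (res w i)"
  by (rule bij_one_minus_contraction[OF bop_Ts norm_Ts]) (simp add: polydisc_def)

lemma res_inv_res: "w \<in> polydisc \<Longrightarrow> res w i (inv (res w i) x) = x"
  by (rule surj_f_inv_f[OF bij_is_surj[OF bij_res]])

lemma inv_res_res: "w \<in> polydisc \<Longrightarrow> inv (res w i) (res w i x) = x"
  by (rule inv_f_f[OF bij_is_inj[OF bij_res]])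

lemma inv_res_commute:
  assumes "w \<in> polydisc"
  shows "inv (res w i) (inv (res w j) x) = inv (res w j) (inv (res w i) x)"
proof -
  have s: "res w i (inv (res w i) x) = x" and l: "inv (res w i) (res w i x) = x" for i x
    by (rule res_inv_res[OF assms], rule inv_res_res[OF assms])
  have "inv (res w i) (inv (res w j) x)
      = inv (res w i) (inv (res w j) (res w i (res w j (inv (res w j) (inv (res w i) x)))))"
    by (simp only: s)
  also have "\<dots> = inv (res w j) (inv (res w i) x)"
    by (simp only: res_commute[where w = w and i = i and j = j] l)
  finally show ?thesis .
qed

lemma cinner_dil_kernel:
  assumes w: "w \<in> polydisc"
  shows "cinner (dil h) (szego_kernel w \<eta>) = cinner (defect_star T (comp_prod (\<lambda>k. inv (res w k)) UNIV h)) \<eta>"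
proof -
  let ?x = "comp_prod (\<lambda>k. inv (res w k)) UNIV h"
  have "comp_prod (res w) UNIV ?x = h"
    by (rule comp_prod_inverse)
      (rule res_commute inv_res_commute[OF w] res_inv_res[OF w] finite)+
  moreover have "zero_on UNIV w = 0"
    by (simp add: zero_on_def vec_eq_iff)
  ultimately show ?thesis
    using cinner_dil_comp_prod_res[OF w, of UNIV ?x \<eta>] by (simp add: kernel_0 coeff_dil Ts_pow_0)
qed

end

section \<open>Families with coefficients in a subspace\<close>

text \<open>The square-summable families all of whose members lie in E.\<close>

definition coeffs_in :: "'a::complex_inner set \<Rightarrow> ('i, 'a) ell2 set"
  where "coeffs_in E = {f. \<forall>m. coeff f m \<in> E}"

lemma csubspace_coeffs_in:
  assumes E: "csubspace E"
  shows "csubspace (coeffs_in E :: ('i, 'a::complex_inner) ell2 set)"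
proof -
  have "closed (coeffs_in E :: ('i, 'a) ell2 set)"
    unfolding closed_sequential_limits coeffs_in_def
  proof (intro allI impI CollectI, elim conjE)
    fix f :: "nat \<Rightarrow> ('i, 'a) ell2" and l m
    assume f: "\<forall>n. f n \<in> {f. \<forall>m. coeff f m \<in> E}" "f \<longlonglongrightarrow> l"
    from f(2) have "(\<lambda>n. coeff (f n) m) \<longlonglongrightarrow> coeff l m"
      by (rule bop_tendsto[OF bop_coeff])
    then show "coeff l m \<in> E"
      by (rule closed_sequentially[OF csubspace_closed[OF E], rotated]) (use f(1) in simp)
  qed
  then show ?thesis
    unfolding csubspace_def
    by (auto simp: coeffs_in_def csubspace_0[OF E] csubspace_add[OF E] csubspace_scaleC[OF E])
qed

lemma shift_coeffs_in: "csubspace E \<Longrightarrow> f \<in> coeffs_in E \<Longrightarrow> shift i f \<in> coeffs_in E"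
  by (auto simp: coeffs_in_def csubspace_0)

lemma back_shift_coeffs_in: "f \<in> coeffs_in E \<Longrightarrow> back_shift i f \<in> coeffs_in E"
  by (auto simp: coeffs_in_def)


section \<open>Beurling tuples and their model\<close>

lemma id_minus_Delta_commute:
  assumes "bop X" "bop Y" "\<And>x. X (Y x) = Y (X x)" "\<And>x. adj X (adj Y x) = adj Y (adj X x)"
  shows "id_minus_Delta X (id_minus_Delta Y A) = id_minus_Delta Y (id_minus_Delta X A)"
  by (rule ext) (simp add: id_minus_Delta_def bop_diff[OF assms(1)] bop_diff[OF assms(2)] assms(3,4))

text \<open>The theory of one Beurling tuple.\<close>

locale beurling = szego T
  for T :: "'n::finite \<Rightarrow> 'a::{complex_inner,banach} \<Rightarrow> 'a" +
  assumes defect_ortho: "i \<noteq> j \<Longrightarrow> defect_op (T i) (defect_op (T j) h) = 0"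
begin

lemma positive_defect: "positive_op (\<lambda>h. h - Ts i (T i h))"
  unfolding positive_op_iff
proof (intro conjI allI bop_minus_fun bop_id bop_compose[OF bop_Ts bop_T])
  fix h
  have "(norm (T i h))\<^sup>2 \<le> (norm h)\<^sup>2"
    by (intro power_mono norm_T) simp
  moreover have "cinner (h - Ts i (T i h)) h = of_real ((norm h)\<^sup>2 - (norm (T i h))\<^sup>2)"
    by (simp add: cinner_diff_left cinner_Ts_left cinner_self)
  ultimately show "Im (cinner (h - Ts i (T i h)) h) = 0" "0 \<le> Re (cinner (h - Ts i (T i h)) h)"
    by simp_all
qed

lemma defect_op_square: "defect_op (T i) (defect_op (T i) h) = h - Ts i (T i h)"
  unfolding defect_op_def by (rule op_sqrt_square[OF positive_defect])

lemma bop_defect_op: "bop (defect_op (T i))"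
  unfolding defect_op_def by (rule positive_op_bop[OF positive_op_sqrt[OF positive_defect]])

text \<open>
  The range of the dilation is invariant under the backward shifts, so its orthogonal complement,
  the kernel of \<open>dil_adj\<close>, is invariant under the shifts.  The map \<open>proj\<close> is the orthogonal projection
  onto that complement, and \<open>co_shift i\<close> is on it the adjoint of the i-th shift.
\<close>

definition proj :: "('n \<Rightarrow> nat, 'a) ell2 \<Rightarrow> ('n \<Rightarrow> nat, 'a) ell2"
  where "proj y = y - dil (dil_adj y)"

definition co_shift :: "'n \<Rightarrow> ('n \<Rightarrow> nat, 'a) ell2 \<Rightarrow> ('n \<Rightarrow> nat, 'a) ell2"
  where "co_shift i y = proj (back_shift i y)"

lemma bop_proj: "bop proj"
  unfolding proj_def by (intro bop_intros bop_compose[OF bop_dil bop_dil_adj])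

lemma bop_co_shift: "bop (co_shift i)"
  unfolding co_shift_def by (rule bop_compose[OF bop_proj bop_back_shift])

lemma proj_dil [simp]: "proj (dil x) = 0"
  by (simp add: proj_def)

lemma dil_adj_proj [simp]: "dil_adj (proj y) = 0"
  by (simp add: proj_def bop_diff[OF bop_dil_adj])

lemma dil_adj_co_shift [simp]: "dil_adj (co_shift i y) = 0"
  by (simp add: co_shift_def)

lemma proj_id: "dil_adj s = 0 \<Longrightarrow> proj s = s"
  by (simp add: proj_def bop_zero[OF bop_dil])

lemma dil_adj_shift_0: "dil_adj s = 0 \<Longrightarrow> dil_adj (shift i s) = 0"
  by (simp add: dil_adj_shift bop_zero[OF bop_T])

lemma cinner_dil_0: "dil_adj s = 0 \<Longrightarrow> cinner s (dil x) = 0" "dil_adj s = 0 \<Longrightarrow> cinner (dil x) s = 0"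
  by (simp_all flip: cinner_dil_adj_left cinner_dil_adj_right)

lemma co_shift_dil [simp]: "co_shift i (dil x) = 0"
  by (simp add: co_shift_def dil_Ts[symmetric])

lemma co_shift_shift_same: "dil_adj s = 0 \<Longrightarrow> co_shift i (shift i s) = s"
  by (simp add: co_shift_def proj_id)

lemma co_shift_proj: "co_shift i (proj y) = co_shift i y"
  by (simp add: proj_def bop_diff[OF bop_co_shift])

lemma co_shift_commute: "co_shift i (co_shift j y) = co_shift j (co_shift i y)"
  by (simp add: co_shift_def[of j y] co_shift_def[of i y] co_shift_proj)
    (simp add: co_shift_def back_shift_commute[of i j])

lemma cinner_co_shift_left:
  assumes "dil_adj s = 0"
  shows "cinner (co_shift i y) s = cinner y (shift i s)"
  by (simp add: co_shift_def proj_def cinner_diff_left cinner_dil_0[OF assms] cinner_back_shift_left)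

lemma cinner_co_shift_right:
  assumes "dil_adj s = 0"
  shows "cinner s (co_shift i y) = cinner (shift i s) y"
  by (rule cinner_flip) (rule cinner_co_shift_left[OF assms])

text \<open>The part of the i-th shift that maps the range of the dilation to its complement.\<close>

definition corner :: "'n \<Rightarrow> 'a \<Rightarrow> ('n \<Rightarrow> nat, 'a) ell2"
  where "corner j h = shift j (dil h) - dil (T j h)"

lemma bop_corner: "bop (corner j)"
  unfolding corner_def
  by (intro bop_minus_fun bop_compose[OF bop_shift bop_dil] bop_compose[OF bop_dil bop_T])

lemma dil_adj_corner [simp]: "dil_adj (corner j h) = 0"
  by (simp add: corner_def bop_diff[OF bop_dil_adj] dil_adj_shift)

lemma cinner_corner:
  "cinner (corner j h) (corner i g)
    = cinner (if i = j then h - Ts j (T j h) else commutator (T j) (Ts i) h) g"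
proof -
  have "cinner (corner j h) (corner i g) = cinner (shift j (dil h)) (corner i g)"
    by (subst (1) corner_def) (simp add: cinner_diff_left cinner_dil_0)
  also have "\<dots> = cinner (shift j (dil h)) (shift i (dil g)) - cinner (T j h) (T i g)"
    by (simp add: corner_def cinner_diff_right cinner_dil_adj_left[symmetric]
        cinner_dil_adj_right[symmetric] dil_adj_shift)
  also have "cinner (shift j (dil h)) (shift i (dil g))
      = cinner (if i = j then h else T j (Ts i h)) g"
  proof (cases "i = j")
    case False
    have "cinner (shift j (dil h)) (shift i (dil g)) = cinner (shift j (dil (Ts i h))) (dil g)"
      using False by (simp add: cinner_back_shift_left[symmetric] back_shift_shift_commute dil_Ts)
    then show ?thesis
      using False by (simp add: cinner_dil_adj_left[symmetric] cinner_dil_adj_right[symmetric] dil_adj_shift)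
  qed (simp add: cinner_shift_shift cinner_dil)
  also have "cinner (T j h) (T i g) = cinner (Ts i (T j h)) g"
    by (simp add: cinner_Ts_left)
  finally show ?thesis
    by (simp add: commutator_def cinner_diff_left split: if_splits)
qed

lemma norm_corner: "(norm (corner i x))\<^sup>2 = Re (cinner (x - Ts i (T i x)) x)"
  using arg_cong[OF cinner_corner[of i x i x], of Re] by (simp add: cinner_self)

text \<open>
  By \<open>norm_corner\<close> the squared defect operator of \<open>T i\<close> is the product of the adjoint of \<open>corner i\<close>
  with \<open>corner i\<close>.  So the Beurling condition gives that \<open>corner j\<close> composed with the adjoint of
  \<open>corner i\<close> is 0, and this makes the shifts on the complement doubly commuting.
\<close>

lemma corner_adj_corner:
  assumes "i \<noteq> j"
  shows "corner j (adj (corner i) f) = 0"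
proof -
  have adj_corner: "adj (corner j) (corner j h) = h - Ts j (T j h)" for h
    by (rule cinner_eqI[of "adj (corner j) (corner j h)"])
      (simp add: cinner_adj_left[OF bop_corner] cinner_corner)
  have 0: "corner i (adj (corner j) (corner j h)) = 0" for h
  proof -
    let ?x = "adj (corner j) (corner j h)"
    have "?x - Ts i (T i ?x) = 0"
      unfolding adj_corner[of h] defect_op_square[symmetric]
      by (simp add: defect_ortho[OF assms] bop_zero[OF bop_defect_op])
    then have "(norm (corner i ?x))\<^sup>2 = 0"
      by (simp only: norm_corner cinner_zero_left) simp
    then show ?thesis
      by simp
  qed
  have "cinner (corner j (adj (corner i) f)) (corner j (adj (corner i) f))
      = cinner (corner i (adj (corner j) (corner j (adj (corner i) f)))) f"
    by (simp add: cinner_adj_left[OF bop_corner, symmetric] cinner_adj_right[OF bop_corner, symmetric])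
  then show ?thesis
    by (simp add: 0)
qed

lemma adj_corner_eq:
  assumes "dil_adj s = 0"
  shows "adj (corner i) s = dil_adj (back_shift i s)"
  by (rule cinner_eqI[of "adj (corner i) s"])
    (simp add: cinner_adj_left[OF bop_corner] cinner_dil_adj_left corner_def cinner_diff_right
      cinner_dil_0[OF assms] cinner_back_shift_left)

lemma co_shift_shift:
  assumes "i \<noteq> j" "dil_adj s = 0"
  shows "co_shift i (shift j s) = shift j (co_shift i s)"
proof -
  let ?x = "dil_adj (back_shift i s)"
  have "shift j (dil ?x) = dil (T j ?x)"
    using corner_adj_corner[OF assms(1), of s] by (simp add: adj_corner_eq[OF assms(2)] corner_def)
  then have "shift j (co_shift i s) = proj (shift j (back_shift i s))"
    by (simp add: co_shift_def proj_def bop_diff[OF bop_shift] dil_adj_shift)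
  then show ?thesis
    using assms(1) by (simp add: co_shift_def back_shift_shift_commute)
qed

lemma co_shift_corner: "i \<noteq> j \<Longrightarrow> co_shift i (corner j h) = corner j (Ts i h)"
  by (simp add: co_shift_def corner_def bop_diff[OF bop_back_shift] back_shift_shift_commute
      dil_Ts[symmetric] bop_diff[OF bop_proj]) (simp add: proj_def dil_adj_shift)

lemma co_shift_corner_same: "co_shift j (corner j h) = 0"
  by (simp add: co_shift_def corner_def bop_diff[OF bop_back_shift] dil_Ts[symmetric] bop_diff[OF bop_proj])

text \<open>
  The map \<open>defect_column j\<close> is \<open>corner j\<close> followed by the projection onto the wandering subspace of
  the shifts.  The projection is the product of the \<open>I - shift k (co_shift k)\<close> over all k; the factor
  for j may be left out by \<open>co_shift_corner_same\<close>, and by \<open>co_shift_corner\<close> the other co-shifts can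
  be moved to the right, where they become the \<open>T\<^sub>k\<^sup>*\<close> in \<open>wander\<close>.
\<close>

definition wander :: "'n \<Rightarrow> ('a \<Rightarrow> ('n \<Rightarrow> nat, 'a) ell2) \<Rightarrow> 'a \<Rightarrow> ('n \<Rightarrow> nat, 'a) ell2"
  where "wander k X h = X h - shift k (X (Ts k h))"

abbreviation partial_column :: "'n set \<Rightarrow> 'n \<Rightarrow> 'a \<Rightarrow> ('n \<Rightarrow> nat, 'a) ell2"
  where "partial_column A j \<equiv> comp_prod wander A (corner j)"

definition defect_column :: "'n \<Rightarrow> 'a \<Rightarrow> ('n \<Rightarrow> nat, 'a) ell2"
  where "defect_column j = partial_column (UNIV - {j}) j"

lemma wander_commute: "wander i (wander j X) = wander j (wander i X)"
  by (rule ext) (simp add: wander_def bop_diff[OF bop_shift] Ts_commute[of i j] shift_commute[of i j])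

lemma partial_column_insert:
  "k \<notin> A \<Longrightarrow> partial_column (insert k A) j h
    = partial_column A j h - shift k (partial_column A j (Ts k h))"
  by (subst comp_prod_insert_apply) (auto simp: wander_def intro: wander_commute)

lemma bop_partial_column: "bop (partial_column A j)"
proof -
  have "finite A" by simp
  then show ?thesis
  proof (induction A rule: finite_induct)
    case (insert k A)
    have "partial_column (insert k A) j
        = (\<lambda>h. partial_column A j h - shift k (partial_column A j (Ts k h)))"
      using insert.hyps by (auto simp: partial_column_insert)
    then show ?case
      using insert.IH
      by (auto intro!: bop_minus_fun bop_compose[OF bop_shift] bop_compose[OF _ bop_Ts])
  qed (simp add: bop_corner)
qed

lemma bop_defect_column: "bop (defect_column j)"
  unfolding defect_column_def by (rule bop_partial_column)

lemma dil_adj_partial_column [simp]: "dil_adj (partial_column A j h) = 0"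
proof -
  have "finite A" by simp
  then show ?thesis
    by (induction A arbitrary: h rule: finite_induct)
      (simp_all add: partial_column_insert bop_diff[OF bop_dil_adj] dil_adj_shift_0)
qed

lemma dil_adj_defect_column [simp]: "dil_adj (defect_column j h) = 0"
  by (simp add: defect_column_def)

lemma co_shift_partial_column:
  assumes "i \<notin> A"
  shows "co_shift i (partial_column A j h) = (if i = j then 0 else partial_column A j (Ts i h))"
proof -
  have "finite A" by simp
  then show ?thesis
    using assms
  proof (induction A arbitrary: h rule: finite_induct)
    case (insert k A)
    have "co_shift i (partial_column (insert k A) j h)
        = co_shift i (partial_column A j h) - shift k (co_shift i (partial_column A j (Ts k h)))"
      using insert by (simp add: partial_column_insert bop_diff[OF bop_co_shift] co_shift_shift)
    then show ?case
      using insert by (simp add: partial_column_insert Ts_commute[of i k] bop_zero[OF bop_shift])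
  qed (simp add: co_shift_corner co_shift_corner_same)
qed

lemma co_shift_defect_column: "co_shift i (defect_column j h) = 0"
proof (cases "i = j")
  case True
  then show ?thesis
    by (simp add: defect_column_def co_shift_partial_column)
next
  case False
  define A where "A = UNIV - {j} - {i}"
  have A: "UNIV - {j} = insert i A" "i \<notin> A"
    using False by (auto simp: A_def)
  then show ?thesis
    using False by (simp add: defect_column_def partial_column_insert bop_diff[OF bop_co_shift]
        co_shift_partial_column co_shift_shift_same)
qed

text \<open>Against a wandering vector the projection in \<open>defect_column\<close> is invisible.\<close>

lemma cinner_wandering_defect_column:
  assumes s: "dil_adj s = 0" "\<And>k. co_shift k s = 0"
  shows "cinner s (defect_column i g) = cinner s (corner i g)"
proof -
  have "cinner s (partial_column A i g) = cinner s (corner i g)" for A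
  proof -
    have "finite A" by simp
    then show ?thesis
    proof (induction A arbitrary: g rule: finite_induct)
      case (insert k A)
      have "cinner s (shift k (partial_column A i (Ts k g))) = 0"
        by (simp add: cinner_co_shift_left[symmetric] s)
      then show ?case
        using insert by (simp add: partial_column_insert cinner_diff_right)
    qed simp
  qed
  then show ?thesis
    by (simp add: defect_column_def)
qed

lemma id_minus_Delta_T_commute:
  "id_minus_Delta (T i) (id_minus_Delta (T j) A) = id_minus_Delta (T j) (id_minus_Delta (T i) A)"
  by (rule id_minus_Delta_commute[OF bop_T bop_T T_commute Ts_commute])

lemma cinner_partial_column_corner:
  assumes "\<And>h g. cinner (corner j h) (corner i g) = cinner (B h) g" "i \<notin> A"
  shows "cinner (partial_column A j h) (corner i g)
    = cinner (comp_prod (\<lambda>k. id_minus_Delta (T k)) A B h) g"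
proof -
  have "finite A" by simp
  then show ?thesis
    using assms(2)
  proof (induction A arbitrary: h g rule: finite_induct)
    case (insert k A)
    have "cinner (shift k (partial_column A j (Ts k h))) (corner i g)
        = cinner (partial_column A j (Ts k h)) (corner i (Ts k g))"
      using insert.prems co_shift_corner[of k i g] by (auto simp: cinner_co_shift_right[symmetric])
    then have "cinner (partial_column (insert k A) j h) (corner i g)
        = cinner (comp_prod (\<lambda>k. id_minus_Delta (T k)) A B h) g
          - cinner (comp_prod (\<lambda>k. id_minus_Delta (T k)) A B (Ts k h)) (Ts k g)"
      using insert by (simp add: partial_column_insert cinner_diff_left)
    also have "\<dots> = cinner (comp_prod (\<lambda>k. id_minus_Delta (T k)) (insert k A) B h) g"
      using insert.hyps
      by (subst comp_prod_insert_apply)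
        (auto simp: id_minus_Delta_def[of "T k"] cinner_diff_left cinner_Ts_right
          intro: id_minus_Delta_T_commute)
    finally show ?case .
  qed (simp add: assms(1))
qed

text \<open>The Gram matrix of the columns is the squared defect matrix.\<close>

lemma cinner_defect_column:
  "cinner (defect_column j h) (defect_column i g)
    = cinner ((if i = j then defect_diag j T else defect_offdiag i j T) h) g"
proof -
  have "cinner (defect_column j h) (defect_column i g) = cinner (defect_column j h) (corner i g)"
    by (rule cinner_wandering_defect_column) (simp_all add: co_shift_defect_column)
  also have "\<dots> = cinner ((if i = j then defect_diag j T else defect_offdiag i j T) h) g"
  proof (cases "i = j")
    case True
    have "cinner (corner j h) (corner j g) = cinner ((defect_op (T j) \<circ> defect_op (T j)) h) g" for h g
      by (simp add: cinner_corner defect_op_square)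
    from cinner_partial_column_corner[OF this, of "UNIV - {j}" h g] show ?thesis
      using True unfolding defect_column_def defect_diag_def by (simp add: comp_def)
  next
    case False
    define A where "A = UNIV - {i, j}"
    have A: "UNIV - {j} = insert i A" "i \<notin> A"
      using False by (auto simp: A_def)
    have "cinner (shift i (partial_column A j (Ts i h))) (corner i g) = 0"
      by (simp add: cinner_co_shift_right[symmetric] co_shift_corner_same)
    then have "cinner (defect_column j h) (corner i g) = cinner (partial_column A j h) (corner i g)"
      using A by (simp add: defect_column_def partial_column_insert cinner_diff_left)
    also have "\<dots> = cinner (defect_offdiag i j T h) g"
      unfolding defect_offdiag_def A_def[symmetric]
      by (rule cinner_partial_column_corner) (use False A in \<open>simp_all add: cinner_corner\<close>)
    finally show ?thesis
      using False by simp
  qed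
  finally show ?thesis .
qed

text \<open>The columns as one map on the direct sum.\<close>

definition defect_row :: "'a ^ 'n \<Rightarrow> ('n \<Rightarrow> nat, 'a) ell2"
  where "defect_row h = (\<Sum>j\<in>UNIV. defect_column j (h $ j))"

lemma bop_defect_row: "bop defect_row"
  unfolding defect_row_def by (intro bop_sum_fun bop_compose[OF bop_defect_column bop_vec_nth])

lemma cinner_defect_row: "cinner (defect_row h) (defect_row g) = cinner (defect_matrix_sq T h) g"
proof -
  have "cinner (defect_row h) (defect_row g) = (\<Sum>j\<in>UNIV. \<Sum>i\<in>UNIV. cinner (defect_column j (h $ j)) (defect_column i (g $ i)))"
    unfolding defect_row_def cinner_sum_left unfolding cinner_sum_right by (rule refl)
  also have "\<dots> = (\<Sum>i\<in>UNIV. \<Sum>j\<in>UNIV. cinner (defect_column j (h $ j)) (defect_column i (g $ i)))"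
    by (rule sum.swap)
  also have "\<dots> = cinner (defect_matrix_sq T h) g"
    unfolding cinner_defect_column by (simp add: cinner_vec_def defect_matrix_sq_def cinner_sum_left)
  finally show ?thesis .
qed

lemma positive_defect_matrix_sq: "positive_op (defect_matrix_sq T)"
proof -
  have "defect_matrix_sq T = (\<lambda>h. adj defect_row (defect_row h))"
    by (rule ext, rule cinner_eqI) (simp add: cinner_adj_left[OF bop_defect_row] cinner_defect_row)
  then have "bop (defect_matrix_sq T)"
    by (simp add: bop_compose bop_adj bop_defect_row)
  then show ?thesis
    by (simp add: positive_op_iff cinner_defect_row[symmetric] cinner_self)
qed

lemma bop_defect_matrix: "bop (defect_matrix T)"
  unfolding defect_matrix_def
  by (rule positive_op_bop[OF positive_op_sqrt[OF positive_defect_matrix_sq]])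

lemma norm_defect_matrix: "norm (defect_matrix T h) = norm (defect_row h)"
proof -
  have "(norm (defect_matrix T h))\<^sup>2 = (norm (defect_row h))\<^sup>2"
    by (simp add: defect_matrix_def norm_op_sqrt[OF positive_defect_matrix_sq] cinner_defect_row[symmetric]
        cinner_self)
  then show ?thesis
    by (simp add: power2_eq_iff_nonneg)
qed

lemma dil_adj_defect_row [simp]: "dil_adj (defect_row h) = 0"
  by (simp add: defect_row_def bop_sum[OF bop_dil_adj])

lemma co_shift_defect_row [simp]: "co_shift i (defect_row h) = 0"
  by (simp add: defect_row_def bop_sum[OF bop_co_shift] co_shift_defect_column)

text \<open>The value of \<open>defect_row h\<close> at w is the right-hand side of the equation that defines the
  characteristic function.\<close>

definition char_value :: "complex ^ 'n \<Rightarrow> 'a ^ 'n \<Rightarrow> 'a"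
  where "char_value w h = defect_star T
          (comp_prod (\<lambda>k. inv (\<lambda>x. x - (w $ k) *\<^sub>C adj (T k) x)) UNIV
            (\<Sum>j\<in>UNIV. (\<lambda>x. (w $ j) *\<^sub>C x - T j x)
              (comp_prod (\<lambda>i x. x - (w $ i) *\<^sub>C adj (T i) x) (UNIV - {j}) (h $ j))))"

lemma cinner_partial_column_kernel:
  assumes w: "w \<in> polydisc"
  shows "cinner (partial_column A j h) (szego_kernel w \<eta>)
    = cinner (corner j (comp_prod (res w) A h)) (szego_kernel w \<eta>)"
proof -
  have "finite A" by simp
  then show ?thesis
  proof (induction A arbitrary: h rule: finite_induct)
    case (insert k A)
    have bQ: "bop (comp_prod (res w) A)"
      by (rule bop_comp_prod[of "res w", OF res_commute]) (auto intro: bop_res)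
    have "cinner (partial_column (insert k A) j h) (szego_kernel w \<eta>)
        = cinner (corner j (comp_prod (res w) A h)) (szego_kernel w \<eta>)
          - w $ k * cinner (corner j (comp_prod (res w) A (Ts k h))) (szego_kernel w \<eta>)"
      using insert by (simp add: partial_column_insert cinner_diff_left cinner_shift_kernel[OF w])
    also have "\<dots> = cinner (corner j (comp_prod (res w) A (res w k h))) (szego_kernel w \<eta>)"
      by (simp add: bop_diff[OF bQ] bop_scaleC[OF bQ] bop_diff[OF bop_corner]
          bop_scaleC[OF bop_corner] cinner_diff_left cinner_scaleC_left)
    also have "\<dots> = cinner (corner j (comp_prod (res w) (insert k A) h)) (szego_kernel w \<eta>)"
      using insert.hyps by (subst comp_prod_insert_apply'[of "res w", OF res_commute]) simp_all
    finally show ?case .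
  qed simp
qed

lemma cinner_defect_row_kernel:
  assumes w: "w \<in> polydisc"
  shows "cinner (defect_row h) (szego_kernel w \<eta>) = cinner (char_value w h) \<eta>"
proof -
  let ?q = "\<lambda>j. comp_prod (res w) (UNIV - {j}) (h $ j)"
  have "cinner (defect_column j (h $ j)) (szego_kernel w \<eta>)
      = cinner (dil (w $ j *\<^sub>C ?q j - T j (?q j))) (szego_kernel w \<eta>)" for j
    by (simp add: defect_column_def cinner_partial_column_kernel[OF w] corner_def cinner_diff_left
        cinner_shift_kernel[OF w] bop_diff[OF bop_dil] bop_scaleC[OF bop_dil] cinner_scaleC_left)
  then have "cinner (defect_row h) (szego_kernel w \<eta>)
      = cinner (dil (\<Sum>j\<in>UNIV. w $ j *\<^sub>C ?q j - T j (?q j))) (szego_kernel w \<eta>)"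
    by (simp add: defect_row_def cinner_sum_left bop_sum[OF bop_dil])
  then show ?thesis
    by (simp add: cinner_dil_kernel[OF w] char_value_def)
qed

lemma char_value_eq:
  assumes w: "w \<in> polydisc"
  shows "char_value w h = adj (szego_kernel w) (defect_row h)"
  by (rule cinner_eqI[of "char_value w h"])
    (simp add: cinner_adj_left[OF bop_kernel[OF w]] cinner_defect_row_kernel[OF w])

lemma bop_char_value:
  assumes w: "w \<in> polydisc"
  shows "bop (char_value w)"
proof -
  have "char_value w = (\<lambda>h. adj (szego_kernel w) (defect_row h))"
    by (rule ext) (rule char_value_eq[OF w])
  then show ?thesis
    by (simp only: bop_compose[OF bop_adj[OF bop_kernel[OF w]] bop_defect_row])
qed

lemma csubspace_defect_space: "csubspace (defect_space T)"
  unfolding defect_space_def by (rule csubspace_closure_range[OF bop_defect_matrix])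

lemma csubspace_defect_star_space: "csubspace (defect_star_space T)"
  unfolding defect_star_space_def by (rule csubspace_closure_range[OF bop_defect_star])

lemma defect_matrix_in: "defect_matrix T h \<in> defect_space T"
  unfolding defect_space_def by (rule subsetD[OF closure_subset rangeI])

text \<open>The characteristic function is well defined: evaluation at w is bounded, and the norm of
  \<open>defect_row h\<close> is that of \<open>defect_matrix T h\<close>.\<close>

lemma char_fun_ex:
  assumes w: "w \<in> polydisc"
  shows "\<exists>!\<Theta>. \<Theta> \<in> bounded_ops (defect_space T) (defect_star_space T) \<and>
    (\<forall>h. \<Theta> (defect_matrix T h) = char_value w h)"
proof -
  obtain C where C: "C > 0" "\<And>f. norm (adj (szego_kernel w) f :: 'a) \<le> C * norm f"
    using bop_bound[OF bop_adj[OF bop_kernel[OF w]]] by metis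
  have "norm (char_value w h) \<le> C * norm (defect_matrix T h)" for h
    using C(2)[of "defect_row h"] by (simp add: char_value_eq[OF w] norm_defect_matrix)
  then obtain \<Theta> where \<Theta>: "\<Theta> \<in> bounded_ops (closure (range (defect_matrix T))) (closure (range (char_value w)))"
    "\<And>h. \<Theta> (defect_matrix T h) = char_value w h"
    using bounded_extension[OF bop_defect_matrix bop_char_value[OF w]] by metis
  have "closure (range (char_value w)) \<subseteq> defect_star_space T"
    unfolding defect_star_space_def by (rule closure_mono) (auto simp: char_value_def)
  then have "\<Theta> \<in> bounded_ops (defect_space T) (defect_star_space T)"
    using \<Theta>(1) unfolding bounded_ops_def defect_space_def by (auto simp: PiE_iff)
  then show ?thesis
  proof (intro ex1I[of _ \<Theta>] conjI allI \<Theta>(2))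
    fix \<Theta>' assume \<Theta>': "\<Theta>' \<in> bounded_ops (defect_space T) (defect_star_space T) \<and>
      (\<forall>h. \<Theta>' (defect_matrix T h) = char_value w h)"
    have "\<Theta>' \<in> bounded_ops (closure (range (defect_matrix T))) (defect_star_space T)"
      using \<Theta>' by (simp add: defect_space_def)
    then show "\<Theta>' = \<Theta>"
      by (rule bounded_ops_eqI[OF _ \<Theta>(1) bop_defect_matrix]) (simp add: \<Theta>(2) \<Theta>')
  qed
qed

lemma
  assumes w: "w \<in> polydisc"
  shows char_fun_bounded: "char_fun T w \<in> bounded_ops (defect_space T) (defect_star_space T)"
    and char_fun_defect_matrix: "char_fun T w (defect_matrix T h) = char_value w h"
  using theI'[OF char_fun_ex[OF w]] unfolding char_fun_def char_value_def by blast+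

lemma char_fun_eqI:
  assumes w: "w \<in> polydisc" and "\<Theta> \<in> bounded_ops (defect_space T) (defect_star_space T)"
    "\<And>h. \<Theta> (defect_matrix T h) = char_value w h"
  shows "char_fun T w = \<Theta>"
  using bounded_ops_eqI[OF char_fun_bounded[OF w, unfolded defect_space_def] _ bop_defect_matrix,
      of \<Theta> "defect_star_space T"] assms(2,3) char_fun_defect_matrix[OF w]
  by (simp add: defect_space_def)

text \<open>Multiplication by the characteristic function, restricted to the constants.  The two conditions
  determine the map.\<close>

definition char_map :: "'a ^ 'n \<Rightarrow> ('n \<Rightarrow> nat, 'a) ell2"
  where "char_map = (SOME \<Theta>. \<Theta> \<in> bounded_ops (defect_space T) (closure (range defect_row)) \<and>
    (\<forall>h. \<Theta> (defect_matrix T h) = defect_row h))"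

lemma
  shows char_map_bounded: "char_map \<in> bounded_ops (defect_space T) (closure (range defect_row))"
    and char_map_defect_matrix: "char_map (defect_matrix T h) = defect_row h"
proof -
  obtain \<Theta> where "\<Theta> \<in> bounded_ops (defect_space T) (closure (range defect_row))"
    "\<And>h. \<Theta> (defect_matrix T h) = defect_row h"
    using bounded_extension[OF bop_defect_matrix bop_defect_row, of 1] norm_defect_matrix
    unfolding defect_space_def by (metis mult_1 order_refl)
  then have "\<exists>\<Theta>. \<Theta> \<in> bounded_ops (defect_space T) (closure (range defect_row)) \<and>
      (\<forall>h. \<Theta> (defect_matrix T h) = defect_row h)"
    by blast
  from someI_ex[OF this] show "char_map \<in> bounded_ops (defect_space T) (closure (range defect_row))"
    "char_map (defect_matrix T h) = defect_row h"
    unfolding char_map_def by blast+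
qed

lemma cinner_char_map_kernel:
  assumes w: "w \<in> polydisc" and x: "x \<in> defect_space T"
  shows "cinner (char_map x) (szego_kernel w \<eta>) = cinner (char_fun T w x) \<eta>"
proof -
  obtain d where d: "\<And>n. d n \<in> range (defect_matrix T)" "d \<longlonglongrightarrow> x"
    using x closure_sequential unfolding defect_space_def by blast
  have d': "d n \<in> defect_space T" for n
    using d(1) closure_subset unfolding defect_space_def by blast
  have eq: "cinner (char_map (d n)) (szego_kernel w \<eta>) = cinner (char_fun T w (d n)) \<eta>" for n
    using d(1)[of n]
    by (elim imageE) (simp add: char_map_defect_matrix char_fun_defect_matrix[OF w] cinner_defect_row_kernel[OF w])
  have "(\<lambda>n. cinner (char_map (d n)) (szego_kernel w \<eta>)) \<longlonglongrightarrow> cinner (char_map x) (szego_kernel w \<eta>)"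
    by (intro tendsto_cinner tendsto_const
        bounded_ops_tendsto(1)[OF char_map_bounded csubspace_defect_space d' d(2)])
  moreover have "(\<lambda>n. cinner (char_fun T w (d n)) \<eta>) \<longlonglongrightarrow> cinner (char_fun T w x) \<eta>"
    by (intro tendsto_cinner tendsto_const
        bounded_ops_tendsto(1)[OF char_fun_bounded[OF w] csubspace_defect_space d' d(2)])
  ultimately show ?thesis
    unfolding eq by (rule LIMSEQ_unique)
qed

lemma dil_adj_char_map:
  assumes "x \<in> defect_space T"
  shows "dil_adj (char_map x) = 0"
proof -
  have "cinner (char_map x) (dil y) = 0" for y
    by (rule cinner_eq_0_closure[OF bounded_ops_in[OF char_map_bounded assms]])
      (auto simp: cinner_dil_0)
  then show ?thesis
    by (intro cinner_eqI[of "dil_adj (char_map x)"]) (simp add: cinner_dil_adj_left)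
qed

text \<open>The Hardy space with coefficients in the defect space of the adjoint tuple.\<close>

abbreviation H2 :: "('n \<Rightarrow> nat, 'a) ell2 set" where "H2 \<equiv> coeffs_in (defect_star_space T)"

lemma csubspace_H2: "csubspace H2"
  by (rule csubspace_coeffs_in[OF csubspace_defect_star_space])

lemmas shift_H2 = shift_coeffs_in[OF csubspace_defect_star_space]

lemma dil_H2: "dil h \<in> H2"
  using closure_subset[of "range (defect_star T)"]
  by (auto simp: coeffs_in_def coeff_dil defect_star_space_def)

lemma proj_H2: "y \<in> H2 \<Longrightarrow> proj y \<in> H2"
  unfolding proj_def by (intro csubspace_diff[OF csubspace_H2] dil_H2)

lemma co_shift_H2: "y \<in> H2 \<Longrightarrow> co_shift i y \<in> H2"
  unfolding co_shift_def by (intro proj_H2 back_shift_coeffs_in)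

lemma corner_H2: "corner j h \<in> H2"
  unfolding corner_def by (intro csubspace_diff[OF csubspace_H2] dil_H2 shift_H2)

lemma partial_column_H2: "partial_column A j h \<in> H2"
proof -
  have "finite A" by simp
  then show ?thesis
    by (induction A arbitrary: h rule: finite_induct)
      (simp_all add: corner_H2 partial_column_insert csubspace_diff[OF csubspace_H2] shift_H2)
qed

lemma defect_row_H2: "defect_row h \<in> H2"
proof -
  have "(\<Sum>j\<in>A. defect_column j (h $ j)) \<in> H2" for A
    by (induction A rule: infinite_finite_induct)
      (auto simp: csubspace_0[OF csubspace_H2] defect_column_def partial_column_H2
        intro!: csubspace_add[OF csubspace_H2])
  then show ?thesis
    by (simp add: defect_row_def)
qed

lemma char_map_H2:
  assumes "x \<in> defect_space T"
  shows "char_map x \<in> H2"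
proof -
  have "closure (range defect_row) \<subseteq> H2"
    by (rule closure_minimal) (auto simp: defect_row_H2 csubspace_closed[OF csubspace_H2])
  then show ?thesis
    using bounded_ops_in[OF char_map_bounded assms] by blast
qed

text \<open>The monomials times the functions in the range of \<open>defect_row\<close>.\<close>

inductive_set generated :: "('n \<Rightarrow> nat, 'a) ell2 set" where
  base: "defect_row h \<in> generated"
| shift: "x \<in> generated \<Longrightarrow> shift i x \<in> generated"

lemma dil_adj_generated: "x \<in> generated \<Longrightarrow> dil_adj x = 0"
  by (induction rule: generated.induct) (simp_all add: dil_adj_shift_0)

lemma co_shift_generated: "x \<in> generated \<Longrightarrow> co_shift i x \<in> generated \<or> co_shift i x = 0"
proof (induction rule: generated.induct)
  case (shift x k)
  then show ?case
    using dil_adj_generated[OF shift.hyps]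
    by (cases "k = i") (auto simp: co_shift_shift_same co_shift_shift bop_zero[OF bop_shift]
        intro: generated.shift)
qed simp

text \<open>What remains in \<open>H2\<close> beside the range of the dilation and the span of \<open>generated\<close>.  It is
  invariant under \<open>co_shift i\<close> and \<open>I - shift i (co_shift i)\<close>, and turns out to be 0.\<close>

definition annihilator :: "('n \<Rightarrow> nat, 'a) ell2 set"
  where "annihilator = {y \<in> H2. dil_adj y = 0 \<and> (\<forall>x\<in>generated. cinner y x = 0)}"

lemma co_shift_annihilator: "y \<in> annihilator \<Longrightarrow> co_shift i y \<in> annihilator"
  by (auto simp: annihilator_def co_shift_H2 cinner_co_shift_left[OF dil_adj_generated]
      intro: generated.shift)

lemma wandering_annihilator:
  assumes y: "y \<in> annihilator"
  shows "y - shift i (co_shift i y) \<in> annihilator"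
proof -
  have cy: "co_shift i y \<in> annihilator"
    by (rule co_shift_annihilator[OF y])
  have "cinner (shift i (co_shift i y)) x = 0" if "x \<in> generated" for x
  proof -
    have "cinner (shift i (co_shift i y)) x = cinner (co_shift i y) (co_shift i x)"
      by (simp add: cinner_co_shift_right)
    also have "\<dots> = 0"
      using co_shift_generated[OF that, of i] cy by (auto simp: annihilator_def)
    finally show ?thesis .
  qed
  then show ?thesis
    using y cy
    by (auto simp: annihilator_def cinner_diff_left bop_diff[OF bop_dil_adj] dil_adj_shift_0
        intro!: csubspace_diff[OF csubspace_H2] shift_H2)
qed

text \<open>A wandering vector that is orthogonal to the range of \<open>defect_row\<close> is constant, and a constant
  orthogonal to the range of the dilation is orthogonal to the range of the defect operator.\<close>

lemma wandering_zero:
  assumes y: "y \<in> annihilator" and co: "\<And>i. co_shift i y = 0"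
  shows "y = 0"
proof -
  have dy: "dil_adj y = 0" and gen: "\<And>x. x \<in> generated \<Longrightarrow> cinner y x = 0" and H: "y \<in> H2"
    using y by (auto simp: annihilator_def)
  have "back_shift j y = 0" for j
  proof -
    have "cinner (dil_adj (back_shift j y)) h = 0" for h
    proof -
      have "defect_row (\<chi> k. if k = j then h else 0) = (\<Sum>k\<in>UNIV. if k = j then defect_column j h else 0)"
        unfolding defect_row_def by (intro sum.cong) (auto simp: bop_zero[OF bop_defect_column])
      then have "defect_row (\<chi> k. if k = j then h else 0) = defect_column j h"
        by simp
      then have "cinner y (defect_column j h) = 0"
        using gen[OF generated.base] by metis
      then have "cinner y (corner j h) = 0"
        by (simp add: cinner_wandering_defect_column[OF dy co])
      then show ?thesis
        by (simp add: cinner_dil_adj_left cinner_back_shift_left corner_def cinner_diff_right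
            cinner_dil_0[OF dy])
    qed
    then have "dil_adj (back_shift j y) = 0"
      by (metis cinner_self_zero)
    then show ?thesis
      using co[of j] by (simp add: co_shift_def proj_id)
  qed
  then have c: "coeff y m = 0" if "m j \<noteq> 0" for m j
    using coeff_back_shift[of j y "m(j := m j - 1)"] that by simp
  let ?\<eta> = "coeff y (\<lambda>_. 0)"
  have z: "(0 :: complex ^ 'n) \<in> polydisc"
    by (simp add: polydisc_def)
  have y_eq: "y = szego_kernel 0 ?\<eta>"
  proof (rule ell2_eqI)
    fix m :: "'n \<Rightarrow> nat"
    show "coeff y m = coeff (szego_kernel 0 ?\<eta>) m"
    proof (cases "m = (\<lambda>_. 0)")
      case False
      then obtain j where "m j \<noteq> 0"
        by auto
      then have "coeff y m = 0" "(\<Prod>i\<in>UNIV. cnj ((0 :: complex ^ 'n) $ i) ^ m i) = 0"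
        using c by auto
      then show ?thesis
        by (simp only: coeff_kernel[OF z] scaleC_zero_left)
    qed (simp add: coeff_kernel[OF z])
  qed
  have "cinner (defect_star T h) ?\<eta> = 0" for h
    using cinner_dil_0(2)[OF dy, of h] kernel_0[of "dil h" ?\<eta>] y_eq
    by (simp add: coeff_dil Ts_pow_0)
  then have "cinner ?\<eta> ?\<eta> = 0"
    using H by (intro cinner_eq_0_closure[of ?\<eta> "range (defect_star T)"])
      (auto simp: coeffs_in_def defect_star_space_def)
  then show ?thesis
    by (subst y_eq) (simp add: bop_zero[OF bop_kernel[OF z]])
qed

lemma co_shift_funpow_tendsto_0:
  assumes "dil_adj y = 0"
  shows "(\<lambda>p. (co_shift i ^^ p) y) \<longlonglongrightarrow> 0"
proof -
  have "(co_shift i ^^ p) y = proj ((back_shift i ^^ p) y)" for p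
    by (induction p) (simp_all add: proj_id assms co_shift_proj, simp add: co_shift_def)
  moreover have "(\<lambda>p. proj ((back_shift i ^^ p) y)) \<longlonglongrightarrow> proj 0"
    by (intro bop_tendsto[OF bop_proj] back_shift_funpow_tendsto_0)
  ultimately show ?thesis
    by (simp add: bop_zero[OF bop_proj])
qed

text \<open>
  The Wold argument, one index at a time: if \<open>I - shift i (co_shift i)\<close> kills all powers
  \<open>co_shift i ^^ p\<close> applied to y, then these all have the norm of y, but they tend to 0.  The set C
  holds the indices whose co-shift need not kill y.
\<close>

lemma annihilator_zero:
  assumes "y \<in> annihilator"
  shows "y = 0"
proof -
  have "y = 0" if "finite C" "y \<in> annihilator" "\<And>i. i \<notin> C \<Longrightarrow> co_shift i y = 0" for C y
    using that
  proof (induction C arbitrary: y rule: finite_induct)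
    case empty
    then show ?case
      using wandering_zero by simp
  next
    case (insert i C)
    let ?y = "\<lambda>p. (co_shift i ^^ p) y"
    have y_ann: "?y p \<in> annihilator" for p
      by (induction p) (simp_all add: insert.prems(1) co_shift_annihilator)
    have dy: "dil_adj (?y p) = 0" for p
      using y_ann[of p] by (simp add: annihilator_def)
    have "?y p = shift i (?y (Suc p))" for p
    proof -
      have "co_shift k (?y p - shift i (?y (Suc p))) = 0" if "k \<notin> C" for k
      proof (cases "k = i")
        case True
        then show ?thesis
          by (simp add: bop_diff[OF bop_co_shift] co_shift_shift_same)
      next
        case False
        have yq: "co_shift k (?y q) = 0" for q
        proof -
          have "co_shift k (?y q) = (co_shift i ^^ q) (co_shift k y)"
            using funpow_commute[of "co_shift k" "co_shift i" 1 q y] co_shift_commute by simp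
          also have "co_shift k y = 0"
            using insert.prems(2) False that by simp
          also have "(co_shift i ^^ q) 0 = 0"
            by (rule bop_zero[OF bop_funpow[OF bop_co_shift]])
          finally show ?thesis .
        qed
        then show ?thesis
          unfolding bop_diff[OF bop_co_shift] co_shift_shift[OF False dy] yq
          by (simp add: bop_zero[OF bop_shift])
      qed
      then have "?y p - shift i (?y (Suc p)) = 0"
        using insert.IH[OF wandering_annihilator[OF y_ann[of p], of i]] by simp
      then show ?thesis
        by simp
    qed
    then have "norm (?y (Suc p)) = norm (?y p)" for p
      by (metis norm_shift)
    then have "norm (?y p) = norm y" for p
      by (induction p) simp_all
    moreover have "(\<lambda>p. norm (?y p)) \<longlonglongrightarrow> norm (0 :: ('n \<Rightarrow> nat, 'a) ell2)"
      using dy[of 0] by (intro tendsto_norm co_shift_funpow_tendsto_0) simp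
    ultimately show ?case
      by (simp add: LIMSEQ_const_iff)
  qed
  from this[of UNIV y] show ?thesis
    using assms by simp
qed

end

section \<open>Unitaries between subspaces\<close>

lemma
  assumes U: "unitary_on E F U" and E: "csubspace E"
  shows unitary_on_add: "x \<in> E \<Longrightarrow> y \<in> E \<Longrightarrow> U (x + y) = U x + U y"
    and unitary_on_scaleC: "x \<in> E \<Longrightarrow> U (c *\<^sub>C x) = c *\<^sub>C U x"
    and unitary_on_zero: "U 0 = 0"
    and unitary_on_in: "x \<in> E \<Longrightarrow> U x \<in> F"
    and unitary_on_cinner: "x \<in> E \<Longrightarrow> y \<in> E \<Longrightarrow> cinner (U x) (U y) = cinner x y"
    and unitary_on_norm: "x \<in> E \<Longrightarrow> norm (U x) = norm x"
    and unitary_on_inj: "inj_on U E"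
    and unitary_on_image: "U ` E = F"
proof -
  have b: "U \<in> bounded_ops E F"
    using U by (simp add: unitary_on_def)
  show add: "x \<in> E \<Longrightarrow> y \<in> E \<Longrightarrow> U (x + y) = U x + U y" for x y
    by (rule bounded_ops_add[OF b])
  show scale: "x \<in> E \<Longrightarrow> U (c *\<^sub>C x) = c *\<^sub>C U x" for x c
    by (rule bounded_ops_scaleC[OF b])
  show "U 0 = 0"
    using scale[OF csubspace_0[OF E], of 0] by simp
  show "x \<in> E \<Longrightarrow> U x \<in> F"
    by (rule bounded_ops_in[OF b])
  show "U ` E = F"
    using U by (simp add: unitary_on_def)
  show c: "x \<in> E \<Longrightarrow> y \<in> E \<Longrightarrow> cinner (U x) (U y) = cinner x y" for x y
    using U by (simp add: unitary_on_def)
  show n: "x \<in> E \<Longrightarrow> norm (U x) = norm x" for x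
    using c[of x x] by (simp add: norm_eq_sqrt_inner inner_eq_Re_cinner)
  show "inj_on U E"
  proof (rule inj_onI)
    fix x y assume xy: "x \<in> E" "y \<in> E" "U x = U y"
    have "U x = U (x - y) + U y"
      using add[OF csubspace_diff[OF E xy(1,2)] xy(2)] by simp
    then show "x = y"
      using n[OF csubspace_diff[OF E xy(1,2)]] xy(3) by simp
  qed
qed

text \<open>The inverse of a unitary, extended to be undefined off its domain.\<close>

definition unitary_inv :: "'a::complex_inner set \<Rightarrow> 'b::complex_inner set \<Rightarrow> ('a \<Rightarrow> 'b) \<Rightarrow> 'b \<Rightarrow> 'a"
  where "unitary_inv E F U = restrict (inv_into E U) F"

lemma
  assumes U: "unitary_on E F U" and E: "csubspace E"
  shows unitary_inv_left: "x \<in> E \<Longrightarrow> unitary_inv E F U (U x) = x"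
    and unitary_inv_right: "y \<in> F \<Longrightarrow> U (unitary_inv E F U y) = y"
    and unitary_inv_in: "y \<in> F \<Longrightarrow> unitary_inv E F U y \<in> E"
proof -
  note i = unitary_on_inj[OF U E] and im = unitary_on_image[OF U E]
  show "x \<in> E \<Longrightarrow> unitary_inv E F U (U x) = x"
    using i im by (auto simp: unitary_inv_def)
  show "y \<in> F \<Longrightarrow> U (unitary_inv E F U y) = y"
    using im by (auto simp: unitary_inv_def f_inv_into_f)
  show "y \<in> F \<Longrightarrow> unitary_inv E F U y \<in> E"
    using im by (auto simp: unitary_inv_def inv_into_into)
qed

lemma unitary_on_inv:
  assumes U: "unitary_on E F U" and E: "csubspace E" and F: "csubspace F"
  shows "unitary_on F E (unitary_inv E F U)"
proof -
  let ?V = "unitary_inv E F U"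
  note left = unitary_inv_left[OF U E] and right = unitary_inv_right[OF U E]
    and inE = unitary_inv_in[OF U E]
  have cin: "cinner (?V x) (?V y) = cinner x y" if "x \<in> F" "y \<in> F" for x y
    using unitary_on_cinner[OF U E inE[OF that(1)] inE[OF that(2)]] that by (simp add: right)
  have "?V (x + y) = ?V x + ?V y" if "x \<in> F" "y \<in> F" for x y
    using left[OF csubspace_add[OF E inE[OF that(1)] inE[OF that(2)]]] that
    by (simp add: unitary_on_add[OF U E] inE right)
  moreover have "?V (c *\<^sub>C x) = c *\<^sub>C ?V x" if "x \<in> F" for x c
    using left[OF csubspace_scaleC[OF E inE[OF that], of c]] that
    by (simp add: unitary_on_scaleC[OF U E] inE right)
  moreover have "norm (?V x) \<le> 1 * norm x" if "x \<in> F" for x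
    using unitary_on_norm[OF U E inE[OF that]] by (simp add: right that)
  moreover have "?V \<in> F \<rightarrow>\<^sub>E E"
    using inE by (auto simp: unitary_inv_def)
  ultimately have "?V \<in> bounded_ops F E"
    unfolding bounded_ops_def by blast
  moreover have "?V ` F = E"
    using left inE unitary_on_in[OF U E] by (auto intro!: image_eqI[of _ ?V])
  ultimately show ?thesis
    by (simp add: unitary_on_def cin)
qed

lemma adjoint_on_unitary:
  assumes U: "unitary_on E F U" and E: "csubspace E" and F: "csubspace F"
  shows "adjoint_on E F U = unitary_inv E F U"
  unfolding adjoint_on_def
proof (rule the_equality)
  let ?V = "unitary_inv E F U"
  have b: "?V \<in> bounded_ops F E"
    using unitary_on_inv[OF U E F] by (simp add: unitary_on_def)
  have adj: "cinner (U x) y = cinner x (?V y)" if "x \<in> E" "y \<in> F" for x y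
    using unitary_on_cinner[OF U E that(1) unitary_inv_in[OF U E that(2)]] that
    by (simp add: unitary_inv_right[OF U E])
  then show "?V \<in> bounded_ops F E \<and> (\<forall>x\<in>E. \<forall>y\<in>F. cinner (U x) y = cinner x (?V y))"
    using b by blast
  fix B assume B: "B \<in> bounded_ops F E \<and> (\<forall>x\<in>E. \<forall>y\<in>F. cinner (U x) y = cinner x (B y))"
  show "B = ?V"
  proof
    fix y
    show "B y = ?V y"
    proof (cases "y \<in> F")
      case True
      let ?d = "B y - ?V y"
      have d: "?d \<in> E"
        using B True by (intro csubspace_diff[OF E]) (auto intro: bounded_ops_in[OF b] bounded_ops_in)
      have "cinner z ?d = 0" if "z \<in> E" for z
      proof -
        have "cinner (U z) y = cinner z (B y)"
          using B that True by blast
        then show ?thesis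
          by (simp add: cinner_diff_right adj[OF that True])
      qed
      from this[OF d] show ?thesis
        by simp
    next
      case False
      then show ?thesis
        using bounded_ops_undef[OF conjunct1[OF B]] bounded_ops_undef[OF b] by simp
    qed
  qed
qed

text \<open>Coincidence of the characteristic functions in the form \<open>\<Theta>\<^sub>T \<tau> = \<tau>\<^sub>* \<Theta>\<^sub>S\<close>.\<close>

definition coincidence ::
    "('n::finite \<Rightarrow> 'a::complex_inner \<Rightarrow> 'a) \<Rightarrow> ('n \<Rightarrow> 'b::complex_inner \<Rightarrow> 'b) \<Rightarrow>
      ('b ^ 'n \<Rightarrow> 'a ^ 'n) \<Rightarrow> ('b \<Rightarrow> 'a) \<Rightarrow> bool"
  where "coincidence T S \<tau> \<tau>s \<longleftrightarrow>
    unitary_on (defect_space S) (defect_space T) \<tau> \<and>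
    unitary_on (defect_star_space S) (defect_star_space T) \<tau>s \<and>
    (\<forall>w\<in>polydisc. \<forall>x\<in>defect_space S. char_fun T w (\<tau> x) = \<tau>s (char_fun S w x))"

lemma char_funs_coincide_iff:
  assumes E: "csubspace (defect_space S)" and F: "csubspace (defect_space T)"
  shows "char_funs_coincide T S \<longleftrightarrow> (\<exists>\<tau> \<tau>s. coincidence T S \<tau> \<tau>s)"
proof -
  have "(\<forall>w\<in>polydisc. \<forall>x\<in>defect_space T. char_fun T w x =
          \<tau>s (char_fun S w (adjoint_on (defect_space S) (defect_space T) \<tau> x))) \<longleftrightarrow>
      (\<forall>w\<in>polydisc. \<forall>x\<in>defect_space S. char_fun T w (\<tau> x) = \<tau>s (char_fun S w x))"
    if \<tau>: "unitary_on (defect_space S) (defect_space T) \<tau>" for \<tau> \<tau>s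
  proof -
    have "(\<forall>x\<in>defect_space T. P x) \<longleftrightarrow> (\<forall>x\<in>defect_space S. P (\<tau> x))" for P
      unfolding unitary_on_image[OF \<tau> E, symmetric] by (rule ball_simps(9))
    then show ?thesis
      by (simp add: adjoint_on_unitary[OF \<tau> E F] unitary_inv_left[OF \<tau> E])
  qed
  then show ?thesis
    unfolding char_funs_coincide_def coincidence_def by blast
qed

lemma coincidence_sym:
  assumes c: "coincidence T S \<tau> \<tau>s"
    and csub: "csubspace (defect_space S)" "csubspace (defect_space T)"
      "csubspace (defect_star_space S)" "csubspace (defect_star_space T)"
    and S: "\<And>w x. w \<in> polydisc \<Longrightarrow> x \<in> defect_space S \<Longrightarrow> char_fun S w x \<in> defect_star_space S"
  shows "coincidence S T (unitary_inv (defect_space S) (defect_space T) \<tau>)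
    (unitary_inv (defect_star_space S) (defect_star_space T) \<tau>s)"
proof -
  have \<tau>: "unitary_on (defect_space S) (defect_space T) \<tau>"
    and \<tau>s: "unitary_on (defect_star_space S) (defect_star_space T) \<tau>s"
    and eq: "\<And>w x. w \<in> polydisc \<Longrightarrow> x \<in> defect_space S \<Longrightarrow> char_fun T w (\<tau> x) = \<tau>s (char_fun S w x)"
    using c by (auto simp: coincidence_def)
  let ?v = "unitary_inv (defect_space S) (defect_space T) \<tau>"
  have "char_fun S w (?v x) = unitary_inv (defect_star_space S) (defect_star_space T) \<tau>s (char_fun T w x)"
    if "w \<in> polydisc" "x \<in> defect_space T" for w x
  proof -
    have v: "?v x \<in> defect_space S"
      by (rule unitary_inv_in[OF \<tau> csub(1) that(2)])
    have "char_fun T w x = \<tau>s (char_fun S w (?v x))"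
      using eq[OF that(1) v] by (simp add: unitary_inv_right[OF \<tau> csub(1) that(2)])
    then show ?thesis
      by (simp add: unitary_inv_left[OF \<tau>s csub(3)] S[OF that(1) v])
  qed
  then show ?thesis
    using unitary_on_inv[OF \<tau> csub(1,2)] unitary_on_inv[OF \<tau>s csub(3,4)]
    by (simp add: coincidence_def)
qed

text \<open>A unitary between the coefficient spaces, applied coefficientwise.  It is meant for families in
  \<open>coeffs_in E\<close>; other coefficients are sent to 0 to stay square-summable.\<close>

definition lift_coeffs :: "'a::complex_inner set \<Rightarrow> ('a \<Rightarrow> 'b::complex_inner) \<Rightarrow> ('i, 'a) ell2 \<Rightarrow> ('i, 'b) ell2"
  where "lift_coeffs E U f = Abs_ell2 (\<lambda>m. if coeff f m \<in> E then U (coeff f m) else 0)"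

lemma
  assumes U: "unitary_on E F U" and E: "csubspace E" and f: "f \<in> coeffs_in E"
  shows coeff_lift: "coeff (lift_coeffs E U f) m = U (coeff f m)"
    and lift_in: "csubspace F \<Longrightarrow> lift_coeffs E U f \<in> coeffs_in F"
proof -
  have "(norm (if coeff f m \<in> E then U (coeff f m) else 0))\<^sup>2 = (norm (coeff f m))\<^sup>2" for m
    using f unitary_on_norm[OF U E] by (auto simp: coeffs_in_def)
  then have "(\<lambda>m. (norm (if coeff f m \<in> E then U (coeff f m) else 0))\<^sup>2) summable_on UNIV"
    by (simp only: coeff_square_summable)
  then show *: "coeff (lift_coeffs E U f) m = U (coeff f m)" for m
    using f unfolding lift_coeffs_def by (subst Abs_ell2_inverse) (auto simp: coeffs_in_def)
  then show "lift_coeffs E U f \<in> coeffs_in F"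
    using f unitary_on_in[OF U E] by (auto simp: coeffs_in_def)
qed

lemma
  assumes U: "unitary_on E F U" and E: "csubspace E"
    and f: "f \<in> coeffs_in E" and g: "g \<in> coeffs_in E"
  shows cinner_lift: "cinner (lift_coeffs E U f) (lift_coeffs E U g) = cinner f g"
    and lift_add: "lift_coeffs E U (f + g) = lift_coeffs E U f + lift_coeffs E U g"
    and lift_scaleC: "lift_coeffs E U (c *\<^sub>C f) = c *\<^sub>C lift_coeffs E U f"
proof -
  have in_E: "coeff f m \<in> E" "coeff g m \<in> E" for m
    using f g by (auto simp: coeffs_in_def)
  note H = csubspace_coeffs_in[OF E]
  have "((\<lambda>m. cinner (coeff f m) (coeff g m)) has_sum
      cinner (lift_coeffs E U f) (lift_coeffs E U g)) UNIV"
    using has_sum_cinner[of "lift_coeffs E U f" "lift_coeffs E U g"]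
    by (simp add: coeff_lift[OF U E f] coeff_lift[OF U E g] unitary_on_cinner[OF U E] in_E)
  then show "cinner (lift_coeffs E U f) (lift_coeffs E U g) = cinner f g"
    by (rule has_sum_unique[OF _ has_sum_cinner])
  show "lift_coeffs E U (f + g) = lift_coeffs E U f + lift_coeffs E U g"
    by (rule ell2_eqI) (simp add: coeff_lift[OF U E] f g csubspace_add[OF H] unitary_on_add[OF U E] in_E)
  show "lift_coeffs E U (c *\<^sub>C f) = c *\<^sub>C lift_coeffs E U f"
    by (rule ell2_eqI) (simp add: coeff_lift[OF U E] f csubspace_scaleC[OF H] unitary_on_scaleC[OF U E] in_E)
qed

lemma
  assumes U: "unitary_on E F U" and E: "csubspace E" and f: "f \<in> coeffs_in E"
  shows lift_shift: "lift_coeffs E U (shift i f) = shift i (lift_coeffs E U f)"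
    and lift_back_shift: "lift_coeffs E U (back_shift i f) = back_shift i (lift_coeffs E U f)"
proof -
  show "lift_coeffs E U (shift i f) = shift i (lift_coeffs E U f)"
    by (rule ell2_eqI)
      (simp add: coeff_lift[OF U E] f shift_coeffs_in[OF E] unitary_on_zero[OF U E])
  show "lift_coeffs E U (back_shift i f) = back_shift i (lift_coeffs E U f)"
    by (rule ell2_eqI) (simp add: coeff_lift[OF U E] f back_shift_coeffs_in)
qed

lemma kernel_coeffs_in: "w \<in> polydisc \<Longrightarrow> csubspace E \<Longrightarrow> \<eta> \<in> E \<Longrightarrow> szego_kernel w \<eta> \<in> coeffs_in E"
  by (auto simp: coeffs_in_def coeff_kernel csubspace_scaleC)

lemma lift_kernel:
  assumes "unitary_on E F U" "csubspace E" "w \<in> polydisc" "\<eta> \<in> E"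
  shows "lift_coeffs E U (szego_kernel w \<eta>) = szego_kernel w (U \<eta>)"
  by (rule ell2_eqI)
    (simp add: coeff_lift[OF assms(1,2)] kernel_coeffs_in coeff_kernel assms unitary_on_scaleC[OF assms(1,2)])

lemma lift_lift_inv:
  assumes U: "unitary_on E F U" and E: "csubspace E" and F: "csubspace F"
  shows "f \<in> coeffs_in E \<Longrightarrow> lift_coeffs F (unitary_inv E F U) (lift_coeffs E U f) = f"
    and "g \<in> coeffs_in F \<Longrightarrow> lift_coeffs E U (lift_coeffs F (unitary_inv E F U) g) = g"
proof -
  note V = unitary_on_inv[OF U E F]
  show "lift_coeffs F (unitary_inv E F U) (lift_coeffs E U f) = f" if f: "f \<in> coeffs_in E"
  proof (rule ell2_eqI)
    fix m
    have "coeff f m \<in> E"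
      using f by (auto simp: coeffs_in_def)
    then show "coeff (lift_coeffs F (unitary_inv E F U) (lift_coeffs E U f)) m = coeff f m"
      by (simp add: coeff_lift[OF V F lift_in[OF U E f F]] coeff_lift[OF U E f] unitary_inv_left[OF U E])
  qed
  show "lift_coeffs E U (lift_coeffs F (unitary_inv E F U) g) = g" if g: "g \<in> coeffs_in F"
  proof (rule ell2_eqI)
    fix m
    have "coeff g m \<in> F"
      using g by (auto simp: coeffs_in_def)
    then show "coeff (lift_coeffs E U (lift_coeffs F (unitary_inv E F U) g)) m = coeff g m"
      by (simp add: coeff_lift[OF U E lift_in[OF V F g E]] coeff_lift[OF V F g] unitary_inv_right[OF U E])
  qed
qed


section \<open>Coincidence implies unitary equivalence\<close>

lemma beurling_tuple_beurling:
  "beurling_tuple T \<Longrightarrow> beurling (T :: 'n::finite \<Rightarrow> 'a::{complex_inner,banach} \<Rightarrow> 'a)"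
  unfolding beurling_tuple_def by unfold_locales (auto simp: fun_eq_iff)

text \<open>Two Beurling tuples with coinciding characteristic functions.\<close>

locale coincide = T: beurling T + S: beurling S
  for T :: "'n::finite \<Rightarrow> 'a::{complex_inner,banach} \<Rightarrow> 'a"
    and S :: "'n \<Rightarrow> 'b::{complex_inner,banach} \<Rightarrow> 'b" +
  fixes \<tau> :: "'b ^ 'n \<Rightarrow> 'a ^ 'n" and \<tau>s :: "'b \<Rightarrow> 'a"
  assumes coincidence: "coincidence T S \<tau> \<tau>s"
begin

lemma \<tau>: "unitary_on (defect_space S) (defect_space T) \<tau>"
  and \<tau>s: "unitary_on (defect_star_space S) (defect_star_space T) \<tau>s"
  and char_fun_eq: "w \<in> polydisc \<Longrightarrow> x \<in> defect_space S \<Longrightarrow> char_fun T w (\<tau> x) = \<tau>s (char_fun S w x)"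
  using coincidence by (auto simp: coincidence_def)

abbreviation lift :: "('n \<Rightarrow> nat, 'b) ell2 \<Rightarrow> ('n \<Rightarrow> nat, 'a) ell2"
  where "lift \<equiv> lift_coeffs (defect_star_space S) \<tau>s"

lemmas lift_H2 = lift_in[OF \<tau>s S.csubspace_defect_star_space _ T.csubspace_defect_star_space]
lemmas cinner_lift_H2 = cinner_lift[OF \<tau>s S.csubspace_defect_star_space]

text \<open>Multiplication by the characteristic functions coincides as well, because an element of \<open>H2\<close>
  is determined by its values.\<close>

lemma lift_char_map:
  assumes x: "x \<in> defect_space S"
  shows "T.char_map (\<tau> x) = lift (S.char_map x)"
proof -
  define d where "d = T.char_map (\<tau> x) - lift (S.char_map x)"
  have \<tau>x: "\<tau> x \<in> defect_space T"
    by (rule unitary_on_in[OF \<tau> S.csubspace_defect_space x])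
  have d_H2: "d \<in> T.H2"
    unfolding d_def
    by (intro csubspace_diff[OF T.csubspace_H2] T.char_map_H2 \<tau>x lift_H2 S.char_map_H2 x)
  have "coeff d m = 0" for m
  proof -
    have "coeff d m \<in> defect_star_space T"
      using d_H2 by (auto simp: coeffs_in_def)
    then obtain \<zeta> where \<zeta>: "\<zeta> \<in> defect_star_space S" "coeff d m = \<tau>s \<zeta>"
      using unitary_on_image[OF \<tau>s S.csubspace_defect_star_space] by blast
    have "cinner d (szego_kernel w (\<tau>s \<zeta>)) = 0" if w: "w \<in> polydisc" for w
    proof -
      have "cinner (T.char_map (\<tau> x)) (szego_kernel w (\<tau>s \<zeta>)) = cinner (\<tau>s (char_fun S w x)) (\<tau>s \<zeta>)"
        by (simp add: T.cinner_char_map_kernel[OF w \<tau>x] char_fun_eq[OF w x])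
      also have "\<dots> = cinner (char_fun S w x) \<zeta>"
        by (rule unitary_on_cinner[OF \<tau>s S.csubspace_defect_star_space
              bounded_ops_in[OF S.char_fun_bounded[OF w] x] \<zeta>(1)])
      also have "\<dots> = cinner (S.char_map x) (szego_kernel w \<zeta>)"
        by (simp add: S.cinner_char_map_kernel[OF w x])
      also have "\<dots> = cinner (lift (S.char_map x)) (lift (szego_kernel w \<zeta>))"
        by (rule cinner_lift_H2[symmetric])
          (intro S.char_map_H2 x kernel_coeffs_in w S.csubspace_defect_star_space \<zeta>)+
      also have "lift (szego_kernel w \<zeta>) = szego_kernel w (\<tau>s \<zeta>)"
        by (rule lift_kernel[OF \<tau>s S.csubspace_defect_star_space w \<zeta>(1)])
      finally show ?thesis
        by (simp add: d_def cinner_diff_left)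
    qed
    then have "cinner (coeff d m) (\<tau>s \<zeta>) = 0"
      by (rule vanishing_coeff)
    then show ?thesis
      by (simp add: \<zeta>(2))
  qed
  then have "d = 0"
    by (intro ell2_eqI) simp
  then show ?thesis
    by (simp add: d_def)
qed

lemma generated_lift:
  "x \<in> T.generated \<Longrightarrow> \<exists>y\<in>S.H2. S.dil_adj y = 0 \<and> x = lift y"
proof (induction rule: T.generated.induct)
  case (base h)
  obtain x where x: "x \<in> defect_space S" "defect_matrix T h = \<tau> x"
    using T.defect_matrix_in[of h] unitary_on_image[OF \<tau> S.csubspace_defect_space] by blast
  then have "T.defect_row h = lift (S.char_map x)"
    using T.char_map_defect_matrix[of h] lift_char_map by simp
  then show ?case
    using S.char_map_H2[OF x(1)] S.dil_adj_char_map[OF x(1)] by blast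
next
  case (shift x i)
  then obtain y where y: "y \<in> S.H2" "S.dil_adj y = 0" "x = lift y"
    by blast
  then have "shift i x = lift (shift i y)"
    by (simp add: lift_shift[OF \<tau>s S.csubspace_defect_star_space])
  then show ?case
    using S.shift_H2[OF y(1)] S.dil_adj_shift_0[OF y(2)] by blast
qed

text \<open>The complement of the range of the dilation is determined by the characteristic function,
  hence so is the range itself.\<close>

definition intertwiner :: "'b \<Rightarrow> 'a"
  where "intertwiner k = T.dil_adj (lift (S.dil k))"

lemma dil_intertwiner: "T.dil (intertwiner k) = lift (S.dil k)"
proof -
  let ?f = "lift (S.dil k)"
  have "cinner (T.proj ?f) x = 0" if x: "x \<in> T.generated" for x
  proof -
    obtain y where y: "y \<in> S.H2" "S.dil_adj y = 0" "x = lift y"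
      using generated_lift[OF x] by blast
    have "cinner (T.proj ?f) x = cinner ?f (lift y)"
      by (simp add: T.proj_def cinner_diff_left T.cinner_dil_0[OF T.dil_adj_generated[OF x]] y(3)[symmetric])
    also have "\<dots> = cinner (S.dil k) y"
      by (rule cinner_lift_H2[OF S.dil_H2 y(1)])
    also have "\<dots> = 0"
      by (rule S.cinner_dil_0(2)[OF y(2)])
    finally show ?thesis .
  qed
  then have "T.proj ?f \<in> T.annihilator"
    by (simp add: T.annihilator_def T.proj_H2 lift_H2 S.dil_H2)
  then have "T.proj ?f = 0"
    by (rule T.annihilator_zero)
  then show ?thesis
    by (simp add: T.proj_def intertwiner_def)
qed

lemma cinner_intertwiner: "cinner (intertwiner x) (intertwiner y) = cinner x y"
proof -
  have "cinner (intertwiner x) (intertwiner y) = cinner (T.dil (intertwiner x)) (T.dil (intertwiner y))"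
    by (simp only: T.cinner_dil)
  then show ?thesis
    by (simp add: dil_intertwiner cinner_lift_H2 S.dil_H2 S.cinner_dil)
qed

lemma bop_intertwiner: "bop intertwiner"
proof (rule bopI[of _ 1])
  show "intertwiner (x + y) = intertwiner x + intertwiner y" for x y
    by (simp add: intertwiner_def bop_add[OF S.bop_dil] S.dil_H2
        lift_add[OF \<tau>s S.csubspace_defect_star_space] bop_add[OF T.bop_dil_adj])
  show "intertwiner (c *\<^sub>C x) = c *\<^sub>C intertwiner x" for c x
    by (simp add: intertwiner_def bop_scaleC[OF S.bop_dil] S.dil_H2
        lift_scaleC[OF \<tau>s S.csubspace_defect_star_space S.dil_H2 S.dil_H2] bop_scaleC[OF T.bop_dil_adj])
  show "norm (intertwiner x) \<le> 1 * norm x" for x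
    using cinner_intertwiner[of x x] by (simp add: norm_eq_sqrt_inner inner_eq_Re_cinner)
qed

lemma intertwiner_Ts: "intertwiner (S.Ts i k) = T.Ts i (intertwiner k)"
proof -
  have "T.dil (intertwiner (S.Ts i k)) = T.dil (T.Ts i (intertwiner k))"
    by (simp add: dil_intertwiner S.dil_Ts T.dil_Ts S.dil_H2
        lift_back_shift[OF \<tau>s S.csubspace_defect_star_space])
  then show ?thesis
    by (metis T.dil_adj_dil)
qed

end

lemma coincidence_imp_equivalent:
  fixes T :: "'n::finite \<Rightarrow> 'a::{complex_inner,banach} \<Rightarrow> 'a"
    and S :: "'n \<Rightarrow> 'b::{complex_inner,banach} \<Rightarrow> 'b"
  assumes "beurling T" "beurling S" "coincidence T S \<tau> \<tau>s"
  shows "jointly_unitarily_equivalent T S"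
proof -
  interpret c: coincide T S \<tau> \<tau>s
    using assms by (simp add: coincide_def coincide_axioms_def)
  define \<tau>' where "\<tau>' = unitary_inv (defect_space S) (defect_space T) \<tau>"
  define \<tau>s' where "\<tau>s' = unitary_inv (defect_star_space S) (defect_star_space T) \<tau>s"
  have "coincidence S T \<tau>' \<tau>s'"
    unfolding \<tau>'_def \<tau>s'_def
    by (rule coincidence_sym[OF assms(3)])
      (auto intro: c.S.csubspace_defect_space c.T.csubspace_defect_space
        c.S.csubspace_defect_star_space c.T.csubspace_defect_star_space
        bounded_ops_in[OF c.S.char_fun_bounded])
  then interpret d: coincide S T \<tau>' \<tau>s'
    using assms by (simp add: coincide_def coincide_axioms_def)
  let ?V = c.intertwiner and ?U = d.intertwiner
  note inv = lift_lift_inv[OF c.\<tau>s c.S.csubspace_defect_star_space c.T.csubspace_defect_star_space,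
      folded \<tau>s'_def]
  have VU: "?V (?U x) = x" for x
  proof -
    have "c.T.dil (?V (?U x)) = c.T.dil x"
      by (simp add: c.dil_intertwiner d.dil_intertwiner inv c.T.dil_H2)
    then show ?thesis
      by (metis c.T.dil_adj_dil)
  qed
  have UV: "?U (?V y) = y" for y
  proof -
    have "c.S.dil (?U (?V y)) = c.S.dil y"
      by (simp add: c.dil_intertwiner d.dil_intertwiner inv c.S.dil_H2)
    then show ?thesis
      by (metis c.S.dil_adj_dil)
  qed
  have adj: "cinner (?U x) y = cinner x (?V y)" for x y
    using c.cinner_intertwiner[of "?U x" y] by (simp add: VU)
  have "adj ?U = ?V"
    by (rule adj_unique[OF c.bop_intertwiner adj])
  moreover have "?U (T i (?V k)) = S i k" for i k
  proof (rule cinner_eqI)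
    fix z
    have "cinner (?U (T i (?V k))) z = cinner (?V k) (?V (c.S.Ts i z))"
      by (simp add: adj c.intertwiner_Ts c.T.cinner_Ts_right)
    then show "cinner (?U (T i (?V k))) z = cinner (S i k) z"
      by (simp add: c.cinner_intertwiner c.S.cinner_Ts_right)
  qed
  moreover have "surj ?U"
    by (rule surjI) (rule UV)
  then have "unitary_on UNIV UNIV ?U"
    unfolding unitary_on_def bounded_ops_UNIV
    using d.bop_intertwiner d.cinner_intertwiner by simp
  ultimately show ?thesis
    unfolding jointly_unitarily_equivalent_def by (intro exI[of _ ?U]) (auto simp: fun_eq_iff)
qed


section \<open>Unitary equivalence implies coincidence\<close>

text \<open>A unitary together with its inverse.\<close>

definition unitary_pair :: "('a::complex_inner \<Rightarrow> 'b::complex_inner) \<Rightarrow> ('b \<Rightarrow> 'a) \<Rightarrow> bool"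
  where "unitary_pair U V \<longleftrightarrow> bop U \<and> bop V \<and> (\<forall>x. V (U x) = x) \<and> (\<forall>y. U (V y) = y) \<and>
    (\<forall>x y. cinner (U x) y = cinner x (V y))"

lemma unitary_on_UNIV_pair:
  fixes U :: "'a::{complex_inner,banach} \<Rightarrow> 'b::complex_inner"
  assumes "unitary_on UNIV UNIV U"
  shows "unitary_pair U (adj U)"
proof -
  have U: "bop U" and s: "surj U" and c: "\<And>x y. cinner (U x) (U y) = cinner x y"
    using assms by (auto simp: unitary_on_def bounded_ops_UNIV)
  have VU: "adj U (U x) = x" for x
    by (rule cinner_eqI[of "adj U (U x)"]) (simp add: cinner_adj_left[OF U] c)
  have "U (adj U y) = y" for y
    using s VU by (metis surjD)
  then show ?thesis
    using VU by (simp add: unitary_pair_def U bop_adj cinner_adj_right)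
qed

lemma
  assumes "unitary_pair U V"
  shows unitary_pair_bop: "bop U" "bop V"
    and unitary_pair_inverse [simp]: "V (U x) = x" "U (V y) = y"
    and unitary_pair_adj: "cinner (U x) y = cinner x (V y)"
    and unitary_pair_cinner: "cinner (U x) (U x') = cinner x x'" "cinner (V y) (V y') = cinner y y'"
  using assms unfolding unitary_pair_def by (blast, blast, blast, blast, blast, metis, metis)

lemma unitary_pair_vec:
  assumes "unitary_pair U V"
  shows "unitary_pair (\<lambda>h. \<chi> i. U (h $ i)) (\<lambda>h. \<chi> i. V (h $ i :: 'b::complex_inner) :: 'a::complex_inner ^ 'n::finite)"
  unfolding unitary_pair_def
  by (auto intro!: bop_vec_lambda bop_compose[OF _ bop_vec_nth] unitary_pair_bop[OF assms]
      simp: unitary_pair_inverse[OF assms] cinner_vec_def unitary_pair_adj[OF assms])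

text \<open>By uniqueness a unitary that intertwines two positive operators intertwines their roots.\<close>

lemma op_sqrt_conj:
  fixes A :: "'a::{complex_inner,banach} \<Rightarrow> 'a" and A' :: "'b::{complex_inner,banach} \<Rightarrow> 'b"
  assumes UV: "unitary_pair U V" and A: "positive_op A" and A': "positive_op A'"
    and eq: "\<And>x. A' (U x) = U (A x)"
  shows "op_sqrt A' (U x) = U (op_sqrt A x)"
proof -
  note [simp] = unitary_pair_inverse[OF UV]
  have "op_sqrt A' = (\<lambda>y. U (op_sqrt A (V y)))"
  proof (rule op_sqrt_eqI[OF _ _ A'])
    show "positive_op (\<lambda>y. U (op_sqrt A (V y)))"
      using positive_op_sqrt[OF A] unfolding positive_op_iff
      by (auto simp: unitary_pair_adj[OF UV]
          intro!: bop_compose[OF unitary_pair_bop(1)[OF UV]] bop_compose[OF _ unitary_pair_bop(2)[OF UV]])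
    show "U (op_sqrt A (V (U (op_sqrt A (V y))))) = A' y" for y
      using eq[of "V y"] by (simp add: op_sqrt_square[OF A])
  qed
  then show ?thesis
    by simp
qed

lemma bop_closure_range:
  assumes "bop U" "\<And>h. \<exists>h'. U (D h) = D' h'" "x \<in> closure (range D)"
  shows "U x \<in> closure (range D')"
proof -
  obtain d where d: "\<And>n. d n \<in> range D" "d \<longlonglongrightarrow> x"
    using assms(3) closure_sequential by blast
  have "U (d n) \<in> range D'" for n
    using d(1)[of n] assms(2) by (elim imageE) (metis rangeI)
  then show ?thesis
    by (rule in_closure_LIMSEQ) (rule bop_tendsto[OF assms(1) d(2)])
qed

lemma unitary_on_restrict:
  assumes UV: "unitary_pair U V" and E: "csubspace E"
    and "\<And>x. x \<in> E \<Longrightarrow> U x \<in> F" "\<And>y. y \<in> F \<Longrightarrow> V y \<in> E"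
  shows "unitary_on E F (restrict U E)"
proof -
  obtain K where K: "\<And>x. norm (U x) \<le> K * norm x"
    using bop_bound[OF unitary_pair_bop(1)[OF UV]] by metis
  have "restrict U E \<in> bounded_ops E F"
    unfolding bounded_ops_def
    using assms(3) K csubspace_add[OF E] csubspace_scaleC[OF E]
    by (auto simp: bop_add[OF unitary_pair_bop(1)[OF UV]] bop_scaleC[OF unitary_pair_bop(1)[OF UV]])
  moreover have "restrict U E ` E = F"
    using assms(3,4) unitary_pair_inverse(2)[OF UV] by (auto intro!: image_eqI[of _ _ "V _"])
  ultimately show ?thesis
    using unitary_pair_cinner(1)[OF UV] by (simp add: unitary_on_def)
qed

text \<open>Two unitarily equivalent Beurling tuples.  The locale shows that all operators in the definition
  of the characteristic function correspond under the unitary.\<close>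

locale equivalent = T: beurling T + S: beurling S
  for T :: "'n::finite \<Rightarrow> 'a::{complex_inner,banach} \<Rightarrow> 'a"
    and S :: "'n \<Rightarrow> 'b::{complex_inner,banach} \<Rightarrow> 'b" +
  fixes U :: "'a \<Rightarrow> 'b" and V :: "'b \<Rightarrow> 'a"
  assumes UV: "unitary_pair U V" and S_U: "S i (U x) = U (T i x)"
begin

lemmas bop_U = unitary_pair_bop(1)[OF UV]
lemmas bop_V = unitary_pair_bop(2)[OF UV]
lemmas UV_simps [simp] = unitary_pair_inverse[OF UV]

abbreviation Uvec :: "'a ^ 'n \<Rightarrow> 'b ^ 'n" where "Uvec \<equiv> \<lambda>h. \<chi> i. U (h $ i)"
abbreviation Vvec :: "'b ^ 'n \<Rightarrow> 'a ^ 'n" where "Vvec \<equiv> \<lambda>h. \<chi> i. V (h $ i)"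

lemma Uvec_Vvec: "unitary_pair Uvec Vvec"
  by (rule unitary_pair_vec[OF UV])

lemma Ss_U: "S.Ts i (U x) = U (T.Ts i x)"
proof (rule cinner_eqI)
  fix z
  have "cinner (S.Ts i (U x)) (U (V z)) = cinner (U (T.Ts i x)) (U (V z))"
    by (simp only: S.cinner_Ts_left S_U unitary_pair_cinner[OF UV] T.cinner_Ts_left)
  then show "cinner (S.Ts i (U x)) z = cinner (U (T.Ts i x)) z"
    by simp
qed

lemma Ts_V: "V (S.Ts i y) = T.Ts i (V y)"
  using Ss_U[of i "V y"] UV_simps by metis

lemma szego_inv_U: "szego_inv S (U x) = U (szego_inv T x)"
proof -
  have f: "U ((T i ^^ p) x) = (S i ^^ p) (U x)" "U ((T.Ts i ^^ p) x) = (S.Ts i ^^ p) (U x)" for i p x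
    by (induction p) (simp_all add: S_U[symmetric] Ss_U[symmetric])
  have T: "U (comp_prod (\<lambda>i. T i ^^ k i) UNIV x) = comp_prod (\<lambda>i. S i ^^ k i) UNIV (U x)" for k x
    by (rule comp_prod_conj) (auto intro: funpow_commute T.T_commute S.T_commute f)
  have Ts: "U (comp_prod (\<lambda>i. T.Ts i ^^ k i) UNIV x) = comp_prod (\<lambda>i. S.Ts i ^^ k i) UNIV (U x)" for k x
    by (rule comp_prod_conj) (auto intro: T.Ts_funpow_commute S.Ts_funpow_commute f)
  show ?thesis
    by (simp add: szego_inv_def bop_sum[OF bop_U] bop_scaleR[OF bop_U] T Ts)
qed

lemma defect_star_U: "defect_star S (U x) = U (defect_star T x)"
  unfolding defect_star_def
  by (rule op_sqrt_conj[OF UV T.positive_szego_inv S.positive_szego_inv szego_inv_U])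

lemma id_minus_Delta_U:
  "U \<circ> comp_prod (\<lambda>k. id_minus_Delta (T k)) I A \<circ> V = comp_prod (\<lambda>k. id_minus_Delta (S k)) I (U \<circ> A \<circ> V)"
proof (rule comp_prod_conj[where V = "\<lambda>A. U \<circ> A \<circ> V"])
  show "U \<circ> id_minus_Delta (T i) A \<circ> V = id_minus_Delta (S i) (U \<circ> A \<circ> V)" for i A
    by (rule ext) (simp add: id_minus_Delta_def bop_diff[OF bop_U] S_U Ts_V)
qed (rule T.id_minus_Delta_T_commute S.id_minus_Delta_T_commute finite)+

lemma defect_matrix_sq_U: "defect_matrix_sq S (Uvec h) = Uvec (defect_matrix_sq T h)"
proof -
  have "U \<circ> (defect_op (T j) \<circ> defect_op (T j)) \<circ> V = defect_op (S j) \<circ> defect_op (S j)" for j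
    by (rule ext) (simp add: T.defect_op_square S.defect_op_square bop_diff[OF bop_U] S_U[symmetric]
        Ss_U[symmetric])
  then have "defect_diag j S (U x) = U (defect_diag j T x)" for j x
    using id_minus_Delta_U[of "UNIV - {j}" "defect_op (T j) \<circ> defect_op (T j)"]
    unfolding defect_diag_def by (metis UV_simps(1) comp_apply)
  moreover have "U \<circ> commutator (T j) (T.Ts i) \<circ> V = commutator (S j) (S.Ts i)" for i j
    by (rule ext) (simp add: commutator_def bop_diff[OF bop_U] S_U[symmetric] Ss_U[symmetric])
  then have "defect_offdiag i j S (U x) = U (defect_offdiag i j T x)" for i j x
    using id_minus_Delta_U[of "UNIV - {i, j}" "commutator (T j) (T.Ts i)"]
    unfolding defect_offdiag_def by (metis UV_simps(1) comp_apply)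
  ultimately show ?thesis
    by (simp add: defect_matrix_sq_def vec_eq_iff bop_sum[OF bop_U] if_distribR if_distrib[of U]
        cong: if_cong)
qed

lemma defect_matrix_U: "defect_matrix S (Uvec h) = Uvec (defect_matrix T h)"
  unfolding defect_matrix_def
  by (rule op_sqrt_conj[OF Uvec_Vvec T.positive_defect_matrix_sq S.positive_defect_matrix_sq
        defect_matrix_sq_U])

lemma char_value_U:
  assumes w: "w \<in> polydisc"
  shows "S.char_value w (Uvec h) = U (T.char_value w h)"
proof -
  have res: "U (T.res w i x) = S.res w i (U x)" for i x
    by (simp add: bop_diff[OF bop_U] bop_scaleC[OF bop_U] Ss_U)
  have inv_res: "U (inv (T.res w i) x) = inv (S.res w i) (U x)" for i x
  proof -
    have "S.res w i (U (inv (T.res w i) x)) = U x"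
      using res[where i = i and x = "inv (T.res w i) x"] by (simp only: T.res_inv_res[OF w])
    then show ?thesis
      using S.inv_res_res[OF w, where i = i and x = "U (inv (T.res w i) x)"] by simp
  qed
  have 1: "U (comp_prod (\<lambda>k. inv (T.res w k)) UNIV x) = comp_prod (\<lambda>k. inv (S.res w k)) UNIV (U x)" for x
    by (rule comp_prod_conj)
      (rule T.inv_res_commute[OF w] S.inv_res_commute[OF w] inv_res finite)+
  have 2: "U (comp_prod (T.res w) I x) = comp_prod (S.res w) I (U x)" for I x
    by (rule comp_prod_conj) (rule T.res_commute S.res_commute res finite)+
  show ?thesis
    unfolding T.char_value_def S.char_value_def defect_star_U[symmetric] 1 bop_sum[OF bop_U]
    by (simp add: bop_diff[OF bop_U] bop_scaleC[OF bop_U] S_U[symmetric] 2)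
qed

lemma defect_star_V: "V (defect_star S y) = defect_star T (V y)"
  using arg_cong[OF defect_star_U[of "V y"], of V] by simp

lemma defect_matrix_V: "Vvec (defect_matrix S h) = defect_matrix T (Vvec h)"
  using arg_cong[OF defect_matrix_U[of "Vvec h"], of Vvec] by simp

lemma U_defect_star_space: "x \<in> defect_star_space T \<Longrightarrow> U x \<in> defect_star_space S"
  unfolding defect_star_space_def
  by (rule bop_closure_range[OF bop_U]) (auto simp: defect_star_U[symmetric])

lemma V_defect_star_space: "y \<in> defect_star_space S \<Longrightarrow> V y \<in> defect_star_space T"
  unfolding defect_star_space_def
  by (rule bop_closure_range[OF bop_V]) (auto simp: defect_star_V)

lemma Uvec_defect_space: "x \<in> defect_space T \<Longrightarrow> Uvec x \<in> defect_space S"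
  unfolding defect_space_def
  by (rule bop_closure_range[OF unitary_pair_bop(1)[OF Uvec_Vvec]])
    (rule exI, rule defect_matrix_U[symmetric])

lemma Vvec_defect_space: "y \<in> defect_space S \<Longrightarrow> Vvec y \<in> defect_space T"
  unfolding defect_space_def
  by (rule bop_closure_range[OF unitary_pair_bop(2)[OF Uvec_Vvec]])
    (rule exI, rule defect_matrix_V)

lemma char_fun_V:
  assumes w: "w \<in> polydisc" and x: "x \<in> defect_space S"
  shows "char_fun T w (Vvec x) = V (char_fun S w x)"
proof -
  let ?\<Theta> = "restrict (\<lambda>x. V (char_fun S w (Uvec x))) (defect_space T)"
  note S = S.char_fun_bounded[OF w] and D = T.csubspace_defect_space
  obtain K where K: "\<And>x. x \<in> defect_space S \<Longrightarrow> norm (char_fun S w x) \<le> K * norm x"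
    using S unfolding bounded_ops_def by blast
  have normU: "norm (Uvec x) = norm x" for x
    using unitary_pair_cinner(1)[OF Uvec_Vvec, of x x] by (simp add: norm_eq_sqrt_inner inner_eq_Re_cinner)
  have normV: "norm (V x) = norm x" for x
    using unitary_pair_cinner(2)[OF UV, of x x] by (simp add: norm_eq_sqrt_inner inner_eq_Re_cinner)
  have "?\<Theta> \<in> bounded_ops (defect_space T) (defect_star_space T)"
    unfolding bounded_ops_def
  proof (intro CollectI conjI ballI allI exI[of _ K])
    show "?\<Theta> \<in> defect_space T \<rightarrow>\<^sub>E defect_star_space T"
      using V_defect_star_space bounded_ops_in[OF S] Uvec_defect_space by auto
    fix x assume x: "x \<in> defect_space T"
    show "norm (?\<Theta> x) \<le> K * norm x"
      using K[OF Uvec_defect_space[OF x]] x by (simp add: normU normV)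
    show "?\<Theta> (c *\<^sub>C x) = c *\<^sub>C ?\<Theta> x" for c
      using x csubspace_scaleC[OF D x]
      by (simp add: bop_scaleC[OF unitary_pair_bop(1)[OF Uvec_Vvec]] bounded_ops_scaleC[OF S]
          Uvec_defect_space bop_scaleC[OF bop_V] del: vec_lambda_beta)
    show "?\<Theta> (x + y) = ?\<Theta> x + ?\<Theta> y" if y: "y \<in> defect_space T" for y
    proof -
      have "char_fun S w (Uvec (x + y)) = char_fun S w (Uvec x) + char_fun S w (Uvec y)"
        unfolding bop_add[OF unitary_pair_bop(1)[OF Uvec_Vvec]]
        by (rule bounded_ops_add[OF S Uvec_defect_space[OF x] Uvec_defect_space[OF y]])
      then show ?thesis
        using x y csubspace_add[OF D x y] by (simp add: bop_add[OF bop_V])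
    qed
  qed
  moreover have "?\<Theta> (defect_matrix T h) = T.char_value w h" for h
    by (simp add: T.defect_matrix_in defect_matrix_U[symmetric] S.char_fun_defect_matrix[OF w]
        char_value_U[OF w])
  ultimately have "char_fun T w = ?\<Theta>"
    by (rule T.char_fun_eqI[OF w])
  then show ?thesis
    using Vvec_defect_space[OF x] unitary_pair_inverse(2)[OF Uvec_Vvec, of x] by simp
qed

lemma coincidence: "coincidence T S (restrict Vvec (defect_space S)) (restrict V (defect_star_space S))"
proof -
  have VU: "unitary_pair V U" "unitary_pair Vvec Uvec"
    using UV Uvec_Vvec by (auto simp: unitary_pair_def intro: cinner_flip)
  show ?thesis
    unfolding coincidence_def
    using bounded_ops_in[OF S.char_fun_bounded]
    by (auto intro!: unitary_on_restrict[OF VU(1) S.csubspace_defect_star_space V_defect_star_space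
          U_defect_star_space] unitary_on_restrict[OF VU(2) S.csubspace_defect_space Vvec_defect_space
          Uvec_defect_space] simp: char_fun_V)
qed

end

theorem theorem7p5:
  fixes T :: "'n::finite \<Rightarrow> 'a::chilbert_space \<Rightarrow> 'a"
    and S :: "'n \<Rightarrow> 'b::chilbert_space \<Rightarrow> 'b"
  assumes "beurling_tuple T"
    and "beurling_tuple S"
  shows "jointly_unitarily_equivalent T S \<longleftrightarrow> char_funs_coincide T S"
proof -
  have T: "beurling T" and S: "beurling S"
    using assms by (auto intro: beurling_tuple_beurling)
  have iff: "char_funs_coincide T S \<longleftrightarrow> (\<exists>\<tau> \<tau>s. coincidence T S \<tau> \<tau>s)"
    by (intro char_funs_coincide_iff beurling.csubspace_defect_space T S)
  show ?thesis
  proof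
    assume "jointly_unitarily_equivalent T S"
    then obtain U where U: "unitary_on UNIV UNIV U" "\<And>i. U \<circ> T i \<circ> adj U = S i"
      unfolding jointly_unitarily_equivalent_def by blast
    have UV: "unitary_pair U (adj U)"
      by (rule unitary_on_UNIV_pair[OF U(1)])
    have "S i (U x) = U (T i x)" for i x
      by (simp add: U(2)[symmetric] unitary_pair_inverse[OF UV])
    then have "equivalent T S U (adj U)"
      using T S UV by (simp add: equivalent_def equivalent_axioms_def)
    then show "char_funs_coincide T S"
      unfolding iff using equivalent.coincidence by blast
  next
    assume "char_funs_coincide T S"
    then show "jointly_unitarily_equivalent T S"
      unfolding iff using coincidence_imp_equivalent[OF T S] by blast
  qed
qed

end
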